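(* There is an absolute constant $C>0$ such that the following holds. Let $g\ge 2$, $\mu_2\ge 0$, and let $\mu=[2^{\mu_2},4g-2]$ or $\mu=[2^{\mu_2},(2g)^2]$. Then any two square-tiled surfaces in $\operatorname{ST}^{hyp}_{Ab}(\mu)$ are connected by a sequence of at most $Cg$ powers of cylinder shears.
   Context: A square-tiled surface on $[n]=\{1,\dots,n\}$ is a triple $\tau=(\tau_R,\tau_G,\tau_B)$ of involutions of $[n]$ (fixed points allowed) such that $\langle\tau_R,\tau_G,\tau_B\rangle$ acts transitively on $[n]$. (Geometrically, $S(\tau)$ is obtained from $n$ right-angled triangles labelled by $[n]$, each with a red horizontal leg, a blue vertical leg and a green hypotenuse, by gluing the colour-$c$ side of triangle $j$ to the colour-$c$ side of triangle $\tau_c(j)$, a side being folded onto itself by a half-turn if $\tau_c(j)=j$.) The dual tricoloured cubic graph $S^*(\tau)$ has vertex set $[n]$, an edge of colour $c$ joining $i\neq j$ for each transposition $(i\,j)$ of $\tau_c$, and a half-edge of colour $c$ at each fixed point of $\tau_c$. Two square-tiled surfaces $\tau,\tau'$ on $[n]$ are isomorphic if $\tau'_c=\sigma\tau_c\sigma^{-1}$ for all $c$ and some $\sigma\in S_n$. The profile of $\tau$ is $(\mu,k)$ where $\mu=[1^{\mu_1},2^{\mu_2},\dots]$ is the cycle type of $\tau_R\tau_G\tau_B$ ($\mu_i$ cycles of length $i$) and $k$ is the total number of fixed points of $\tau_R,\tau_G,\tau_B$; the genus $g$ satisfies $4g-4=\sum_i\mu_i(i-2)-k$. $\operatorname{ST}(\mu)$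 is the set of isomorphism classes of square-tiled surfaces of profile $(\mu,0)$. $\tau$ is Abelian if there is a partition $[n]=A_+\sqcup A_-$ with $\tau_c(A_+)=A_-$ for each $c\in\{R,G,B\}$ (equivalently no fixed points and $S^*(\tau)$ bipartite); $\operatorname{ST}_{Ab}(\mu)$ denotes the Abelian ones. Shears: for distinct colours $i,j$, an $\{i,j\}$-component is an orbit of $\langle\tau_i,\tau_j\rangle$ (a path or a cycle in $S^*(\tau)$). For such a component $c$, $\operatorname{Shear}_{c,i,j}(\tau)$ is obtained by replacing $\tau_i$ on $c$ by $\tau_j|_c$ and $\tau_j$ on $c$ by $(\tau_j\tau_i\tau_j)|_c$, leaving everything else unchanged. Horizontal cylinders are $\{G,B\}$-components and horizontal cylinder shears are $\operatorname{Shear}_{c,G,B},\operatorname{Shear}_{c,B,G}$ for such $c$; vertical cylinders are $\{R,G\}$-components and vertical cylinder shears are $\operatorname{Shear}_{c,R,G},\operatorname{Shear}_{c,G,R}$. A cylinder shear is a horizontal or vertical one; a power of a cylinder shear is an iterate $\operatorname{Shear}_{c,i,j}^m$, $m\ge1$, along the same component $c$ (which stays a component). Hyperellipticity: an automorphism of $\tau$ is $\alpha\in S_n$ commuting with $\tau_R,\tau_G,\tau_B$. For a subgroup $H$ of automorphisms, the quotient $\tau/H$ is the square-tiled surface whose triangles are the $H$-orbits on $[n]$ with the induced involutions. A square-tiled surface of genus $g\ge2$ is hyperelliptic if it has an automorphism $\alpha$ of order $2$ with $\tau/\langle\alpha\rangle$ of genus $0$ (this $\alpha$ is then unique, the hyperelliptic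 involution). $\operatorname{ST}^{hyp}_{Ab}([2^{\mu_2},4g-2])$ is the set of hyperelliptic elements of $\operatorname{ST}_{Ab}([2^{\mu_2},4g-2])$, and $\operatorname{ST}^{hyp}_{Ab}([2^{\mu_2},(2g)^2])$ is the set of hyperelliptic elements of $\operatorname{ST}_{Ab}([2^{\mu_2},(2g)^2])$ whose hyperelliptic involution exchanges the two cycles of length $2g$ of $\tau_R\tau_G\tau_B$. *)

theory Defs
  imports
    Complex_Main
    "HOL-Library.Multiset"
    "HOL-Combinatorics.Orbits"
    "HOL-Algebra.Generated_Groups"
begin

definition Sym :: "'a set \<Rightarrow> ('a \<Rightarrow> 'a) monoid" where
  "Sym X = \<lparr> carrier = {p. p permutes X}, mult = (\<circ>), one = id \<rparr>"

definition group_orbit :: "('a \<Rightarrow> 'a) set \<Rightarrow> 'a \<Rightarrow> 'a set" where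
  "group_orbit H x = (\<lambda>h. h x) ` H"

definition group_orbits :: "('a \<Rightarrow> 'a) set \<Rightarrow> 'a set \<Rightarrow> 'a set set" where
  "group_orbits H X = group_orbit H ` X"


datatype colour = Red | Green | Blue

text \<open>The set of triangles is part of the data, and of arbitrary type, so that the quotient of a
  surface by a group of automorphisms is again such an object, its triangles being the orbits.\<close>

record 'a surface =
  triangles :: "'a set"
  glue :: "colour \<Rightarrow> 'a \<Rightarrow> 'a"

definition square_tiled :: "'a surface \<Rightarrow> bool" where
  "square_tiled S \<longleftrightarrow>
     finite (triangles S) \<and> triangles S \<noteq> {} \<and>
     (\<forall>c. glue S c permutes triangles S \<and> glue S c \<circ> glue S c = id) \<and>
     (\<forall>x \<in> triangles S.
        group_orbit (generate (Sym (triangles S)) {glue S Red, glue S Green, glue S Blue}) x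
          = triangles S)"

definition square_tiled_surfaces :: "nat surface set" where
  "square_tiled_surfaces = {S. square_tiled S \<and> (\<exists>n. triangles S = {1..n})}"

definition iso_rel :: "(nat surface \<times> nat surface) set" where
  "iso_rel = {(S, T). S \<in> square_tiled_surfaces \<and> T \<in> square_tiled_surfaces \<and>
     triangles S = triangles T \<and>
     (\<exists>\<sigma>. \<sigma> permutes triangles S \<and>
        (\<forall>c. glue T c = \<sigma> \<circ> glue S c \<circ> Hilbert_Choice.inv \<sigma>))}"


definition vertex_perm :: "'a surface \<Rightarrow> 'a \<Rightarrow> 'a" where
  "vertex_perm S = glue S Red \<circ> glue S Green \<circ> glue S Blue"

definition vertex_cycles :: "'a surface \<Rightarrow> 'a set set" where
  "vertex_cycles S = orbit (vertex_perm S) ` triangles S"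

text \<open>The cycle type \<open>[1^\<mu>\<^sub>1, 2^\<mu>\<^sub>2, \<dots>]\<close> is encoded as the multiset of the cycle lengths.\<close>

definition cycle_type :: "'a surface \<Rightarrow> nat multiset" where
  "cycle_type S = image_mset card (mset_set (vertex_cycles S))"

definition num_fixed :: "'a surface \<Rightarrow> nat" where
  "num_fixed S = (\<Sum>c \<in> {Red, Green, Blue}. card {x \<in> triangles S. glue S c x = x})"

definition profile :: "'a surface \<Rightarrow> nat multiset \<times> nat" where
  "profile S = (cycle_type S, num_fixed S)"

definition has_genus :: "'a surface \<Rightarrow> nat \<Rightarrow> bool" where
  "has_genus S g \<longleftrightarrow>
     4 * int g - 4 = (\<Sum>i \<in># cycle_type S. int i - 2) - int (num_fixed S)"

definition Abelian :: "'a surface \<Rightarrow> bool" where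
  "Abelian S \<longleftrightarrow>
     (\<exists>A B. A \<union> B = triangles S \<and> A \<inter> B = {} \<and> (\<forall>c. glue S c ` A = B))"


definition automorphism :: "'a surface \<Rightarrow> ('a \<Rightarrow> 'a) \<Rightarrow> bool" where
  "automorphism S \<alpha> \<longleftrightarrow>
     \<alpha> permutes triangles S \<and> (\<forall>c. \<alpha> \<circ> glue S c = glue S c \<circ> \<alpha>)"

text \<open>Since automorphisms commute with the gluing involutions, these send orbits to orbits. The
  identity outside the set of orbits is the convention of \<open>permutes\<close>.\<close>

definition quotient_surface :: "'a surface \<Rightarrow> ('a \<Rightarrow> 'a) set \<Rightarrow> 'a set surface" where
  "quotient_surface S H =
     \<lparr> triangles = group_orbits H (triangles S),
       glue = (\<lambda>c Q. if Q \<in> group_orbits H (triangles S) then glue S c ` Q else Q) \<rparr>"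

definition hyperelliptic_involution :: "'a surface \<Rightarrow> ('a \<Rightarrow> 'a) \<Rightarrow> bool" where
  "hyperelliptic_involution S \<alpha> \<longleftrightarrow>
     automorphism S \<alpha> \<and> \<alpha> \<noteq> id \<and> \<alpha> \<circ> \<alpha> = id \<and>
     has_genus (quotient_surface S (generate (Sym (triangles S)) {\<alpha>})) 0"

definition hyperelliptic :: "'a surface \<Rightarrow> bool" where
  "hyperelliptic S \<longleftrightarrow>
     (\<exists>g \<ge> 2. has_genus S g) \<and> (\<exists>\<alpha>. hyperelliptic_involution S \<alpha>)"


definition ST_Ab :: "nat multiset \<Rightarrow> nat surface set set" where
  "ST_Ab \<mu> = {S \<in> square_tiled_surfaces. profile S = (\<mu>, 0) \<and> Abelian S} // iso_rel"

definition profile_one :: "nat \<Rightarrow> nat \<Rightarrow> nat multiset" where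
  "profile_one m g = replicate_mset m 2 + {#4 * g - 2#}"

definition profile_two :: "nat \<Rightarrow> nat \<Rightarrow> nat multiset" where
  "profile_two m g = replicate_mset m 2 + {#2 * g, 2 * g#}"

definition ST_Ab_hyp_one :: "nat \<Rightarrow> nat \<Rightarrow> nat surface set set" where
  "ST_Ab_hyp_one m g = {K \<in> ST_Ab (profile_one m g). \<exists>S \<in> K. hyperelliptic S}"

text \<open>For \<open>g \<ge> 2\<close> the hyperelliptic involution is unique, so the existential quantifier over
  \<open>\<alpha>\<close> amounts to speaking of \<^emph>\<open>the\<close> hyperelliptic involution.\<close>

definition ST_Ab_hyp_two :: "nat \<Rightarrow> nat \<Rightarrow> nat surface set set" where
  "ST_Ab_hyp_two m g = {K \<in> ST_Ab (profile_two m g). \<exists>S \<in> K. hyperelliptic S \<and>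
     (\<exists>\<alpha> P Q. hyperelliptic_involution S \<alpha> \<and>
        P \<noteq> Q \<and> {Z \<in> vertex_cycles S. card Z = 2 * g} = {P, Q} \<and>
        \<alpha> ` P = Q \<and> \<alpha> ` Q = P)}"


definition components :: "'a surface \<Rightarrow> colour \<Rightarrow> colour \<Rightarrow> 'a set set" where
  "components S i j =
     group_orbits (generate (Sym (triangles S)) {glue S i, glue S j}) (triangles S)"

definition shear :: "'a set \<Rightarrow> colour \<Rightarrow> colour \<Rightarrow> 'a surface \<Rightarrow> 'a surface" where
  "shear C i j S = S\<lparr> glue := (glue S)
     (i := (\<lambda>x. if x \<in> C then glue S j x else glue S i x),
      j := (\<lambda>x. if x \<in> C then glue S j (glue S i (glue S j x)) else glue S j x)) \<rparr>"

definition cylinder_shear_power :: "'a surface \<Rightarrow> 'a surface \<Rightarrow> bool" where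
  "cylinder_shear_power S T \<longleftrightarrow>
     (\<exists>i j C m.
        (i, j) \<in> {(Green, Blue), (Blue, Green), (Red, Green), (Green, Red)} \<and>
        C \<in> components S i j \<and> m \<ge> 1 \<and> T = (shear C i j ^^ m) S)"

text \<open>The relation on isomorphism classes. Restricting to the quotient matters: for arbitrary sets
  of surfaces the existence of representatives would be meaningless.\<close>

definition cylinder_move :: "(nat surface set \<times> nat surface set) set" where
  "cylinder_move = {(K, L). K \<in> square_tiled_surfaces // iso_rel \<and>
     L \<in> square_tiled_surfaces // iso_rel \<and> (\<exists>S \<in> K. \<exists>T \<in> L. cylinder_shear_power S T)}"

end

theory Submission
  imports
    Defs
    "HOL-Combinatorics.Cycles"
    "HOL-Number_Theory.Cong"
begin

text \<open>An Abelian surface with positive triangles \<open>X\<close> is an origami: a pair of permutations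
  \<open>r = \<tau>\<^sub>B \<tau>\<^sub>G\<close> and \<open>u = \<tau>\<^sub>R \<tau>\<^sub>G\<close> of \<open>X\<close>. Powers of cylinder shears replace \<open>r\<close> by \<open>r\<close> composed with
  a power of one cycle of \<open>u\<close>, or \<open>u\<close> by \<open>u\<close> composed with a power of one cycle of \<open>r\<close>.
  The hyperelliptic involution \<open>\<alpha>\<close> becomes the involution \<open>b = \<tau>\<^sub>G \<alpha>\<close> of \<open>X\<close>, which inverts \<open>r\<close> and \<open>u\<close>;
  the quotient has genus 0 iff \<open>b\<close> has \<open>d + 2\<close> poles, where \<open>d\<close> is the number of squares at the
  singularities of the quotient, \<open>d = 2 g - 1\<close> or \<open>d = 2 g\<close>.

  Counting poles and using connectedness, every horizontal or vertical cylinder is mapped to itself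
  by \<open>b\<close>. Hence the shear of a single row keeps the surface hyperelliptic, although it need not
  descend to the quotient. If there are at least two horizontal cylinders, two adjacent ones can be
  twisted so that some vertical cycle crosses each of their rows exactly once; shearing along it merges
  all these rows into one, whatever their number. So \<open>O(d)\<close> moves lead to a single row, where the pole
  count forces the gluing \<open>\<tau>\<^sub>R\<close> to reverse \<open>d\<close> consecutive blocks. Two adjacent blocks of lengths
  \<open>(a, b)\<close> form a torus with a slit and can be changed into \<open>(1, a + b - 1)\<close> in boundedly many moves, which
  leads to the normal form \<open>(N - d + 1, 1, \<dots>, 1)\<close>.\<close>

section \<open>Cycles of permutations of a finite set\<close>

text \<open>Any twist of one cylinder costs one move and relabelling costs nothing, so the bound has
  to come from the number of singularities and not from the number of squares, which
  \<open>m\<close> copies of the cycle length 2 make arbitrarily large. Invariance of cylinders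
  rests on two opposite inequalities. A reflection of a cycle and the next reflection have together
  at most two fixed points, which bounds the poles by the number of reflected cycles. The rows,
  joined when \<open>b\<close> or \<open>u \<circ> b\<close> leads from one to the other, form a
  connected graph, which needs as many edges as a tree. Together they leave no cylinder without a
  middle. This is vital because a shear moves one row and not its mirror row: the involution
  survives only because both lie in one cylinder, where \<open>b\<close> can be corrected on the
  rows between them. The constant: 3 moves for each of at most \<open>d\<close> cylinders, 4 moves
  for each of \<open>d - 1\<close> pairs of blocks and one last twist, so at most
  \<open>8 * d\<close> to the normal form. Shears have finite order and can be undone, so
  \<open>16 * d\<close> moves join two surfaces, and \<open>d \<le> 2 * g\<close> gives 32.\<close>

lemma permutes_self_in_orbit:
  assumes "finite X" "f permutes X"
  shows "x \<in> orbit f x"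
  using assms permutation_permutes permutation_self_in_orbit by metis

lemma permutes_orbit_altdef:
  assumes "finite X" "f permutes X"
  shows "orbit f x = {(f ^^ n) x | n. True}"
  using assms permutation_permutes orbit_altdef_permutation by metis

lemma permutes_in_orbit_step_iff:
  assumes "finite X" "f permutes X"
  shows "f y \<in> orbit f x \<longleftrightarrow> y \<in> orbit f x"
proof
  assume y: "f y \<in> orbit f x"
  have "y \<in> orbit f (f y)"
    using permutation_orbit_step[of f y] permutes_self_in_orbit[OF assms, of y] assms
      permutation_permutes[of f] by fastforce
  then show "y \<in> orbit f x" using y orbit_trans by fast
qed (rule orbit.step)

lemma permutes_orbit_eq:
  assumes "finite X" "f permutes X" "y \<in> orbit f x"
  shows "orbit f y = orbit f x"
proof -
  have "x \<in> orbit f y"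
    using orbit_swap[OF permutes_self_in_orbit[OF assms(1,2)] assms(3)] .
  then show ?thesis using assms(3) orbit_trans by fast
qed

lemma orbit_subset_closed:
  assumes "x \<in> A" "\<And>y. y \<in> A \<Longrightarrow> f y \<in> A"
  shows "orbit f x \<subseteq> A"
proof
  fix y assume "y \<in> orbit f x"
  then show "y \<in> A" by induction (use assms in auto)
qed

lemma permutes_funpow_id:
  assumes "finite X" "f permutes X"
  shows "\<exists>k>0. f ^^ k = id"
proof -
  have "permutation f" using assms permutation_permutes by blast
  then show ?thesis by (rule permutation_is_nilpotent) blast
qed

text \<open>Finiteness turns forward invariance into backward invariance: \<open>x\<close> lies on
  the forward orbit of \<open>f x\<close>.\<close>

lemma permutes_inv_closed:
  assumes "finite X" "f permutes X" "\<And>y. y \<in> A \<Longrightarrow> f y \<in> A" "f x \<in> A"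
  shows "x \<in> A"
proof -
  have "orbit f (f x) \<subseteq> A" using assms(3,4) by (intro orbit_subset_closed) auto
  moreover have "x \<in> orbit f (f x)"
    using permutes_orbit_eq[OF assms(1,2) orbit.base, of x] permutes_self_in_orbit[OF assms(1,2), of x]
    by simp
  ultimately show ?thesis by auto
qed

definition rows :: "'a set \<Rightarrow> ('a \<Rightarrow> 'a) \<Rightarrow> 'a set set" where
  "rows X f = orbit f ` X"

lemma finite_rows: "finite X \<Longrightarrow> finite (rows X f)"
  by (simp add: rows_def)

lemma row_eq_orbit:
  assumes "finite X" "f permutes X" "C \<in> rows X f" "x \<in> C"
  shows "C = orbit f x"
proof -
  obtain y where "C = orbit f y" using assms(3) by (auto simp: rows_def)
  then show ?thesis using permutes_orbit_eq[OF assms(1,2)] assms(4) by simp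
qed

lemma row_subset:
  assumes "f permutes X" "C \<in> rows X f"
  shows "C \<subseteq> X"
proof -
  obtain y where "C = orbit f y" "y \<in> X" using assms(2) by (auto simp: rows_def)
  then show ?thesis using permutes_orbit_subset[OF assms(1)] by simp
qed

lemma row_nonempty: "C \<in> rows X f \<Longrightarrow> C \<noteq> {}"
  by (auto simp: rows_def orbit_nonempty)

lemma row_step_iff:
  assumes "finite X" "f permutes X" "C \<in> rows X f"
  shows "f x \<in> C \<longleftrightarrow> x \<in> C"
proof -
  obtain y where "C = orbit f y" using assms(3) by (auto simp: rows_def)
  then show ?thesis using permutes_in_orbit_step_iff[OF assms(1,2)] by simp
qed

lemma rows_disjoint:
  assumes "finite X" "f permutes X" "C \<in> rows X f" "D \<in> rows X f" "x \<in> C" "x \<in> D"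
  shows "C = D"
  using row_eq_orbit[OF assms(1,2,3,5)] row_eq_orbit[OF assms(1,2,4,6)] by simp

lemma card_rows_le:
  assumes "finite X" "f permutes X" "finite Y" "\<And>C. C \<in> A \<Longrightarrow> C \<in> rows X f \<and> C \<inter> Y \<noteq> {}"
  shows "card A \<le> card Y"
proof -
  have "\<forall>C \<in> A. \<exists>y. y \<in> C \<inter> Y" using assms(4) by blast
  then obtain g where g: "\<And>C. C \<in> A \<Longrightarrow> g C \<in> C \<inter> Y" using bchoice by metis
  have "inj_on g A"
  proof (rule inj_onI)
    fix C D assume *: "C \<in> A" "D \<in> A" "g C = g D"
    have "g C \<in> C" "g C \<in> D" using g[OF *(1)] g[OF *(2)] *(3) by simp_all
    then show "C = D"
      using rows_disjoint[OF assms(1,2)] assms(4)[OF *(1)] assms(4)[OF *(2)] by blast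
  qed
  moreover have "g ` A \<subseteq> Y" using g by auto
  ultimately show ?thesis using assms(3) card_inj_on_le by blast
qed

section \<open>Involutions inverting a permutation\<close>

lemma card_le_two: "A \<subseteq> {a, b} \<Longrightarrow> card A \<le> 2"
  by (rule order_trans[OF card_mono[of "{a, b}"]]) (auto simp: card_insert_if)

text \<open>Counts the fixed points of the reflections \<open>i \<mapsto> k - i\<close> and
  \<open>i \<mapsto> k + 1 - i\<close> of a cycle of length \<open>n\<close>. For even
  \<open>n\<close> one of the two right-hand sides is odd and never attained, while the other is
  attained at most twice; for odd \<open>n\<close> doubling is injective.\<close>

lemma two_mult_count:
  fixes n k :: nat
  assumes "k < n"
  shows "card {i. i < n \<and> (2 * i) mod n = k} + card {i. i < n \<and> (2 * i) mod n = (k + 1) mod n} \<le> 2"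
proof (cases "even n")
  case True
  have e: "even ((2 * i) mod n)" for i using True by (simp add: dvd_mod_iff)
  have *: "card {i. i < n \<and> (2 * i) mod n = j} \<le> 2" if "j < n" for j
  proof -
    have "{i. i < n \<and> (2 * i) mod n = j} \<subseteq> {j div 2, (j + n) div 2}"
    proof
      fix i assume i: "i \<in> {i. i < n \<and> (2 * i) mod n = j}"
      show "i \<in> {j div 2, (j + n) div 2}"
      proof (cases "2 * i < n")
        case True then show ?thesis using i by auto
      next
        case False
        then have "(2 * i) mod n = (2 * i - n) mod n" by (simp add: le_mod_geq)
        moreover have "2 * i - n < n" using i by auto
        ultimately have "(2 * i) mod n = 2 * i - n" by simp
        then show ?thesis using i False by auto
      qed
    qed
    then show ?thesis by (rule card_le_two)
  qed
  show ?thesis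
  proof (cases "even k")
    case True
    then have "odd ((k + 1) mod n)" using \<open>even n\<close> by (simp add: dvd_mod_iff)
    then have "{i. i < n \<and> (2 * i) mod n = (k + 1) mod n} = {}" using e by (metis (mono_tags, lifting) empty_Collect_eq)
    then show ?thesis using *[OF assms] by (simp only: card.empty add_0_right)
  next
    case False
    then have "{i. i < n \<and> (2 * i) mod n = k} = {}" using e by (metis (mono_tags, lifting) empty_Collect_eq)
    moreover have "(k + 1) mod n < n" using assms by simp
    ultimately show ?thesis using *[of "(k + 1) mod n"] by (simp only: card.empty add_0)
  qed
next
  case False
  have *: "card {i. i < n \<and> (2 * i) mod n = j} \<le> 1" for j
  proof -
    have "i = i'" if i: "i < n" "i' < n" "(2 * i) mod n = j" "(2 * i') mod n = j" for i i'
    proof -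
      have "(2 * i) mod n = (if 2 * i < n then 2 * i else 2 * i - n)"
        "(2 * i') mod n = (if 2 * i' < n then 2 * i' else 2 * i' - n)"
        using i(1,2) by (simp_all add: mod_if)
      then have "2 * i = 2 * i' \<or> 2 * i = 2 * i' + n \<or> 2 * i' = 2 * i + n"
        using i by (auto split: if_splits)
      then show ?thesis using False by presburger
    qed
    then show ?thesis by (subst One_nat_def, subst card_le_Suc0_iff_eq) auto
  qed
  show ?thesis using *[of k] *[of "(k + 1) mod n"] by simp
qed

lemma card_split_rows:
  assumes "finite X" "f permutes X"
  shows "card {x \<in> X. P x} = (\<Sum>C \<in> rows X f. card {x \<in> C. P x})"
proof -
  have "x \<in> orbit f x" for x by (rule permutes_self_in_orbit[OF assms])
  then have "{x \<in> X. P x} = (\<Union>C \<in> rows X f. {x \<in> C. P x})"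
    using row_subset[OF assms(2)] by (auto simp: rows_def)
  also have "card \<dots> = (\<Sum>C \<in> rows X f. card {x \<in> C. P x})"
  proof (rule card_UN_disjoint)
    show "\<forall>C\<in>rows X f. \<forall>D\<in>rows X f. C \<noteq> D \<longrightarrow> {x \<in> C. P x} \<inter> {x \<in> D. P x} = {}"
      using rows_disjoint[OF assms] by blast
    show "\<forall>C\<in>rows X f. finite {x \<in> C. P x}"
    proof
      fix C assume "C \<in> rows X f"
      then have "finite C" using row_subset[OF assms(2)] assms(1) finite_subset by blast
      then show "finite {x \<in> C. P x}" by simp
    qed
  qed (simp add: finite_rows assms(1))
  finally show ?thesis .
qed

text \<open>The dihedral relation: \<open>g\<close> is an involution that conjugates
  \<open>f\<close> to its inverse, written without the inverse.\<close>

definition inverts :: "('a \<Rightarrow> 'a) \<Rightarrow> ('a \<Rightarrow> 'a) \<Rightarrow> bool" where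
  "inverts g f \<longleftrightarrow> (\<forall>x. g (g x) = x) \<and> (\<forall>x. f (g (f x)) = g x)"

lemma inverts_image_orbit:
  assumes "finite X" "f permutes X" "inverts g f"
  shows "g ` orbit f x = orbit f (g x)"
proof -
  have *: "g ` orbit f x \<subseteq> orbit f (g x)" for x
  proof -
    have "orbit f x \<subseteq> {y. g y \<in> orbit f (g x)}"
    proof (rule orbit_subset_closed)
      show "x \<in> {y. g y \<in> orbit f (g x)}" using permutes_self_in_orbit[OF assms(1,2)] by simp
      fix y assume "y \<in> {y. g y \<in> orbit f (g x)}"
      then have "f (g (f y)) \<in> orbit f (g x)" using assms(3) by (simp add: inverts_def)
      then show "f y \<in> {y. g y \<in> orbit f (g x)}"
        using permutes_in_orbit_step_iff[OF assms(1,2)] by simp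
    qed
    then show ?thesis by auto
  qed
  have gg: "g (g y) = y" for y using assms(3) by (simp add: inverts_def)
  have "g ` g ` orbit f (g x) \<subseteq> g ` orbit f x" using *[of "g x"] gg by (intro image_mono) simp
  then have "orbit f (g x) \<subseteq> g ` orbit f x" by (simp add: image_image gg)
  then show ?thesis using * by blast
qed

lemma inverts_funpow:
  assumes "inverts g f"
  shows "(f ^^ i) (g ((f ^^ i) x)) = g x"
proof (induction i)
  case (Suc i)
  have "(f ^^ Suc i) (g ((f ^^ Suc i) x)) = (f ^^ i) (f (g (f ((f ^^ i) x))))"
    by (simp add: funpow_swap1)
  then show ?case using Suc assms by (simp add: inverts_def)
qed simp

lemma row_coords:
  assumes "finite X" "f permutes X" "C \<in> rows X f" "a \<in> C"
  obtains n where "n > 0" "C = (\<lambda>i. (f ^^ i) a) ` {..<n}" "inj_on (\<lambda>i. (f ^^ i) a) {..<n}"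
    "\<And>i j. (f ^^ i) a = (f ^^ j) a \<longleftrightarrow> i mod n = j mod n"
proof -
  let ?n = "funpow_dist1 f a a"
  have C: "C = orbit f a" by (rule row_eq_orbit[OF assms])
  have a: "a \<in> orbit f a" by (rule permutes_self_in_orbit[OF assms(1,2)])
  have 1: "C = (\<lambda>i. (f ^^ i) a) ` {..<?n}"
    using orbit_conv_funpow_dist1[OF a] C by (simp add: lessThan_atLeast0)
  have 2: "inj_on (\<lambda>i. (f ^^ i) a) {..<?n}"
    using inj_on_funpow_dist1[OF a] by (simp add: lessThan_atLeast0)
  have 3: "(f ^^ ?n) a = a" using funpow_dist1_prop[OF a] .
  have "(f ^^ i) a = (f ^^ j) a \<longleftrightarrow> i mod ?n = j mod ?n" for i j
  proof -
    have "(f ^^ i) a = (f ^^ j) a \<longleftrightarrow> (f ^^ (i mod ?n)) a = (f ^^ (j mod ?n)) a"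
      by (simp only: funpow_mod_eq[OF 3])
    also have "\<dots> \<longleftrightarrow> i mod ?n = j mod ?n"
      using inj_on_eq_iff[OF 2, of "i mod ?n" "j mod ?n"] by simp
    finally show ?thesis .
  qed
  then show ?thesis using that[of ?n] 1 2 by simp
qed

text \<open>A fixed point of \<open>g\<close> or of \<open>f \<circ> g\<close> forces
  \<open>g\<close> to map its row to itself. In the coordinates \<open>(f ^^ i) a\<close> of such a
  row \<open>g\<close> acts as \<open>i \<mapsto> k - i\<close>, so the fixed points solve
  \<open>2 * i = k\<close> and \<open>2 * i = k + 1\<close> modulo the length.\<close>

lemma reflection_count_row:
  assumes "finite X" "f permutes X" "inverts g f" "C \<in> rows X f"
  shows "card {x \<in> C. g x = x} + card {x \<in> C. f (g x) = x} \<le> (if g ` C = C then 2 else 0)"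
proof -
  have gC: "g ` C = C" if "x \<in> C" "g x = x \<or> f (g x) = x" for x
  proof -
    have "g x \<in> C" using that row_step_iff[OF assms(1,2,4), of "g x"] by metis
    moreover have "C = orbit f x" by (rule row_eq_orbit[OF assms(1,2,4) that(1)])
    moreover have "g ` orbit f x = orbit f (g x)" by (rule inverts_image_orbit[OF assms(1-3)])
    ultimately show ?thesis using row_eq_orbit[OF assms(1,2,4)] by metis
  qed
  show ?thesis
  proof (cases "g ` C = C")
    case False
    then have e: "{x \<in> C. g x = x} = {}" "{x \<in> C. f (g x) = x} = {}" using gC by auto
    show ?thesis unfolding e by simp
  next
    case True
    obtain a where a: "a \<in> C" using row_nonempty[OF assms(4)] by blast
    obtain n where n: "n > 0" "C = (\<lambda>i. (f ^^ i) a) ` {..<n}"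
      "\<And>i j. (f ^^ i) a = (f ^^ j) a \<longleftrightarrow> i mod n = j mod n"
      using row_coords[OF assms(1,2,4) a] by metis
    have "g a \<in> C" using True a by blast
    then obtain k where k: "k < n" "g a = (f ^^ k) a" using n(2) by auto
    have "card {x \<in> C. g x = x} \<le> card {i. i < n \<and> (2 * i) mod n = k}"
    proof (rule surj_card_le[where f = "\<lambda>i. (f ^^ i) a"])
      show "{x \<in> C. g x = x} \<subseteq> (\<lambda>i. (f ^^ i) a) ` {i. i < n \<and> (2 * i) mod n = k}"
      proof
        fix x assume "x \<in> {x \<in> C. g x = x}"
        then obtain i where i: "i < n" "x = (f ^^ i) a" "g x = x" using n(2) by auto
        have "(f ^^ (i + i)) a = (f ^^ k) a"
          using inverts_funpow[OF assms(3), of i a] i k by (simp add: funpow_add)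
        then have "(2 * i) mod n = k" using n(3) k(1) by (simp add: mult_2)
        then show "x \<in> (\<lambda>i. (f ^^ i) a) ` {i. i < n \<and> (2 * i) mod n = k}" using i by blast
      qed
    qed simp
    moreover have "card {x \<in> C. f (g x) = x} \<le> card {i. i < n \<and> (2 * i) mod n = (k + 1) mod n}"
    proof (rule surj_card_le[where f = "\<lambda>i. (f ^^ i) a"])
      show "{x \<in> C. f (g x) = x} \<subseteq> (\<lambda>i. (f ^^ i) a) ` {i. i < n \<and> (2 * i) mod n = (k + 1) mod n}"
      proof
        fix x assume "x \<in> {x \<in> C. f (g x) = x}"
        then obtain i where i: "i < n" "x = (f ^^ i) a" "f (g x) = x" using n(2) by auto
        have "f ((f ^^ i) (g ((f ^^ i) a))) = f (g a)" using inverts_funpow[OF assms(3), of i a] by simp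
        then have "(f ^^ i) (f (g x)) = (f ^^ (k + 1)) a" using i(2) k(2) by (simp add: funpow_swap1)
        then have "(f ^^ (i + i)) a = (f ^^ (k + 1)) a" using i by (simp add: funpow_add)
        then have "(2 * i) mod n = (k + 1) mod n" by (simp add: mult_2 n(3) del: funpow.simps)
        then show "x \<in> (\<lambda>i. (f ^^ i) a) ` {i. i < n \<and> (2 * i) mod n = (k + 1) mod n}" using i by blast
      qed
    qed simp
    ultimately show ?thesis using two_mult_count[OF k(1)] True by simp
  qed
qed

lemma reflection_count:
  assumes "finite X" "f permutes X" "inverts g f"
  shows "card {x \<in> X. g x = x} + card {x \<in> X. f (g x) = x} \<le> 2 * card {C \<in> rows X f. g ` C = C}"
proof -
  have "card {x \<in> X. g x = x} + card {x \<in> X. f (g x) = x}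
      = (\<Sum>C \<in> rows X f. card {x \<in> C. g x = x} + card {x \<in> C. f (g x) = x})"
    by (simp add: card_split_rows[OF assms(1,2)] sum.distrib)
  also have "\<dots> \<le> (\<Sum>C \<in> rows X f. if g ` C = C then 2 else 0)"
    by (intro sum_mono reflection_count_row[OF assms])
  also have "\<dots> = 2 * card {C \<in> rows X f. g ` C = C}"
    using finite_rows[OF assms(1)] by (simp add: sum.If_cases Int_def)
  finally show ?thesis .
qed

section \<open>Hyperelliptic origamis\<close>

text \<open>In the presence of HOL-Algebra, \<open>inv\<close> is the inverse in an implicit group.\<close>

abbreviation pinv :: "('a \<Rightarrow> 'a) \<Rightarrow> 'a \<Rightarrow> 'a" where
  "pinv \<equiv> Hilbert_Choice.inv"

definition origami :: "'a set \<Rightarrow> ('a \<Rightarrow> 'a) \<Rightarrow> ('a \<Rightarrow> 'a) \<Rightarrow> bool" where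
  "origami X r u \<longleftrightarrow> finite X \<and> X \<noteq> {} \<and> r permutes X \<and> u permutes X \<and>
     (\<forall>A \<subseteq> X. A \<noteq> {} \<longrightarrow> r ` A \<subseteq> A \<longrightarrow> u ` A \<subseteq> A \<longrightarrow> A = X)"

text \<open>In the quotient, \<open>b\<close>, \<open>u b\<close> and \<open>r b\<close> are the green, red and blue gluings and \<open>u r b\<close> is the
  vertex permutation, so that the poles are their fixed points.\<close>

definition hyp :: "'a set \<Rightarrow> ('a \<Rightarrow> 'a) \<Rightarrow> ('a \<Rightarrow> 'a) \<Rightarrow> ('a \<Rightarrow> 'a) \<Rightarrow> nat \<Rightarrow> bool" where
  "hyp X r u b d \<longleftrightarrow> origami X r u \<and> b permutes X \<and> inverts b r \<and> inverts b u \<and> d > 0 \<and>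
     card {x \<in> X. u (r x) \<noteq> r (u x)} = d \<and>
     d + 2 \<le> card {x \<in> X. b x = x} + card {x \<in> X. u (b x) = x}
           + card {x \<in> X. r (b x) = x} + card {x \<in> X. u (r (b x)) = x}"

definition cshear :: "('a \<Rightarrow> 'a) \<Rightarrow> ('a \<Rightarrow> 'a) \<Rightarrow> 'a set \<Rightarrow> nat \<Rightarrow> 'a \<Rightarrow> 'a" where
  "cshear r u c t x = r (if x \<in> c then (u ^^ t) x else x)"

lemma origamiD:
  assumes "origami X r u"
  shows "finite X" "r permutes X" "u permutes X" "X \<noteq> {}"
  using assms by (simp_all add: origami_def)

lemma origami_closed:
  assumes "origami X r u" "A \<subseteq> X" "A \<noteq> {}" "\<And>x. x \<in> A \<Longrightarrow> r x \<in> A" "\<And>x. x \<in> A \<Longrightarrow> u x \<in> A"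
  shows "A = X"
  using assms unfolding origami_def by (metis image_subsetI)

lemma origami_swap: "origami X r u \<Longrightarrow> origami X u r"
  unfolding origami_def by blast

lemma permutes_card_preimage:
  assumes "w permutes X"
  shows "card {x \<in> X. P (w x)} = card {x \<in> X. P x}"
proof (rule bij_betw_same_card[of w])
  have "w ` {x \<in> X. P (w x)} = {x \<in> X. P x}"
    using permutes_image[OF assms] permutes_in_image[OF assms] by fastforce
  then show "bij_betw w {x \<in> X. P (w x)} {x \<in> X. P x}"
    using permutes_inj[OF assms] by (simp add: bij_betw_def inj_on_def)
qed

lemma Collect_card_eq:
  "(\<And>x. x \<in> X \<Longrightarrow> P x \<longleftrightarrow> Q x) \<Longrightarrow> card {x \<in> X. P x} = card {x \<in> X. Q x}"
  by (metis (mono_tags, lifting) Collect_cong)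

text \<open>Since \<open>b\<close> inverts \<open>r\<close> and \<open>u\<close>, the maps
  \<open>u \<circ> r \<circ> b\<close> and \<open>r \<circ> u \<circ> b\<close> are inverse to each
  other.\<close>

lemma inverts_fixed_iff:
  assumes "inverts b r" "inverts b u"
  shows "u (r (b x)) = x \<longleftrightarrow> r (u (b x)) = x"
proof -
  have b: "r (b (r y)) = b y" "u (b (u y)) = b y" "b (b y) = y" for y
    using assms by (simp_all add: inverts_def)
  show ?thesis
  proof
    assume *: "u (r (b x)) = x"
    have "r (u (b x)) = r (u (b (u (r (b x)))))" using * by simp
    then show "r (u (b x)) = x" by (simp add: b)
  next
    assume *: "r (u (b x)) = x"
    have "u (r (b x)) = u (r (b (r (u (b x)))))" using * by simp
    then show "u (r (b x)) = x" by (simp add: b)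
  qed
qed

lemma hyp_swap:
  assumes "hyp X r u b d"
  shows "hyp X u r b d"
proof -
  have br: "r (b (r x)) = b x" "b (b x) = x" and bu: "u (b (u x)) = b x" for x
    using assms by (simp_all add: hyp_def inverts_def)
  have "u (r (b x)) = x \<longleftrightarrow> r (u (b x)) = x" for x
    by (rule inverts_fixed_iff) (use assms in \<open>simp_all add: hyp_def\<close>)
  then have "card {x \<in> X. u (r (b x)) = x} = card {x \<in> X. r (u (b x)) = x}" by simp
  moreover have "{x \<in> X. u (r x) \<noteq> r (u x)} = {x \<in> X. r (u x) \<noteq> u (r x)}" by auto
  ultimately show ?thesis using assms unfolding hyp_def
    by (auto simp: origami_swap)
qed

text \<open>Combined with \<open>hyp_swap\<close> this turns the surface upside down, which halves
  the case distinction for shears. A shift along \<open>r\<close> matches the singular squares and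
  the vertex poles, and \<open>b\<close> matches the fixed points of
  \<open>r \<circ> b\<close>.\<close>

lemma hyp_inv:
  assumes "hyp X r u b d"
  shows "hyp X (pinv r) u b d"
proof -
  have o: "origami X r u" and bp: "b permutes X" using assms by (simp_all add: hyp_def)
  have rp: "r permutes X" "finite X" using origamiD[OF o] by auto
  have br: "r (b (r x)) = b x" "b (b x) = x" and bu: "u (b (u x)) = b x" for x
    using assms by (simp_all add: hyp_def inverts_def)
  have ir: "r (pinv r x) = x" "pinv r (r x) = x" for x
    using permutes_inverses[OF rp(1)] by auto
  have bir: "pinv r (b x) = b (r x)" for x
    using br(1)[of x] ir by metis
  have 1: "origami X (pinv r) u"
    unfolding origami_def
  proof (intro conjI allI impI)
    fix A assume A: "A \<subseteq> X" "A \<noteq> {}" "pinv r ` A \<subseteq> A" "u ` A \<subseteq> A"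
    show "A = X"
    proof (rule origami_closed[OF o A(1,2)])
      fix x assume x: "x \<in> A"
      show "u x \<in> A" using A x by auto
      show "r x \<in> A"
        by (rule permutes_inv_closed[OF rp(2) permutes_inv[OF rp(1)]]) (use A x ir in auto)
    qed
  qed (use o rp permutes_inv in \<open>auto simp: origami_def\<close>)
  have 2: "inverts b (pinv r)"
    unfolding inverts_def by (auto simp: br) (metis br(1) ir)
  have "card {x \<in> X. u (pinv r x) \<noteq> pinv r (u x)} = card {x \<in> X. u (pinv r (r x)) \<noteq> pinv r (u (r x))}"
    by (rule permutes_card_preimage[OF rp(1), symmetric])
  also have "\<dots> = card {x \<in> X. u (r x) \<noteq> r (u x)}"
    by (rule Collect_card_eq) (metis ir)
  finally have 3: "card {x \<in> X. u (pinv r x) \<noteq> pinv r (u x)} = card {x \<in> X. u (r x) \<noteq> r (u x)}" .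
  have "card {x \<in> X. pinv r (b x) = x} = card {x \<in> X. b (r (b x)) = b x}"
    by (subst permutes_card_preimage[OF bp, symmetric, of "\<lambda>x. pinv r (b x) = x"])
      (intro Collect_card_eq, metis bir br(2))
  also have "\<dots> = card {x \<in> X. r (b x) = x}"
    by (rule Collect_card_eq) (metis br(2))
  finally have 4: "card {x \<in> X. pinv r (b x) = x} = card {x \<in> X. r (b x) = x}" .
  have "card {x \<in> X. u (pinv r (b x)) = x} = card {x \<in> X. u (pinv r (b (pinv r x))) = pinv r x}"
    by (rule permutes_card_preimage[OF permutes_inv[OF rp(1)], symmetric])
  also have "\<dots> = card {x \<in> X. r (u (b x)) = x}"
    by (rule Collect_card_eq) (metis bir ir)
  also have "\<dots> = card {x \<in> X. u (r (b x)) = x}"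
    by (rule Collect_card_eq) (rule inverts_fixed_iff[symmetric], use assms in \<open>simp_all add: hyp_def\<close>)
  finally have 5: "card {x \<in> X. u (pinv r (b x)) = x} = card {x \<in> X. u (r (b x)) = x}" .
  show ?thesis using assms 1 2 3 4 5 unfolding hyp_def by simp
qed

lemma hyp_conj:
  assumes "hyp X r u b d" "p permutes X"
    and r': "\<And>x. r' (p x) = p (r x)" and u': "\<And>x. u' (p x) = p (u x)"
  shows "\<exists>b'. hyp X r' u' b' d"
proof -
  let ?b = "\<lambda>x. p (b (pinv p x))"
  have o: "origami X r u" and bp: "b permutes X" using assms by (simp_all add: hyp_def)
  have fin: "finite X" using origamiD[OF o] by auto
  have ip: "p (pinv p x) = x" "pinv p (p x) = x" for x
    using permutes_inverses[OF assms(2)] by auto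
  have rr: "r' x = p (r (pinv p x))" and uu: "u' x = p (u (pinv p x))" for x
    using r'[of "pinv p x"] u'[of "pinv p x"] ip by simp_all
  have pc: "(\<lambda>x. p (f (pinv p x))) permutes X" if "f permutes X" for f
    using permutes_compose[OF permutes_compose[OF permutes_inv[OF assms(2)] that] assms(2)]
    by (simp add: comp_def)
  have pi: "p x = p y \<longleftrightarrow> x = y" for x y using permutes_inj[OF assms(2)] by (auto simp: inj_def)
  have rp: "r' permutes X" "u' permutes X"
    using pc[of r] pc[of u] origamiD[OF o] rr uu by presburger+
  have "origami X r' u'"
    unfolding origami_def
  proof (intro conjI allI impI)
    fix A assume A: "A \<subseteq> X" "A \<noteq> {}" "r' ` A \<subseteq> A" "u' ` A \<subseteq> A"
    have "pinv p ` A = X"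
    proof (rule origami_closed[OF o])
      show "pinv p ` A \<subseteq> X" using A(1) permutes_in_image[OF permutes_inv[OF assms(2)]] by auto
      fix x assume "x \<in> pinv p ` A"
      then obtain y where y: "y \<in> A" "x = pinv p y" by auto
      have "r' y \<in> A" "u' y \<in> A" using y A by auto
      moreover have "r x = pinv p (r' y)" "u x = pinv p (u' y)" using y by (simp_all add: rr uu ip)
      ultimately show "r x \<in> pinv p ` A" "u x \<in> pinv p ` A" by auto
    qed (use A in auto)
    then have "p ` pinv p ` A = p ` X" by simp
    then show "A = X" by (simp add: image_image ip permutes_image[OF assms(2)])
  qed (use o rp in \<open>auto simp: origami_def\<close>)
  moreover have "card {x \<in> X. u' (r' x) \<noteq> r' (u' x)} = card {x \<in> X. u (r x) \<noteq> r (u x)}"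
    by (subst permutes_card_preimage[OF assms(2), symmetric]) (simp add: r' u' pi)
  moreover have "card {x \<in> X. ?b x = x} = card {x \<in> X. b x = x}"
    by (subst permutes_card_preimage[OF assms(2), symmetric]) (simp add: ip pi)
  moreover have "card {x \<in> X. u' (?b x) = x} = card {x \<in> X. u (b x) = x}"
    by (subst permutes_card_preimage[OF assms(2), symmetric]) (simp add: ip u' pi)
  moreover have "card {x \<in> X. r' (?b x) = x} = card {x \<in> X. r (b x) = x}"
    by (subst permutes_card_preimage[OF assms(2), symmetric]) (simp add: ip r' pi)
  moreover have "card {x \<in> X. u' (r' (?b x)) = x} = card {x \<in> X. u (r (b x)) = x}"
    by (subst permutes_card_preimage[OF assms(2), symmetric]) (simp add: ip r' u' pi)
  moreover have "inverts ?b r'" "inverts ?b u'"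
    using assms(1) by (simp_all add: hyp_def inverts_def rr uu ip)
  moreover have "?b permutes X" by (rule pc[OF bp])
  ultimately have "hyp X r' u' ?b d" using assms(1) by (simp add: hyp_def)
  then show ?thesis by blast
qed

section \<open>Effect of a shear on an origami and on its involution\<close>

lemma cshear_permutes:
  assumes "finite X" "r permutes X" "u permutes X" "c \<subseteq> X" "\<And>x. u x \<in> c \<longleftrightarrow> x \<in> c"
  shows "cshear r u c t permutes X"
proof -
  have ut: "(u ^^ t) permutes X" using assms(3) by (rule permutes_funpow)
  have cl: "(u ^^ t) x \<in> c \<longleftrightarrow> x \<in> c" for x by (induction t) (simp_all add: assms(5))
  have "(\<lambda>x. if x \<in> c then (u ^^ t) x else x) permutes X"
  proof (rule inj_imp_permutes)
    show "inj_on (\<lambda>x. if x \<in> c then (u ^^ t) x else x) X"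
    proof (rule inj_onI)
      fix x y assume *: "(if x \<in> c then (u ^^ t) x else x) = (if y \<in> c then (u ^^ t) y else y)"
      have "x \<in> c \<longleftrightarrow> y \<in> c" using * cl[of x] cl[of y] by (metis (full_types))
      then show "x = y" using * injD[OF permutes_inj[OF ut], of x y] by (cases "x \<in> c") auto
    qed
    show "finite X" by (rule assms(1))
    show "(if x \<in> c then (u ^^ t) x else x) \<in> X" if "x \<in> X" for x
      using that permutes_in_image[OF ut] by simp
    show "(if x \<in> c then (u ^^ t) x else x) = x" if "x \<notin> X" for x
      using that assms(4) by auto
  qed
  then have "r \<circ> (\<lambda>x. if x \<in> c then (u ^^ t) x else x) permutes X"
    using assms(2) by (rule permutes_compose)
  then show ?thesis by (simp add: cshear_def[abs_def] comp_def)
qed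

text \<open>A finite set closed under \<open>u\<close> is closed under inverse powers of
  \<open>u\<close> as well, and these recover \<open>r\<close> from the sheared map.\<close>

lemma origami_cshear:
  assumes "origami X r u" "c \<subseteq> X" "\<And>x. u x \<in> c \<longleftrightarrow> x \<in> c"
  shows "origami X (cshear r u c t) u"
  unfolding origami_def
proof (intro conjI allI impI)
  note o = origamiD[OF assms(1)]
  show "cshear r u c t permutes X" by (rule cshear_permutes[OF o(1-3) assms(2,3)])
  fix A assume A: "A \<subseteq> X" "A \<noteq> {}" "cshear r u c t ` A \<subseteq> A" "u ` A \<subseteq> A"
  have uA: "(u ^^ n) x \<in> A" if "x \<in> A" for x n using that A(4) by (induction n) auto
  have ut: "(u ^^ t) permutes X" using o(3) by (rule permutes_funpow)
  have cl: "(u ^^ t) x \<in> c \<longleftrightarrow> x \<in> c" for x by (induction t) (simp_all add: assms(3))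
  show "A = X"
  proof (rule origami_closed[OF assms(1) A(1,2)])
    fix x assume x: "x \<in> A"
    show "u x \<in> A" using A x by auto
    show "r x \<in> A"
    proof (cases "x \<in> c")
      case True
      obtain y where y: "x = (u ^^ t) y" using permutes_surj[OF ut] by (metis surjD)
      have "y \<in> A" by (rule permutes_inv_closed[OF o(1) ut]) (use uA x y in auto)
      moreover have "y \<in> c" using True y cl by simp
      ultimately show ?thesis using A(3) y by (force simp: cshear_def)
    next
      case False
      then show ?thesis using A(3) x by (force simp: cshear_def)
    qed
  qed
qed (use origamiD[OF assms(1)] in auto)

text \<open>\<open>J\<close> is a strip of \<open>u\<close>-cycles, symmetric under
  \<open>b\<close>, which \<open>r\<close> leaves only through \<open>c\<close> and enters only
  through the mirror image of \<open>c\<close>, and inside which \<open>r\<close> commutes with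
  \<open>u\<close>. A twist by one step at the exit is compensated by using
  \<open>b \<circ> u\<close> instead of \<open>b\<close> on the whole strip. This exchanges the
  fixed points of \<open>b\<close> with those of \<open>u \<circ> b\<close> on \<open>J\<close>, and
  those of \<open>r \<circ> b\<close> with those of \<open>u \<circ> r \<circ> b\<close> where
  \<open>b\<close> leads to a point of \<open>J\<close> off \<open>c\<close>, so the number of poles
  is unchanged. The last three conclusions restore the hypotheses, so that the step can be
  iterated.\<close>

lemma strip_shear_step:
  assumes h: "hyp X r u b d" and J: "J \<subseteq> X" "c \<subseteq> J"
    and uJ: "\<And>x. u x \<in> J \<longleftrightarrow> x \<in> J" and bJ: "\<And>x. b x \<in> J \<longleftrightarrow> x \<in> J"
    and uc: "\<And>x. u x \<in> c \<longleftrightarrow> x \<in> c"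
    and int: "\<And>x. x \<in> J \<Longrightarrow> x \<notin> c \<Longrightarrow> r x \<in> J \<and> b (r x) \<notin> c \<and> u (r x) = r (u x)"
    and ext: "\<And>x. x \<notin> J \<or> x \<in> c \<Longrightarrow> r x \<notin> J \<or> b (r x) \<in> c"
  defines "r' \<equiv> cshear r u c 1" and "b' \<equiv> \<lambda>x. if x \<in> J then b (u x) else b x"
  shows "hyp X r' u b' d"
    and "\<And>x. b' x \<in> J \<longleftrightarrow> x \<in> J"
    and "\<And>x. x \<in> J \<Longrightarrow> x \<notin> c \<Longrightarrow> r' x \<in> J \<and> b' (r' x) \<notin> c \<and> u (r' x) = r' (u x)"
    and "\<And>x. x \<notin> J \<or> x \<in> c \<Longrightarrow> r' x \<notin> J \<or> b' (r' x) \<in> c"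
proof -
  have o: "origami X r u" and bp: "b permutes X" using h by (simp_all add: hyp_def)
  note op = origamiD[OF o]
  have rbr: "r (b (r x)) = b x" and bb: "b (b x) = x" and ubu: "u (b (u x)) = b x" for x
    using h by (simp_all add: hyp_def inverts_def)
  have r': "r' x = (if x \<in> c then r (u x) else r x)" for x by (simp add: r'_def cshear_def)
  have cJ: "x \<in> c \<Longrightarrow> x \<in> J" for x using J by blast
  have bu_c: "b (u y) \<in> c \<longleftrightarrow> b y \<in> c" for y using uc[of "b (u y)"] ubu by simp
  show bJ': "b' x \<in> J \<longleftrightarrow> x \<in> J" for x by (simp add: b'_def uJ bJ)
  show int': "r' x \<in> J \<and> b' (r' x) \<notin> c \<and> u (r' x) = r' (u x)" if "x \<in> J" "x \<notin> c" for x
    using int[OF that] that bu_c[of "r x"] by (simp add: r' b'_def uc bu_c)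
  show ext': "r' x \<notin> J \<or> b' (r' x) \<in> c" if "x \<notin> J \<or> x \<in> c" for x
    using that ext[of x] ext[of "u x"] cJ by (auto simp: r' b'_def uc bu_c)
  have inv1: "b' (b' x) = x" for x by (simp add: b'_def uJ bJ ubu bb)
  have inv2: "u (b' (u x)) = b' x" for x by (simp add: b'_def uJ ubu)
  have inv3: "r' (b' (r' x)) = b' x" for x
  proof (cases "x \<in> J \<and> x \<notin> c")
    case True
    then have i: "r x \<in> J" "b (r x) \<notin> c" "u (r x) = r (u x)" using int by auto
    have "b' (r' x) = b (r (u x))" using True i by (simp add: r' b'_def)
    moreover have "b (r (u x)) \<notin> c" using i bu_c by metis
    ultimately show ?thesis using True by (simp add: r' rbr b'_def)
  next
    case False
    \<comment> \<open>Here \<open>x\<close> is outside the strip or at its exit, and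
      \<open>y\<close> absorbs the twist.\<close>
    define y where "y = (if x \<in> c then u x else x)"
    have y: "r' x = r y" "b' x = b y" "y \<notin> J \<or> y \<in> c"
      using False cJ by (auto simp: y_def r' b'_def uc)
    show ?thesis
    proof (cases "r y \<in> J")
      case True
      then have "b (r y) \<in> c" using ext y(3) by blast
      then show ?thesis using y True by (simp add: b'_def r' bu_c ubu rbr)
    next
      case False
      then have "b (r y) \<notin> J" by (simp add: bJ)
      then have "b (r y) \<notin> c" using cJ by blast
      then show ?thesis using y False by (simp add: b'_def r' rbr)
    qed
  qed
  have op': "origami X r' u" unfolding r'_def
    by (rule origami_cshear[OF o]) (use J uc in auto)
  have bp': "b' permutes X"
  proof (rule inj_imp_permutes)
    show "inj_on b' X" by (metis inv1 inj_onI)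
  qed (use op bp permutes_in_image[OF bp] permutes_in_image[OF op(3)] J permutes_not_in[OF bp] in
      \<open>auto simp: b'_def\<close>)
  have wp: "(\<lambda>x. if x \<in> c then u x else x) permutes X"
  proof -
    have "c \<subseteq> X" using J by blast
    from cshear_permutes[OF op(1) permutes_id op(3) this uc, of 1]
    show ?thesis by (simp add: cshear_def[abs_def] cong: if_cong)
  qed
  have "card {x \<in> X. u (r' x) \<noteq> r' (u x)}
      = card {x \<in> X. (\<lambda>x. u (r x) \<noteq> r (u x)) (if x \<in> c then u x else x)}"
    by (rule Collect_card_eq) (simp add: r' uc)
  also have "\<dots> = card {x \<in> X. u (r x) \<noteq> r (u x)}" by (rule permutes_card_preimage[OF wp])
  finally have sing: "card {x \<in> X. u (r' x) \<noteq> r' (u x)} = card {x \<in> X. u (r x) \<noteq> r (u x)}" .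
  have split: "card {x \<in> X. P x} = card {x \<in> X. x \<in> S \<and> P x} + card {x \<in> X. x \<notin> S \<and> P x}" for P S
  proof -
    have "{x \<in> X. P x} = {x \<in> X. x \<in> S \<and> P x} \<union> {x \<in> X. x \<notin> S \<and> P x}" by auto
    then show ?thesis using op(1) by (simp add: card_Un_disjoint disjoint_iff)
  qed
  have "card {x \<in> X. x \<in> J \<and> b' x = x} = card {x \<in> X. x \<in> J \<and> u (b x) = x}"
  proof -
    have "card {x \<in> X. x \<in> J \<and> b' x = x} = card {x \<in> X. u x \<in> J \<and> u (b (u x)) = u x}"
      by (rule Collect_card_eq) (auto simp: b'_def uJ permutes_inj[OF op(3)] inj_eq)
    also have "\<dots> = card {x \<in> X. x \<in> J \<and> u (b x) = x}"
      by (rule permutes_card_preimage[OF op(3)])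
    finally show ?thesis .
  qed
  moreover have "card {x \<in> X. x \<in> J \<and> u (b' x) = x} = card {x \<in> X. x \<in> J \<and> b x = x}"
    by (rule Collect_card_eq) (auto simp: b'_def ubu)
  moreover have "card {x \<in> X. x \<notin> J \<and> b' x = x} = card {x \<in> X. x \<notin> J \<and> b x = x}"
    "card {x \<in> X. x \<notin> J \<and> u (b' x) = x} = card {x \<in> X. x \<notin> J \<and> u (b x) = x}"
    by (rule Collect_card_eq; simp add: b'_def cong: conj_cong)+
  ultimately have p1: "card {x \<in> X. b' x = x} + card {x \<in> X. u (b' x) = x}
      = card {x \<in> X. b x = x} + card {x \<in> X. u (b x) = x}"
    using split[of "\<lambda>x. b' x = x" J] split[of "\<lambda>x. u (b' x) = x" J]
      split[of "\<lambda>x. b x = x" J] split[of "\<lambda>x. u (b x) = x" J] by linarith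
  \<comment> \<open>From \<open>K\<close> the involution leads to a point of the strip off
    \<open>c\<close>, where \<open>r\<close> commutes with \<open>u\<close>; elsewhere the twist of
    \<open>r\<close> and the correction of \<open>b\<close> cancel.\<close>
  define K where "K = {x \<in> J. b x \<notin> c}"
  have uK: "u x \<in> K \<longleftrightarrow> x \<in> K" for x by (simp add: K_def uJ bu_c)
  have r1: "r' (b' x) = r (b (u x))" "u (r (b (u x))) = r (b x)" if "x \<in> K" for x
  proof -
    have x: "x \<in> J" "b (u x) \<in> J" "b (u x) \<notin> c" using that by (auto simp: K_def bJ uJ bu_c)
    show "r' (b' x) = r (b (u x))" using x by (simp add: r' b'_def)
    show "u (r (b (u x))) = r (b x)" using int[OF x(2,3)] ubu by simp
  qed
  have r2: "r' (b' x) = r (b x)" if "x \<notin> K" for x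
    using that cJ bJ by (auto simp: K_def r' b'_def bu_c ubu)
  have "card {x \<in> X. x \<in> K \<and> r' (b' x) = x} = card {x \<in> X. x \<in> K \<and> u (r (b x)) = x}"
  proof -
    have "card {x \<in> X. x \<in> K \<and> r' (b' x) = x} = card {x \<in> X. u x \<in> K \<and> u (r (b (u x))) = u x}"
      by (rule Collect_card_eq) (auto simp: r1 uK permutes_inj[OF op(3)] inj_eq)
    also have "\<dots> = card {x \<in> X. x \<in> K \<and> u (r (b x)) = x}"
      by (rule permutes_card_preimage[OF op(3)])
    finally show ?thesis .
  qed
  moreover have "card {x \<in> X. x \<in> K \<and> u (r' (b' x)) = x} = card {x \<in> X. x \<in> K \<and> r (b x) = x}"
    by (rule Collect_card_eq) (auto simp: r1)
  moreover have "card {x \<in> X. x \<notin> K \<and> r' (b' x) = x} = card {x \<in> X. x \<notin> K \<and> r (b x) = x}"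
    "card {x \<in> X. x \<notin> K \<and> u (r' (b' x)) = x} = card {x \<in> X. x \<notin> K \<and> u (r (b x)) = x}"
    by (rule Collect_card_eq; simp add: r2 cong: conj_cong)+
  ultimately have p2: "card {x \<in> X. r' (b' x) = x} + card {x \<in> X. u (r' (b' x)) = x}
      = card {x \<in> X. r (b x) = x} + card {x \<in> X. u (r (b x)) = x}"
    using split[of "\<lambda>x. r' (b' x) = x" K] split[of "\<lambda>x. u (r' (b' x)) = x" K]
      split[of "\<lambda>x. r (b x) = x" K] split[of "\<lambda>x. u (r (b x)) = x" K] by linarith
  show "hyp X r' u b' d"
    using h op' bp' inv1 inv2 inv3 sing p1 p2 by (simp add: hyp_def inverts_def)
qed

lemma cshear_Suc:
  assumes "\<And>x. u x \<in> c \<longleftrightarrow> x \<in> c"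
  shows "cshear (cshear r u c t) u c 1 = cshear r u c (Suc t)"
  by (rule ext) (simp add: cshear_def assms funpow_swap1)

lemma strip_shear:
  assumes "hyp X r u b d" "J \<subseteq> X" "c \<subseteq> J"
    "\<And>x. u x \<in> J \<longleftrightarrow> x \<in> J" "\<And>x. b x \<in> J \<longleftrightarrow> x \<in> J" "\<And>x. u x \<in> c \<longleftrightarrow> x \<in> c"
    "\<And>x. x \<in> J \<Longrightarrow> x \<notin> c \<Longrightarrow> r x \<in> J \<and> b (r x) \<notin> c \<and> u (r x) = r (u x)"
    "\<And>x. x \<notin> J \<or> x \<in> c \<Longrightarrow> r x \<notin> J \<or> b (r x) \<in> c"
  shows "\<exists>b'. hyp X (cshear r u c t) u b' d"
proof -
  let ?r = "\<lambda>t. cshear r u c t"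
  have "\<exists>b'. hyp X (?r t) u b' d \<and> (\<forall>x. b' x \<in> J \<longleftrightarrow> x \<in> J) \<and>
    (\<forall>x. x \<in> J \<longrightarrow> x \<notin> c \<longrightarrow> ?r t x \<in> J \<and> b' (?r t x) \<notin> c \<and> u (?r t x) = ?r t (u x)) \<and>
    (\<forall>x. x \<notin> J \<or> x \<in> c \<longrightarrow> ?r t x \<notin> J \<or> b' (?r t x) \<in> c)"
  proof (induction t)
    case 0
    have "?r 0 = r" by (rule ext) (simp add: cshear_def)
    then show ?case using assms by (intro exI[of _ b]) auto
  next
    case (Suc t)
    then obtain b' where b': "hyp X (?r t) u b' d" "\<And>x. b' x \<in> J \<longleftrightarrow> x \<in> J"
      "\<And>x. x \<in> J \<Longrightarrow> x \<notin> c \<Longrightarrow> ?r t x \<in> J \<and> b' (?r t x) \<notin> c \<and> u (?r t x) = ?r t (u x)"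
      "\<And>x. x \<notin> J \<or> x \<in> c \<Longrightarrow> ?r t x \<notin> J \<or> b' (?r t x) \<in> c" by blast
    note s = strip_shear_step[OF b'(1) assms(2-4) b'(2) assms(6) b'(3,4)]
    show ?case
      using s unfolding cshear_Suc[OF assms(6)] by (intro exI[of _ "\<lambda>x. if x \<in> J then b' (u x) else b' x"]) blast
  qed
  then show ?thesis by blast
qed

section \<open>Counting cylinders\<close>

text \<open>The tree bound. Take a largest \<open>W\<close> with enough edges inside it: if it were
  not \<open>V\<close>, an edge leaving \<open>W\<close> would let it grow by one vertex and at
  least one edge.\<close>

lemma connected_card_le:
  assumes "finite V" "V \<noteq> {}" "finite E"
    and conn: "\<And>W. W \<subseteq> V \<Longrightarrow> W \<noteq> {} \<Longrightarrow> W \<noteq> V \<Longrightarrow> \<exists>x \<in> W. \<exists>y \<in> V - W. {x, y} \<in> E"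
  shows "card V \<le> card E + 1"
proof -
  define P where "P W \<longleftrightarrow> W \<subseteq> V \<and> W \<noteq> {} \<and> card W \<le> card {e \<in> E. e \<subseteq> W} + 1" for W
  obtain v where v: "v \<in> V" using assms(2) by blast
  have "P {v}" using v by (simp add: P_def)
  moreover have "\<forall>W. P W \<longrightarrow> card W < card V + 1"
    using card_mono[OF assms(1)] by (auto simp: P_def less_Suc_eq_le)
  ultimately obtain W where W: "P W" "\<forall>W'. P W' \<longrightarrow> card W' \<le> card W"
    using ex_has_greatest_nat[of P "{v}" card "card V + 1"] by blast
  have "W = V"
  proof (rule ccontr)
    assume "W \<noteq> V"
    then obtain x y where xy: "x \<in> W" "y \<in> V - W" "{x, y} \<in> E"
      using conn W(1) unfolding P_def by blast
    have finW: "finite W" using W(1) assms(1) finite_subset unfolding P_def by blast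
    have "insert {x, y} {e \<in> E. e \<subseteq> W} \<subseteq> {e \<in> E. e \<subseteq> insert y W}" using xy by auto
    then have "card (insert {x, y} {e \<in> E. e \<subseteq> W}) \<le> card {e \<in> E. e \<subseteq> insert y W}"
      using assms(3) by (intro card_mono) auto
    moreover have "card (insert {x, y} {e \<in> E. e \<subseteq> W}) = card {e \<in> E. e \<subseteq> W} + 1"
      using xy assms(3) by (subst card_insert_disjoint) auto
    moreover have "card (insert y W) = card W + 1" using xy finW by simp
    ultimately have "P (insert y W)" using W(1) xy by (auto simp: P_def)
    then show False using W(2) \<open>card (insert y W) = card W + 1\<close> by fastforce
  qed
  then have "card V \<le> card {e \<in> E. e \<subseteq> V} + 1" using W(1) by (simp add: P_def)
  also have "\<dots> \<le> card E + 1" using card_mono[OF assms(3), of "{e \<in> E. e \<subseteq> V}"] by simp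
  finally show ?thesis .
qed

lemma involution_pairs:
  assumes "finite S" "\<And>x. x \<in> S \<Longrightarrow> g x \<in> S" "\<And>x. x \<in> S \<Longrightarrow> g (g x) = x"
  shows "2 * card ((\<lambda>x. {x, g x}) ` {x \<in> S. g x \<noteq> x}) + card {x \<in> S. g x = x} \<le> card S"
proof -
  let ?P = "(\<lambda>x. {x, g x}) ` {x \<in> S. g x \<noteq> x}"
  have "card (\<Union> ?P) = (\<Sum>p \<in> ?P. card p)"
  proof (rule card_Union_disjoint)
    show "disjoint ?P"
    proof (rule disjointI)
      fix p q assume "p \<in> ?P" "q \<in> ?P" "p \<noteq> q"
      then obtain x y where xy: "p = {x, g x}" "q = {y, g y}" "x \<in> S" "y \<in> S" by blast
      show "p \<inter> q = {}"
      proof (rule ccontr)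
        assume "p \<inter> q \<noteq> {}"
        then have "x = y \<or> x = g y \<or> g x = y \<or> g x = g y" using xy by blast
        then have "p = q" unfolding xy(1,2) using assms(3)[OF xy(3)] assms(3)[OF xy(4)] by (metis insert_commute)
        then show False using \<open>p \<noteq> q\<close> by simp
      qed
    qed
  qed auto
  also have "\<dots> = (\<Sum>p \<in> ?P. 2)" by (rule sum.cong) auto
  finally have 1: "card (\<Union> ?P) = 2 * card ?P" by simp
  have "card (\<Union> ?P \<union> {x \<in> S. g x = x}) = card (\<Union> ?P) + card {x \<in> S. g x = x}"
    by (rule card_Un_disjoint) (use assms in auto)
  moreover have "card (\<Union> ?P \<union> {x \<in> S. g x = x}) \<le> card S"
    by (rule card_mono) (use assms in auto)
  ultimately show ?thesis using 1 by simp
qed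

section \<open>The two pole counts and the graph of rows\<close>

locale hyp_origami =
  fixes X :: "'a set" and r u b :: "'a \<Rightarrow> 'a" and d :: nat
  assumes hyp: "hyp X r u b d"
begin

lemma origami: "origami X r u" and b_permutes: "b permutes X" and d_pos: "d > 0"
  and inverts_br: "inverts b r" and inverts_bu: "inverts b u"
  and card_sing: "card {x \<in> X. u (r x) \<noteq> r (u x)} = d"
  and poles: "d + 2 \<le> card {x \<in> X. b x = x} + card {x \<in> X. u (b x) = x}
           + card {x \<in> X. r (b x) = x} + card {x \<in> X. u (r (b x)) = x}"
  using hyp by (simp_all add: hyp_def)

lemmas fin = origamiD(1)[OF origami] and rp = origamiD(2)[OF origami]
  and up = origamiD(3)[OF origami] and ne = origamiD(4)[OF origami]

lemma bb [simp]: "b (b x) = x" and rbr [simp]: "r (b (r x)) = b x" and ubu [simp]: "u (b (u x)) = b x"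
  using inverts_br inverts_bu by (simp_all add: inverts_def)

text \<open>\<open>R\<close> reverses the maximal intervals of rows which end at the points of \<open>E\<close>. At these points \<open>r2\<close>
  jumps to the start of the opposite interval, so that \<open>R\<close> still inverts \<open>r2\<close>; the cycles of \<open>r2\<close> are the
  rows without points of \<open>E\<close> (in \<open>F\<close>) and the unions of two opposite intervals (in \<open>M\<close>).\<close>

definition R :: "'a \<Rightarrow> 'a" where "R x = u (b x)"

definition E :: "'a set" where "E = {y. r (R (r y)) \<noteq> R y}"

definition r2 :: "'a \<Rightarrow> 'a" where "r2 y = (if y \<in> E then R y else r y)"

lemma RR [simp]: "R (R x) = x" by (metis R_def bb ubu)

lemma R_permutes: "R permutes X"
  using permutes_compose[OF b_permutes up] by (simp add: R_def[abs_def] comp_def)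

lemma E_iff: "y \<in> E \<longleftrightarrow> u (r (b (r y))) \<noteq> r (u (b (r y)))"
  by (auto simp: E_def R_def)

lemma E_subset: "E \<subseteq> X"
proof
  fix y assume "y \<in> E"
  then show "y \<in> X"
    using permutes_not_in[OF rp, of y] permutes_not_in[OF R_permutes, of y] by (cases "y \<in> X") (auto simp: E_def)
qed

text \<open>By \<open>E_iff\<close> the bijection \<open>y \<mapsto> b (r y)\<close> carries
  \<open>E\<close> onto the singular squares.\<close>

lemma card_E: "card E = d"
proof -
  have "card E = card {y \<in> X. u (r (b (r y))) \<noteq> r (u (b (r y)))}"
    using E_iff E_subset by (intro arg_cong[where f = card]) auto
  also have "\<dots> = card {y \<in> X. u (r (b y)) \<noteq> r (u (b y))}"
    by (rule permutes_card_preimage[OF rp])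
  also have "\<dots> = d"
    using permutes_card_preimage[OF b_permutes, of "\<lambda>y. u (r y) \<noteq> r (u y)"] card_sing by simp
  finally show ?thesis .
qed

lemma R_E: "y \<in> E \<Longrightarrow> r2 y = R y" and r_E: "y \<notin> E \<Longrightarrow> r2 y = r y"
  by (simp_all add: r2_def)

lemma not_E_D: "y \<notin> E \<Longrightarrow> r (R (r y)) = R y"
  by (simp add: E_def)

lemma not_E_mirror: "y \<notin> E \<Longrightarrow> R (r y) \<notin> E"
  by (simp add: E_def)

lemma inj_r: "r x = r y \<longleftrightarrow> x = y" and inj_R: "R x = R y \<longleftrightarrow> x = y" and inj_b: "b x = b y \<longleftrightarrow> x = y"
  and inj_u: "u x = u y \<longleftrightarrow> x = y"
  using permutes_inj[OF rp] permutes_inj[OF R_permutes] permutes_inj[OF b_permutes] permutes_inj[OF up]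
  by (auto simp: inj_eq)

lemma r2_permutes: "r2 permutes X"
proof (rule inj_imp_permutes)
  have *: False if "x \<in> E" "y \<notin> E" "R x = r y" for x y
  proof -
    have "x = R (r y)" using that(3) by (metis RR)
    then show False using not_E_mirror[OF that(2)] that(1) by simp
  qed
  show "inj_on r2 X"
  proof (rule inj_onI)
    fix x y assume "r2 x = r2 y"
    then show "x = y" using *[of x y] *[of y x]
      by (cases "x \<in> E"; cases "y \<in> E") (auto simp: r2_def inj_r inj_R)
  qed
  show "r2 x \<in> X" if "x \<in> X" for x
    using that permutes_in_image[OF rp] permutes_in_image[OF R_permutes] by (simp add: r2_def)
  show "r2 x = x" if "x \<notin> X" for x
    using that E_subset permutes_not_in[OF rp] by (auto simp: r2_def)
qed (rule fin)

text \<open>Off \<open>E\<close> this is the definition of \<open>E\<close>, since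
  \<open>R (r y)\<close> avoids \<open>E\<close> again; on \<open>E\<close> it holds because
  \<open>r2\<close> is \<open>R\<close> itself there.\<close>

lemma inverts_R_r2: "inverts R r2"
  using not_E_D not_E_mirror by (auto simp: inverts_def r2_def)

lemma vertex_fixed_iff: "u (r (b x)) = x \<longleftrightarrow> r (R x) = x"
  unfolding R_def by (rule inverts_fixed_iff[OF inverts_br inverts_bu])

definition M :: "'a set set" where "M = {C \<in> rows X r2. C \<inter> E \<noteq> {}}"

definition F :: "'a set set" where "F = {C \<in> rows X r. C \<inter> E = {}}"

lemma finite_M: "finite M" and finite_F: "finite F"
  using finite_rows[OF fin] by (simp_all add: M_def F_def)

lemma orbit_r2_eq: "orbit r2 x \<inter> E = {} \<Longrightarrow> orbit r2 x = orbit r x"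
  "orbit r x \<inter> E = {} \<Longrightarrow> orbit r2 x = orbit r x"
proof -
  have s2: "x \<in> orbit r2 x" and s: "x \<in> orbit r x"
    using permutes_self_in_orbit[OF fin r2_permutes] permutes_self_in_orbit[OF fin rp] by auto
  show "orbit r2 x = orbit r x" if e: "orbit r2 x \<inter> E = {}"
  proof
    show 1: "orbit r x \<subseteq> orbit r2 x"
    proof (rule orbit_subset_closed[OF s2])
      fix y assume "y \<in> orbit r2 x"
      then show "r y \<in> orbit r2 x" using e orbit.step[of y r2 x] by (auto simp: r2_def split: if_splits)
    qed
    show "orbit r2 x \<subseteq> orbit r x"
    proof -
      have "orbit r2 x \<subseteq> {y. y \<in> orbit r2 x \<and> y \<in> orbit r x}"
      proof (rule orbit_subset_closed)
        fix y assume y: "y \<in> {y. y \<in> orbit r2 x \<and> y \<in> orbit r x}"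
        then have "r2 y = r y" using e by (auto simp: r2_def)
        then show "r2 y \<in> {y. y \<in> orbit r2 x \<and> y \<in> orbit r x}"
          using y orbit.step[of y r2 x] orbit.step[of y r x] by simp
      qed (use s s2 in auto)
      then show ?thesis by blast
    qed
  qed
  show "orbit r2 x = orbit r x" if e: "orbit r x \<inter> E = {}"
  proof
    show "orbit r2 x \<subseteq> orbit r x"
    proof (rule orbit_subset_closed[OF s])
      fix y assume "y \<in> orbit r x"
      then show "r2 y \<in> orbit r x" using e orbit.step[of y r x] by (auto simp: r2_def)
    qed
    then have "orbit r2 x \<inter> E = {}" using e by blast
    show "orbit r x \<subseteq> orbit r2 x"
    proof (rule orbit_subset_closed[OF s2])
      fix y assume "y \<in> orbit r2 x"
      then show "r y \<in> orbit r2 x" using \<open>orbit r2 x \<inter> E = {}\<close> orbit.step[of y r2 x]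
        by (auto simp: r2_def split: if_splits)
    qed
  qed
qed

lemma F_alt: "F = {C \<in> rows X r2. C \<inter> E = {}}"
  unfolding F_def rows_def using orbit_r2_eq by auto

lemma R_row_r2: "C \<in> rows X r2 \<Longrightarrow> R ` C \<in> rows X r2"
  using inverts_image_orbit[OF fin r2_permutes inverts_R_r2] permutes_in_image[OF R_permutes]
  by (auto simp: rows_def)

text \<open>The jump at a point of \<open>E\<close> is a step of the cycle, so \<open>R\<close> maps
  at least one point of the cycle into it.\<close>

lemma R_M: assumes "C \<in> M" shows "R ` C = C"
proof -
  obtain y where y: "y \<in> C" "y \<in> E" "C \<in> rows X r2" using assms by (auto simp: M_def)
  have "R y \<in> C" using row_step_iff[OF fin r2_permutes y(3)] y R_E by metis
  moreover have "R y \<in> R ` C" using y by blast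
  ultimately show ?thesis using rows_disjoint[OF fin r2_permutes R_row_r2[OF y(3)] y(3)] by blast
qed

lemma R_F: assumes "C \<in> F" shows "R ` C \<in> F"
proof -
  have C: "C \<in> rows X r2" "C \<inter> E = {}" using assms by (auto simp: F_alt)
  have "R ` C \<inter> E = {}"
  proof (rule ccontr)
    assume "R ` C \<inter> E \<noteq> {}"
    then obtain y where y: "y \<in> C" "R y \<in> E" by auto
    then have "r2 (R y) \<in> C" by (simp add: R_E)
    then have "R y \<in> C" using row_step_iff[OF fin r2_permutes C(1)] by blast
    then show False using y C by blast
  qed
  then show ?thesis using R_row_r2[OF C(1)] by (simp add: F_alt)
qed

lemma b_row: "C \<in> rows X r \<Longrightarrow> b ` C \<in> rows X r"
  using inverts_image_orbit[OF fin rp inverts_br] permutes_in_image[OF b_permutes]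
  by (auto simp: rows_def)

lemma b_image_twice [simp]: "b ` b ` C = C" by (simp add: image_image)

lemma R_image_twice [simp]: "R ` R ` C = C" by (simp add: image_image)

text \<open>The reflection count is used twice: for \<open>b\<close> on the rows, where it sees the
  fixed points of \<open>b\<close> and \<open>r \<circ> b\<close>, and for \<open>R\<close> on the
  cycles of \<open>r2\<close>, where it sees those of \<open>u \<circ> b\<close> and of the vertex
  permutation. Each \<open>R y\<close> with \<open>y \<in> E\<close> is an additional fixed point of
  \<open>r2 \<circ> R\<close>, which raises \<open>d + 2\<close> to
  \<open>2 * d + 2\<close>.\<close>

lemma pole_bound:
  "2 * d + 2 \<le> 2 * card {C \<in> rows X r. b ` C = C} + 2 * card M + 2 * card {C \<in> F. R ` C = C}"
proof -
  have "card {x \<in> X. b x = x} + card {x \<in> X. r (b x) = x} \<le> 2 * card {C \<in> rows X r. b ` C = C}"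
    by (rule reflection_count[OF fin rp inverts_br])
  moreover have "card {x \<in> X. R x = x} + card {x \<in> X. r2 (R x) = x} \<le> 2 * card {C \<in> rows X r2. R ` C = C}"
    by (rule reflection_count[OF fin r2_permutes inverts_R_r2])
  moreover have "card {x \<in> X. u (r (b x)) = x} + d \<le> card {x \<in> X. r2 (R x) = x}"
  proof -
    have *: "R x \<notin> E" if "r (R x) = x" for x using that by (simp add: E_def)
    have "card ({x \<in> X. r (R x) = x} \<union> R ` E) = card {x \<in> X. r (R x) = x} + card (R ` E)"
    proof (rule card_Un_disjoint)
      show "finite (R ` E)" using finite_subset[OF E_subset fin] by simp
      show "{x \<in> X. r (R x) = x} \<inter> R ` E = {}" using * by fastforce
    qed (use fin in auto)
    moreover have "card (R ` E) = d"
      using card_image[OF inj_on_subset[OF permutes_inj[OF R_permutes]], of E] card_E by simp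
    moreover have "{x \<in> X. r (R x) = x} \<union> R ` E \<subseteq> {x \<in> X. r2 (R x) = x}"
      using * E_subset permutes_in_image[OF R_permutes] by (auto simp: r2_def)
    then have "card ({x \<in> X. r (R x) = x} \<union> R ` E) \<le> card {x \<in> X. r2 (R x) = x}"
      using fin by (intro card_mono) auto
    ultimately show ?thesis by (simp add: vertex_fixed_iff)
  qed
  moreover have "card {C \<in> rows X r2. R ` C = C} \<le> card M + card {C \<in> F. R ` C = C}"
  proof -
    have "{C \<in> rows X r2. R ` C = C} \<subseteq> M \<union> {C \<in> F. R ` C = C}" by (auto simp: M_def F_alt)
    then have "card {C \<in> rows X r2. R ` C = C} \<le> card (M \<union> {C \<in> F. R ` C = C})"
      using finite_M finite_F by (intro card_mono) auto
    also have "\<dots> \<le> card M + card {C \<in> F. R ` C = C}" by (rule card_Un_le)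
    finally show ?thesis .
  qed
  ultimately show ?thesis using poles by (simp add: R_def)
qed

lemma card_M_sum: "(\<Sum>C \<in> M. card (C \<inter> E)) = d"
proof -
  have "d = card {x \<in> X. x \<in> E}" using card_E E_subset by (metis Int_absorb1 Int_def)
  also have "\<dots> = (\<Sum>C \<in> rows X r2. card {x \<in> C. x \<in> E})"
    by (rule card_split_rows[OF fin r2_permutes])
  also have "\<dots> = (\<Sum>C \<in> M. card (C \<inter> E))"
  proof (rule sum.mono_neutral_cong_right)
    show "\<forall>C \<in> rows X r2 - M. card {x \<in> C. x \<in> E} = 0"
    proof
      fix C assume "C \<in> rows X r2 - M"
      then have "{x \<in> C. x \<in> E} = {}" by (auto simp: M_def)
      then show "card {x \<in> C. x \<in> E} = 0" by (simp only: card.empty)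
    qed
  qed (auto simp: M_def Int_def finite_rows[OF fin])
  finally show ?thesis by simp
qed

text \<open>For a cycle in \<open>M\<close> this says that its two opposite intervals lie on
  different rows, so that it yields an edge of the graph in \<open>graph_bound\<close>.\<close>

definition two :: "'a set \<Rightarrow> bool" where
  "two C \<longleftrightarrow> (\<exists>x \<in> C. orbit r x \<noteq> orbit r (R x))"

lemma M_E_finite: "C \<in> M \<Longrightarrow> finite (C \<inter> E)" and M_E_nonempty: "C \<in> M \<Longrightarrow> C \<inter> E \<noteq> {}"
  using finite_subset[OF E_subset fin] by (auto simp: M_def)

text \<open>If \<open>e\<close> were the only point of \<open>E\<close> on the cycle,
  \<open>r2\<close> would follow \<open>r\<close> everywhere else on it, so the whole cycle would
  lie on the row of \<open>e\<close>.\<close>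

lemma two_card:
  assumes "C \<in> M" "two C"
  shows "2 \<le> card (C \<inter> E)"
proof (rule ccontr)
  assume "\<not> ?thesis"
  moreover have "card (C \<inter> E) > 0" using M_E_finite M_E_nonempty assms(1) card_gt_0_iff by blast
  ultimately have "card (C \<inter> E) = 1" by linarith
  then obtain e where e: "C \<inter> E = {e}" using card_1_singletonE by blast
  have C: "C \<in> rows X r2" using assms(1) by (simp add: M_def)
  have sub: "C \<subseteq> orbit r e"
  proof (rule ccontr)
    assume "\<not> ?thesis"
    then obtain x where x: "x \<in> C" "x \<notin> orbit r e" by blast
    have "orbit r2 x \<subseteq> {y \<in> C. y \<notin> orbit r e}"
    proof (rule orbit_subset_closed)
      fix y assume y: "y \<in> {y \<in> C. y \<notin> orbit r e}"
      have "y \<noteq> e" using y permutes_self_in_orbit[OF fin rp] by auto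
      then have "y \<notin> E" using e y by blast
      then have "r2 y = r y" by (rule r_E)
      then show "r2 y \<in> {y \<in> C. y \<notin> orbit r e}"
        using y row_step_iff[OF fin r2_permutes C, of y] permutes_in_orbit_step_iff[OF fin rp] by auto
    qed (use x in auto)
    moreover have "orbit r2 x = C" using row_eq_orbit[OF fin r2_permutes C x(1)] by simp
    ultimately show False using e permutes_self_in_orbit[OF fin rp, of e] by auto
  qed
  obtain x where x: "x \<in> C" "orbit r x \<noteq> orbit r (R x)" using assms(2) by (auto simp: two_def)
  have "R x \<in> C" using R_M[OF assms(1)] x(1) by blast
  then have "orbit r x = orbit r e" "orbit r (R x) = orbit r e"
    using sub x(1) permutes_orbit_eq[OF fin rp] by blast+
  then show False using x(2) by simp
qed

lemma two_bound: "card M + card {C \<in> M. two C} \<le> d"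
proof -
  have "card M + card {C \<in> M. two C} = (\<Sum>C \<in> M. 1 + (if two C then 1 else 0))"
    using finite_M by (simp only: sum.distrib sum.If_cases Int_def) simp
  also have "\<dots> \<le> (\<Sum>C \<in> M. card (C \<inter> E))"
  proof (rule sum_mono)
    fix C assume C: "C \<in> M"
    have "card (C \<inter> E) > 0" using M_E_finite M_E_nonempty C card_gt_0_iff by blast
    then show "1 + (if two C then 1 else 0) \<le> card (C \<inter> E)" using two_card[OF C] by auto
  qed
  finally show ?thesis using card_M_sum by simp
qed

text \<open>The unordered pair of the rows through \<open>y\<close> and \<open>R y\<close> does not
  change when \<open>y\<close> moves by \<open>r2\<close>.\<close>

lemma M_rows:
  assumes "C \<in> M" "x \<in> C"
  shows "orbit r ` C = {orbit r x, orbit r (R x)}"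
proof -
  have C: "C \<in> rows X r2" using assms(1) by (simp add: M_def)
  have st: "orbit r (r y) = orbit r y" for y
    using permutes_orbit_eq[OF fin rp orbit.base] .
  have step: "{orbit r (r2 y), orbit r (R (r2 y))} = {orbit r y, orbit r (R y)}" for y
  proof (cases "y \<in> E")
    case True then show ?thesis by (auto simp: R_E)
  next
    case False
    then show ?thesis using not_E_D[OF False] st[of y] st[of "R (r y)"] by (simp add: r_E)
  qed
  have "C = orbit r2 x" by (rule row_eq_orbit[OF fin r2_permutes C assms(2)])
  also have "\<dots> \<subseteq> {y. {orbit r y, orbit r (R y)} = {orbit r x, orbit r (R x)}}"
    by (rule orbit_subset_closed) (use step in auto)
  finally have "orbit r ` C \<subseteq> {orbit r x, orbit r (R x)}" by blast
  moreover have "R x \<in> C" using R_M[OF assms(1)] assms(2) by blast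
  ultimately show ?thesis using assms(2) by blast
qed

text \<open>Tree bound for the graph on the rows with three kinds of edges: a row and its image
  under \<open>b\<close> (\<open>E1\<close>), a row in \<open>F\<close> and its image under
  \<open>R\<close> (\<open>E2\<close>), the two rows met by a cycle in \<open>M\<close>
  (\<open>E3\<close>). It is connected because \<open>u\<close> is \<open>R \<circ> b\<close>. The
  first two kinds use up two rows per edge, and by \<open>two_bound\<close> there are at most
  \<open>d - card M\<close> edges of the third kind.\<close>

lemma graph_bound:
  "card {C \<in> rows X r. b ` C = C} + card {C \<in> F. R ` C = C} + card {C \<in> rows X r. C \<inter> E \<noteq> {}}
    + 2 * card M \<le> 2 * d + 2"
proof -
  let ?V = "rows X r"
  define E1 where "E1 = (\<lambda>C. {C, b ` C}) ` {C \<in> ?V. b ` C \<noteq> C}"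
  define E2 where "E2 = (\<lambda>C. {C, R ` C}) ` {C \<in> F. R ` C \<noteq> C}"
  define E3 where "E3 = (\<lambda>C. orbit r ` C) ` {C \<in> M. two C}"
  have f: "finite E1" "finite E2" "finite E3"
    using finite_rows[OF fin] finite_F finite_M by (auto simp: E1_def E2_def E3_def)
  have 1: "2 * card E1 + card {C \<in> ?V. b ` C = C} \<le> card ?V"
    unfolding E1_def by (rule involution_pairs) (use finite_rows[OF fin] b_row in auto)
  have 2: "2 * card E2 + card {C \<in> F. R ` C = C} \<le> card F"
    unfolding E2_def by (rule involution_pairs) (use finite_F R_F in auto)
  have 3: "card E3 \<le> card {C \<in> M. two C}"
    unfolding E3_def using finite_M by (intro card_image_le) simp
  have orow: "orbit r x \<in> ?V" if "x \<in> X" for x using that by (simp add: rows_def)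
  have edgeR: "{orbit r x, orbit r (R x)} \<in> E1 \<union> E2 \<union> E3" if x: "x \<in> X" "orbit r x \<noteq> orbit r (R x)" for x
  proof -
    let ?C = "orbit r2 x"
    have C: "?C \<in> rows X r2" "x \<in> ?C" using x permutes_self_in_orbit[OF fin r2_permutes] by (auto simp: rows_def)
    show ?thesis
    proof (cases "?C \<inter> E = {}")
      case True
      then have CF: "?C \<in> F" using C by (simp add: F_alt)
      have e1: "?C = orbit r x" by (rule orbit_r2_eq(1)[OF True])
      have "R ` ?C \<in> rows X r" using R_F[OF CF] by (simp add: F_def)
      moreover have "R x \<in> R ` ?C" using C by blast
      ultimately have "R ` ?C = orbit r (R x)" by (rule row_eq_orbit[OF fin rp])
      then have "{orbit r x, orbit r (R x)} = {?C, R ` ?C}" "R ` ?C \<noteq> ?C" using e1 x(2) by simp_all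
      then show ?thesis using CF unfolding E2_def by blast
    next
      case False
      then have CM: "?C \<in> M" using C by (simp add: M_def)
      have "two ?C" unfolding two_def using x(2) C(2) by (rule_tac bexI[of _ x])
      then have "orbit r ` ?C \<in> E3" unfolding E3_def using CM by (intro imageI) simp
      then show ?thesis unfolding M_rows[OF CM C(2)] by simp
    qed
  qed
  have "card ?V \<le> card (E1 \<union> E2 \<union> E3) + 1"
  proof (rule connected_card_le)
    show "?V \<noteq> {}" using ne by (simp add: rows_def)
    fix W assume W: "W \<subseteq> ?V" "W \<noteq> {}" "W \<noteq> ?V"
    show "\<exists>C\<in>W. \<exists>D\<in>?V - W. {C, D} \<in> E1 \<union> E2 \<union> E3"
    proof (rule ccontr)
      assume no: "\<not> ?thesis"
      let ?A = "\<Union> W"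
      have AX: "?A \<subseteq> X" using W(1) row_subset[OF rp] by blast
      have mem: "orbit r x \<in> W" if x: "x \<in> ?A" for x
      proof -
        obtain C where "C \<in> W" "x \<in> C" using x by blast
        moreover have "C = orbit r x" using calculation W(1) row_eq_orbit[OF fin rp] by blast
        ultimately show ?thesis by simp
      qed
      have bA: "b x \<in> ?A" if x: "x \<in> ?A" for x
      proof -
        have "orbit r (b x) \<in> W"
        proof (rule ccontr)
          assume n: "orbit r (b x) \<notin> W"
          have bx: "b ` orbit r x = orbit r (b x)" by (rule inverts_image_orbit[OF fin rp inverts_br])
          have "{orbit r x, orbit r (b x)} \<in> E1"
            unfolding E1_def using bx n mem[OF x] W(1)
            by (intro image_eqI[of _ _ "orbit r x"]) auto
          moreover have "orbit r (b x) \<in> ?V" using x AX permutes_in_image[OF b_permutes] by (auto simp: rows_def)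
          ultimately show False using no mem[OF x] n by blast
        qed
        then show ?thesis using permutes_self_in_orbit[OF fin rp] by blast
      qed
      have RA: "R x \<in> ?A" if x: "x \<in> ?A" for x
      proof -
        have "orbit r (R x) \<in> W"
        proof (rule ccontr)
          assume n: "orbit r (R x) \<notin> W"
          then have "{orbit r x, orbit r (R x)} \<in> E1 \<union> E2 \<union> E3"
            using edgeR[of x] subsetD[OF AX x] mem[OF x] by (metis (full_types))
          moreover have "orbit r (R x) \<in> ?V" using x AX permutes_in_image[OF R_permutes] by (auto simp: rows_def)
          ultimately show False using no mem[OF x] n by blast
        qed
        then show ?thesis using permutes_self_in_orbit[OF fin rp] by blast
      qed
      have "?A = X"
      proof (rule origami_closed[OF origami AX])
        show "?A \<noteq> {}" using W row_nonempty by blast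
        fix x assume x: "x \<in> ?A"
        show "r x \<in> ?A" using mem[OF x] orbit.base[of r x] by blast
        show "u x \<in> ?A" using RA[OF bA[OF x]] by (simp add: R_def)
      qed
      then have "?V \<subseteq> W" using mem by (auto simp: rows_def)
      then show False using W by blast
    qed
  qed (use f finite_rows[OF fin] in auto)
  also have "\<dots> \<le> card E1 + card E2 + card E3 + 1"
    using card_Un_le[of "E1 \<union> E2" E3] card_Un_le[of E1 E2] by linarith
  finally have 4: "card ?V \<le> card E1 + card E2 + card E3 + 1" .
  have "card ?V = card F + card {C \<in> ?V. C \<inter> E \<noteq> {}}"
  proof -
    have "?V = F \<union> {C \<in> ?V. C \<inter> E \<noteq> {}}" by (auto simp: F_def)
    moreover have "card (F \<union> {C \<in> ?V. C \<inter> E \<noteq> {}}) = card F + card {C \<in> ?V. C \<inter> E \<noteq> {}}"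
      by (rule card_Un_disjoint) (use finite_rows[OF fin] in \<open>auto simp: F_def\<close>)
    ultimately show ?thesis by simp
  qed
  then show ?thesis using 1 2 3 4 two_bound by linarith
qed

text \<open>Subtracting \<open>graph_bound\<close> from \<open>pole_bound\<close> cancels
  \<open>d\<close> and \<open>card M\<close>: the rows meeting \<open>E\<close> are at most as many
  as the rows fixed by \<open>b\<close> plus the rows in \<open>F\<close> fixed by \<open>R\<close>.
  The image under \<open>b\<close> takes non-flat rows to rows meeting \<open>E\<close>, and the
  fixed rows in \<open>F\<close> to the flat rows of the last set.\<close>

lemma cap_count:
  "card {C \<in> rows X r. \<exists>x \<in> C. u (r x) \<noteq> r (u x)}
   \<le> card {C \<in> rows X r. b ` C = C} + card {C \<in> rows X r. (\<forall>x \<in> C. u (r x) = r (u x)) \<and> u ` C = b ` C}"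
proof -
  have inj: "inj_on ((`) b) S" for S
    by (rule inj_onI) (metis b_image_twice)
  have fr: "finite {C \<in> rows X r. P C}" for P using finite_rows[OF fin] by simp
  have "(`) b ` {C \<in> rows X r. \<exists>x \<in> C. u (r x) \<noteq> r (u x)} \<subseteq> {C \<in> rows X r. C \<inter> E \<noteq> {}}"
  proof safe
    fix C x assume C: "C \<in> rows X r" "x \<in> C" "u (r x) \<noteq> r (u x)"
    show "b ` C \<in> rows X r" by (rule b_row[OF C(1)])
    obtain y where y: "b x = r y" using permutes_surj[OF rp] by (metis surjD)
    have "b x \<in> b ` C" using C by blast
    then have "y \<in> b ` C" using row_step_iff[OF fin rp b_row[OF C(1)], of y] y by simp
    moreover have "y \<in> E" using C(3) E_iff[of y] unfolding y[symmetric] by simp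
    moreover assume "b ` C \<inter> E = {}"
    ultimately show False by blast
  qed
  then have 1: "card {C \<in> rows X r. \<exists>x \<in> C. u (r x) \<noteq> r (u x)} \<le> card {C \<in> rows X r. C \<inter> E \<noteq> {}}"
    by (intro card_inj_on_le[OF inj _ fr])
  have "(`) b ` {C \<in> F. R ` C = C} \<subseteq> {C \<in> rows X r. (\<forall>x \<in> C. u (r x) = r (u x)) \<and> u ` C = b ` C}"
  proof (rule subsetI, elim imageE)
    fix C D assume "D \<in> {C \<in> F. R ` C = C}" "C = b ` D"
    then have C: "D \<in> F" "R ` D = D" "C = b ` D" by auto
    have Cr: "D \<in> rows X r" "D \<inter> E = {}" using C by (auto simp: F_def)
    have "u ` b ` D = D" using C(2) unfolding R_def[abs_def] by (simp only: image_image)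
    then have "u ` C = b ` C" using C(3) by simp
    moreover have "u (r (b y)) = r (u (b y))" if y: "y \<in> D" for y
    proof -
      obtain z where z: "y = r z" using permutes_surj[OF rp] by (metis surjD)
      have "z \<in> D" using row_step_iff[OF fin rp Cr(1), of z] y z by simp
      then have "z \<notin> E" using Cr by blast
      then show ?thesis using z by (simp add: E_iff)
    qed
    ultimately show "C \<in> {C \<in> rows X r. (\<forall>x \<in> C. u (r x) = r (u x)) \<and> u ` C = b ` C}"
      using b_row[OF Cr(1)] C(3) by auto
  qed
  then have 2: "card {C \<in> F. R ` C = C} \<le> card {C \<in> rows X r. (\<forall>x \<in> C. u (r x) = r (u x)) \<and> u ` C = b ` C}"
    by (intro card_inj_on_le[OF inj _ fr])
  show ?thesis using 1 2 pole_bound graph_bound by linarith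
qed

text \<open>For a single row, the count forces \<open>R\<close> to reverse every interval between consecutive
  points of \<open>E\<close>.\<close>

lemma one_row_reversal:
  assumes one: "rows X r = {X}" and z: "R z \<in> E"
    and k: "\<And>i. i < k \<Longrightarrow> (r ^^ i) z \<notin> E" "(r ^^ k) z \<in> E"
  shows "(r ^^ k) z = R z"
proof -
  have "F = {}"
  proof -
    have "E \<noteq> {}" using card_E d_pos by auto
    then show ?thesis using one E_subset by (auto simp: F_def)
  qed
  moreover have "card {C \<in> rows X r. b ` C = C} \<le> 1" unfolding one
    using card_mono[of "{X}" "{C \<in> {X}. b ` C = C}"] by auto
  ultimately have m: "d \<le> card M" using pole_bound by simp
  \<comment> \<open>At least \<open>d\<close> cycles, each meeting \<open>E\<close>, share its
    \<open>d\<close> points.\<close>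
  have s: "card (C \<inter> E) = 1" if C: "C \<in> M" for C
  proof -
    have pos: "1 \<le> card (D \<inter> E)" if "D \<in> M" for D
      using M_E_finite[OF that] M_E_nonempty[OF that] by (simp add: Suc_leI card_gt_0_iff)
    have "d = card (C \<inter> E) + (\<Sum>D \<in> M - {C}. card (D \<inter> E))"
      using card_M_sum sum.remove[OF finite_M C, of "\<lambda>D. card (D \<inter> E)"] by simp
    moreover have "(\<Sum>D \<in> M - {C}. 1) \<le> (\<Sum>D \<in> M - {C}. card (D \<inter> E))"
      by (rule sum_mono) (use pos in auto)
    moreover have "card (M - {C}) = card M - 1" "card M > 0" using C finite_M card_gt_0_iff by auto
    ultimately show ?thesis using m pos[OF C] by simp
  qed
  let ?C = "orbit r2 (R z)"
  have zX: "R z \<in> X" using z E_subset by blast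
  have C: "?C \<in> M" "R z \<in> ?C"
    using z zX permutes_self_in_orbit[OF fin r2_permutes] by (auto simp: M_def rows_def)
  have Cr: "?C \<in> rows X r2" using C by (simp add: M_def)
  have "z \<in> ?C" using row_step_iff[OF fin r2_permutes Cr, of "R z"] C(2) R_E[OF z] by simp
  have "(r ^^ i) z \<in> ?C" if "i \<le> k" for i using that
  proof (induction i)
    case 0 then show ?case using \<open>z \<in> ?C\<close> by simp
  next
    case (Suc i)
    then have "r2 ((r ^^ i) z) = (r ^^ Suc i) z" using r_E k(1) by simp
    then show ?case using Suc row_step_iff[OF fin r2_permutes Cr, of "(r ^^ i) z"] by simp
  qed
  then have "(r ^^ k) z \<in> ?C \<inter> E" "R z \<in> ?C \<inter> E" using k z C by auto
  then show ?thesis using s[OF C(1)] card_1_singletonE by (metis singletonD)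
qed

end

section \<open>Cylinders are invariant under the involution\<close>

text \<open>A flat row has no singularity on its upper side.\<close>

definition flat :: "('a \<Rightarrow> 'a) \<Rightarrow> ('a \<Rightarrow> 'a) \<Rightarrow> 'a set \<Rightarrow> bool" where
  "flat r u C \<longleftrightarrow> (\<forall>x \<in> C. u (r x) = r (u x))"

text \<open>Then \<open>C\<close> and the \<open>k\<close> rows reached from it by \<open>u\<close>
  are stacked in one maximal cylinder.\<close>

definition chain :: "('a \<Rightarrow> 'a) \<Rightarrow> ('a \<Rightarrow> 'a) \<Rightarrow> 'a set \<Rightarrow> nat \<Rightarrow> bool" where
  "chain r u C k \<longleftrightarrow> (\<forall>i < k. flat r u ((u ^^ i) ` C))"

text \<open>A maximal cylinder is named by the one row at its upper end.\<close>

definition tops :: "'a set \<Rightarrow> ('a \<Rightarrow> 'a) \<Rightarrow> ('a \<Rightarrow> 'a) \<Rightarrow> 'a set set" where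
  "tops X r u = {C \<in> rows X r. \<not> flat r u C}"

text \<open>The number of rows above \<open>C\<close> in its maximal cylinder;
  \<open>not_flat_exists\<close> shows that the minimum is attained.\<close>

definition height :: "('a \<Rightarrow> 'a) \<Rightarrow> ('a \<Rightarrow> 'a) \<Rightarrow> 'a set \<Rightarrow> nat" where
  "height r u C = (LEAST i. \<not> flat r u ((u ^^ i) ` C))"

definition top_row :: "('a \<Rightarrow> 'a) \<Rightarrow> ('a \<Rightarrow> 'a) \<Rightarrow> 'a set \<Rightarrow> 'a set" where
  "top_row r u C = (u ^^ height r u C) ` C"

lemma image_funpow_add: "(u ^^ i) ` (u ^^ j) ` C = (u ^^ (i + j)) ` C"
  by (simp add: image_image funpow_add)

lemma image_funpow_Suc: "(u ^^ Suc i) ` C = u ` (u ^^ i) ` C"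
  by (simp add: image_image)

lemma image_funpow_Suc2: "(u ^^ Suc i) ` C = (u ^^ i) ` u ` C"
  by (simp only: image_image funpow_Suc_right comp_def)

lemma chain_0 [simp]: "chain r u C 0"
  by (simp add: chain_def)

lemma chain_Suc: "chain r u C (Suc k) \<longleftrightarrow> flat r u C \<and> chain r u (u ` C) k"
proof
  assume *: "chain r u C (Suc k)"
  then have "flat r u ((u ^^ 0) ` C)" unfolding chain_def by blast
  moreover have "flat r u ((u ^^ i) ` u ` C)" if "i < k" for i
    using * that unfolding chain_def image_funpow_Suc2[symmetric] by blast
  ultimately show "flat r u C \<and> chain r u (u ` C) k" by (simp add: chain_def)
next
  assume *: "flat r u C \<and> chain r u (u ` C) k"
  show "chain r u C (Suc k)" unfolding chain_def
  proof (intro allI impI)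
    fix i assume "i < Suc k"
    then show "flat r u ((u ^^ i) ` C)" using *
      by (cases i) (auto simp: chain_def image_funpow_Suc2 simp del: funpow.simps)
  qed
qed

lemma chain_append: "chain r u C i \<Longrightarrow> chain r u ((u ^^ i) ` C) j \<Longrightarrow> chain r u C (i + j)"
proof -
  assume *: "chain r u C i" "chain r u ((u ^^ i) ` C) j"
  show "chain r u C (i + j)" unfolding chain_def
  proof (intro allI impI)
    fix k assume k: "k < i + j"
    show "flat r u ((u ^^ k) ` C)"
    proof (cases "k < i")
      case True then show ?thesis using * by (simp add: chain_def)
    next
      case False
      then have "flat r u ((u ^^ (k - i)) ` (u ^^ i) ` C)" using * k by (simp add: chain_def)
      then show ?thesis using False by (simp add: image_funpow_add)
    qed
  qed
qed

lemma chain_mono: "chain r u C k \<Longrightarrow> i \<le> k \<Longrightarrow> chain r u C i"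
  by (simp add: chain_def)

lemma flat_image_orbit:
  assumes "finite X" "r permutes X" "flat r u (orbit r x)"
  shows "u ` orbit r x = orbit r (u x)"
proof
  have x: "x \<in> orbit r x" and ux: "u x \<in> orbit r (u x)"
    by (rule permutes_self_in_orbit[OF assms(1,2)])+
  show "orbit r (u x) \<subseteq> u ` orbit r x"
  proof (rule orbit_subset_closed)
    fix y assume "y \<in> u ` orbit r x"
    then obtain z where "z \<in> orbit r x" "y = u z" by blast
    then have "r y = u (r z)" using assms(3) by (simp add: flat_def)
    moreover have "r z \<in> orbit r x" using \<open>z \<in> orbit r x\<close> by (rule orbit.step)
    ultimately show "r y \<in> u ` orbit r x" by simp
  qed (use x in blast)
  have "orbit r x \<subseteq> {y \<in> orbit r x. u y \<in> orbit r (u x)}"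
  proof (rule orbit_subset_closed)
    fix y assume "y \<in> {y \<in> orbit r x. u y \<in> orbit r (u x)}"
    then show "r y \<in> {y \<in> orbit r x. u y \<in> orbit r (u x)}"
      using assms(3) orbit.step[of y r x] orbit.step[of "u y" r "u x"] by (auto simp: flat_def)
  qed (use x ux in blast)
  then show "u ` orbit r x \<subseteq> orbit r (u x)" by blast
qed

lemma flat_row:
  assumes "origami X r u" "C \<in> rows X r" "flat r u C"
  shows "u ` C \<in> rows X r"
proof -
  note o = origamiD[OF assms(1)]
  obtain x where x: "x \<in> X" "C = orbit r x" using assms(2) by (auto simp: rows_def)
  then show ?thesis
    using flat_image_orbit[OF o(1,2), of u x] assms(3) permutes_in_image[OF o(3)] by (simp add: rows_def)
qed

lemma chain_row:
  assumes "origami X r u" "C \<in> rows X r" "chain r u C k"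
  shows "(u ^^ k) ` C \<in> rows X r"
  using assms(2,3)
proof (induction k arbitrary: C)
  case (Suc k)
  then show ?case using flat_row[OF assms(1)] by (simp add: chain_Suc image_funpow_Suc2 del: funpow.simps)
qed simp

section \<open>Climbing in a maximal cylinder and locating its middle\<close>

context hyp_origami
begin

lemma inj_image_funpow: "(u ^^ i) ` C = (u ^^ i) ` D \<longleftrightarrow> C = D"
  using permutes_inj[OF permutes_funpow[OF up]] by (simp add: inj_image_eq_iff)

lemma flat_mirror:
  assumes "C \<in> rows X r" "flat r u C"
  shows "flat r u (b ` u ` C)" "u ` b ` u ` C = b ` C"
proof -
  show "flat r u (b ` u ` C)"
    unfolding flat_def
  proof
    fix y assume "y \<in> b ` u ` C"
    then obtain x where x: "x \<in> C" "y = b (u x)" by auto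
    obtain z where z: "x = r z" using permutes_surj[OF rp] by (metis surjD)
    have zC: "z \<in> C" using row_step_iff[OF fin rp assms(1), of z] x z by simp
    have "u x = r (u z)" using assms(2) zC z by (simp add: flat_def)
    then have "u (r y) = u (r (b (r (u z))))" by (simp only: x(2))
    also have "\<dots> = b z" by simp
    also have "\<dots> = r (u y)" by (simp add: x(2) z)
    finally show "u (r y) = r (u y)" .
  qed
  show "u ` b ` u ` C = b ` C" by (simp add: image_image)
qed

text \<open>The involution turns a cylinder upside down, so the climb from \<open>C\<close> by
  \<open>k\<close> rows becomes a climb of the same length that ends at the image of
  \<open>C\<close>.\<close>

lemma chain_mirror:
  assumes "C \<in> rows X r" "chain r u C k"
  shows "chain r u (b ` (u ^^ k) ` C) k" "(u ^^ k) ` b ` (u ^^ k) ` C = b ` C"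
proof -
  have "chain r u (b ` (u ^^ k) ` C) k \<and> (u ^^ k) ` b ` (u ^^ k) ` C = b ` C"
    using assms
  proof (induction k arbitrary: C)
    case (Suc k)
    have C: "flat r u C" "chain r u (u ` C) k" using Suc.prems by (auto simp: chain_Suc)
    let ?D = "b ` (u ^^ k) ` u ` C"
    have D: "chain r u ?D k" "(u ^^ k) ` ?D = b ` u ` C"
      using Suc.IH[OF flat_row[OF origami Suc.prems(1) C(1)] C(2)] by auto
    have "chain r u ?D (k + 1)"
      using chain_append[OF D(1), of 1] D(2) flat_mirror(1)[OF Suc.prems(1) C(1)] by (simp add: chain_def)
    moreover have "(u ^^ Suc k) ` ?D = b ` C"
      unfolding image_funpow_Suc D(2) by (rule flat_mirror(2)[OF Suc.prems(1) C(1)])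
    ultimately show ?case by (simp only: image_funpow_Suc2[of k u C] Suc_eq_plus1[symmetric])
  qed simp
  then show "chain r u (b ` (u ^^ k) ` C) k" "(u ^^ k) ` b ` (u ^^ k) ` C = b ` C" by auto
qed

text \<open>If all rows above \<open>C\<close> were flat, their union would be closed under
  \<open>r\<close> and \<open>u\<close>, hence everything, and there would be no singular square,
  against \<open>d > 0\<close>.\<close>

lemma not_flat_exists:
  assumes "C \<in> rows X r"
  shows "\<exists>i. \<not> flat r u ((u ^^ i) ` C)"
proof (rule ccontr)
  assume "\<not> ?thesis"
  then have all: "flat r u ((u ^^ i) ` C)" for i by blast
  have rw: "(u ^^ i) ` C \<in> rows X r" for i
    by (rule chain_row[OF origami assms]) (simp add: chain_def all)
  have "(\<Union>i. (u ^^ i) ` C) = X"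
  proof (rule origami_closed[OF origami])
    show "(\<Union>i. (u ^^ i) ` C) \<subseteq> X" using row_subset[OF rp rw] by blast
    show "(\<Union>i. (u ^^ i) ` C) \<noteq> {}" using row_nonempty[OF rw[of 0]] by auto
    fix x assume "x \<in> (\<Union>i. (u ^^ i) ` C)"
    then obtain i where i: "x \<in> (u ^^ i) ` C" by blast
    then have "u x \<in> (u ^^ Suc i) ` C" "r x \<in> (u ^^ i) ` C"
      using row_step_iff[OF fin rp rw] by auto
    then show "r x \<in> (\<Union>i. (u ^^ i) ` C)" "u x \<in> (\<Union>i. (u ^^ i) ` C)" by blast+
  qed
  then have "{x \<in> X. u (r x) \<noteq> r (u x)} = {}" using all unfolding flat_def by blast
  then show False using card_sing d_pos by (simp only: card.empty)
qed

abbreviation "ht \<equiv> height r u"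
abbreviation "tp \<equiv> top_row r u"

lemma height_prop:
  assumes "C \<in> rows X r"
  shows "chain r u C (ht C)" "tp C \<in> tops X r u"
proof -
  have nf: "\<not> flat r u ((u ^^ ht C) ` C)"
    unfolding height_def using not_flat_exists[OF assms] by (rule LeastI_ex)
  show c: "chain r u C (ht C)"
    unfolding chain_def height_def using not_less_Least by blast
  show "tp C \<in> tops X r u"
    using nf chain_row[OF origami assms c] by (simp add: tops_def top_row_def)
qed

lemma height_flat:
  assumes "C \<in> rows X r" "flat r u C"
  shows "ht C = Suc (ht (u ` C))" "tp (u ` C) = tp C"
proof -
  obtain n where n: "\<not> flat r u ((u ^^ n) ` C)" using not_flat_exists[OF assms(1)] by blast
  have "\<not> \<not> flat r u ((u ^^ 0) ` C)" using assms(2) by simp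
  with n have "ht C = Suc (LEAST i. \<not> flat r u ((u ^^ Suc i) ` C))"
    unfolding height_def by (rule Least_Suc)
  then show h: "ht C = Suc (ht (u ` C))"
    unfolding height_def image_funpow_Suc2 .
  show "tp (u ` C) = tp C" by (simp only: top_row_def h image_funpow_Suc2)
qed

lemma height_chain:
  assumes "C \<in> rows X r" "chain r u C k"
  shows "ht C = ht ((u ^^ k) ` C) + k" "tp ((u ^^ k) ` C) = tp C"
proof -
  have "ht C = ht ((u ^^ k) ` C) + k \<and> tp ((u ^^ k) ` C) = tp C"
    using assms
  proof (induction k arbitrary: C)
    case (Suc k)
    then have "flat r u C" "chain r u (u ` C) k" by (auto simp: chain_Suc)
    then show ?case
      using Suc.IH[OF flat_row[OF origami Suc.prems(1)]] height_flat[OF Suc.prems(1)]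
      by (simp add: image_funpow_Suc2 del: funpow.simps)
  qed simp
  then show "ht C = ht ((u ^^ k) ` C) + k" "tp ((u ^^ k) ` C) = tp C" by auto
qed

lemma same_top:
  assumes "tp C = tp D" "ht D \<le> ht C"
  shows "(u ^^ (ht C - ht D)) ` C = D"
proof -
  have "(u ^^ ht D) ` (u ^^ (ht C - ht D)) ` C = (u ^^ ht D) ` D"
    using assms by (simp add: image_funpow_add top_row_def)
  then show ?thesis by (simp only: inj_image_funpow)
qed

text \<open>This quantity drops by 2 with every row up a cylinder and is 0 or 1 at a cap, hence a cylinder
  contains at most one cap.\<close>

definition asym :: "'a set \<Rightarrow> int" where
  "asym C = int (ht C) - int (ht (b ` C))"

lemma asym_chain:
  assumes "C \<in> rows X r" "chain r u C k"
  shows "asym ((u ^^ k) ` C) = asym C - 2 * int k"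
proof -
  have rk: "(u ^^ k) ` C \<in> rows X r" by (rule chain_row[OF origami assms])
  have "ht (b ` (u ^^ k) ` C) = ht (b ` C) + k"
    using height_chain(1)[OF b_row[OF rk] chain_mirror(1)[OF assms]] chain_mirror(2)[OF assms] by simp
  then show ?thesis using height_chain(1)[OF assms] by (simp add: asym_def)
qed

text \<open>The middle of a cylinder that is its own mirror image: the middle row when the number of
  rows is odd, the row just below the middle line when it is even.\<close>

definition caps :: "'a set set" where
  "caps = {C \<in> rows X r. b ` C = C} \<union> {C \<in> rows X r. flat r u C \<and> u ` C = b ` C}"

lemma asym_cap:
  "C \<in> rows X r \<Longrightarrow> b ` C = C \<Longrightarrow> asym C = 0"
  "C \<in> rows X r \<Longrightarrow> flat r u C \<Longrightarrow> u ` C = b ` C \<Longrightarrow> asym C = 1"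
proof -
  show "b ` C = C \<Longrightarrow> asym C = 0" by (simp add: asym_def)
  assume C: "C \<in> rows X r" "flat r u C" "u ` C = b ` C"
  show "asym C = 1" using height_flat(1)[OF C(1,2)] C(3) by (simp add: asym_def)
qed

lemma caps_inj: "inj_on tp caps"
proof -
  have *: "C = D" if "C \<in> caps" "D \<in> caps" "tp C = tp D" "ht D \<le> ht C" for C D
  proof -
    let ?m = "ht C - ht D"
    have C: "C \<in> rows X r" "asym C \<in> {0, 1}" and D: "asym D \<in> {0, 1}"
      using that asym_cap by (auto simp: caps_def)
    have "chain r u C ?m" by (rule chain_mono[OF height_prop(1)[OF C(1)]]) simp
    then have "asym D = asym C - 2 * int ?m"
      using asym_chain[OF C(1), of ?m] same_top[OF that(3,4)] by simp
    then have "?m = 0" using C D by auto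
    then show ?thesis using same_top[OF that(3,4)] by simp
  qed
  show ?thesis
  proof (rule inj_onI)
    fix C D assume "C \<in> caps" "D \<in> caps" "tp C = tp D"
    then show "C = D" using *[of C D] *[of D C] by (cases "ht D \<le> ht C") auto
  qed
qed

text \<open>Here the counts are used: by \<open>cap_count\<close> there are at least as many caps as
  tops, and by \<open>caps_inj\<close> at most one cap below each top. The values 0 and 1 of
  \<open>asym\<close> show that the two kinds of caps are different.\<close>

lemma caps_surj: "tp ` caps = tops X r u"
proof (rule card_subset_eq)
  show ft: "finite (tops X r u)" using finite_rows[OF fin] by (simp add: tops_def)
  show sub: "tp ` caps \<subseteq> tops X r u" using height_prop(2) by (auto simp: caps_def)
  have "{C \<in> rows X r. b ` C = C} \<inter> {C \<in> rows X r. flat r u C \<and> u ` C = b ` C} = {}"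
    using asym_cap by fastforce
  then have "card caps = card {C \<in> rows X r. b ` C = C} + card {C \<in> rows X r. flat r u C \<and> u ` C = b ` C}"
    unfolding caps_def using finite_rows[OF fin] by (intro card_Un_disjoint) auto
  then have "card (tops X r u) \<le> card caps"
    using cap_count by (simp add: tops_def flat_def)
  moreover have "card (tp ` caps) = card caps" by (rule card_image[OF caps_inj])
  moreover have "card (tp ` caps) \<le> card (tops X r u)" by (rule card_mono[OF ft sub])
  ultimately show "card (tp ` caps) = card (tops X r u)" by simp
qed

text \<open>The cylinder of \<open>C\<close> contains a cap \<open>D\<close>, and \<open>C\<close>
  and its mirror row lie at equal distance on opposite sides of the middle line that
  \<open>D\<close> marks. The two cases tell which of the two rows is the lower one.\<close>

lemma cylinder_invariant:
  assumes C: "C \<in> rows X r"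
  obtains k where "chain r u C k" "(u ^^ k) ` C = b ` C"
  | k where "chain r u (b ` C) k" "(u ^^ k) ` b ` C = C"
proof -
  have "tp C \<in> tp ` caps" using height_prop(2)[OF C] caps_surj by simp
  then obtain D where D: "D \<in> caps" "tp D = tp C" by auto
  have Dr: "D \<in> rows X r" using D by (auto simp: caps_def)
  have Dc: "b ` D = D \<or> flat r u D \<and> u ` D = b ` D" using D by (auto simp: caps_def)
  show ?thesis
  proof (cases "ht D \<le> ht C")
    case True
    let ?m = "ht C - ht D"
    have m: "(u ^^ ?m) ` C = D" "chain r u C ?m"
      using same_top[OF D(2)[symmetric] True] chain_mono[OF height_prop(1)[OF C]] by auto
    have m2: "chain r u (b ` D) ?m" "(u ^^ ?m) ` b ` D = b ` C"
      using chain_mirror[OF C m(2)] m(1) by auto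
    from Dc show ?thesis
    proof
      assume "b ` D = D"
      then have "chain r u C (?m + ?m)" "(u ^^ (?m + ?m)) ` C = b ` C"
        using chain_append[OF m(2), of ?m] m m2 image_funpow_add[of ?m u ?m C] by simp_all
      then show ?thesis by (rule that(1))
    next
      assume *: "flat r u D \<and> u ` D = b ` D"
      then have "chain r u D (Suc ?m)" using m2 by (simp add: chain_Suc)
      moreover have "(u ^^ Suc ?m) ` D = b ` C" unfolding image_funpow_Suc2 using * m2 by simp
      ultimately have "chain r u C (?m + Suc ?m)" "(u ^^ (?m + Suc ?m)) ` C = b ` C"
        using chain_append[OF m(2), of "Suc ?m"] m image_funpow_add[of "Suc ?m" u ?m C]
        by (simp_all add: add.commute)
      then show ?thesis by (rule that(1))
    qed
  next
    case False
    let ?m = "ht D - ht C"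
    have m: "(u ^^ ?m) ` D = C" "chain r u D ?m"
      using same_top[OF D(2)] False chain_mono[OF height_prop(1)[OF Dr]] by auto
    have m2: "chain r u (b ` C) ?m" "(u ^^ ?m) ` b ` C = b ` D"
      using chain_mirror[OF Dr m(2)] m(1) by auto
    from Dc show ?thesis
    proof
      assume "b ` D = D"
      then have "chain r u (b ` C) (?m + ?m)" "(u ^^ (?m + ?m)) ` b ` C = C"
        using chain_append[OF m2(1), of ?m] m m2 image_funpow_add[of ?m u ?m "b ` C"] by simp_all
      then show ?thesis by (rule that(2))
    next
      assume *: "flat r u D \<and> u ` D = b ` D"
      obtain k where k: "?m = Suc k" using False by (cases ?m) auto
      then have "chain r u (b ` D) k" using m(2) * by (simp add: chain_Suc)
      moreover have "(u ^^ k) ` b ` D = C" using m(1) * k image_funpow_Suc2[of k u D] by simp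
      ultimately have "chain r u (b ` C) (?m + k)" "(u ^^ (?m + k)) ` b ` C = C"
        using chain_append[OF m2(1), of k] m2(2) image_funpow_add[of k u ?m "b ` C"]
        by (simp_all add: add.commute)
      then show ?thesis by (rule that(2))
    qed
  qed
qed

lemma top_mirror:
  assumes C: "C \<in> rows X r"
  shows "tp (b ` C) = tp C"
  using C
proof (cases rule: cylinder_invariant)
  case (1 k)
  then show ?thesis using height_chain(2)[OF C 1(1)] by simp
next
  case (2 k)
  then show ?thesis using height_chain(2)[OF b_row[OF C] 2(1)] by simp
qed

section \<open>Closure under shears\<close>

text \<open>This is \<open>strip_shear\<close> with \<open>r\<close> and \<open>u\<close>
  interchanged, for the strip of rows from the mirror row of \<open>C\<close> up to
  \<open>C\<close>.\<close>

lemma twist_upper: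
  assumes C: "C \<in> rows X r" and ex: "chain r u (b ` C) n" "(u ^^ n) ` b ` C = C"
  shows "\<exists>b'. hyp X r (cshear u r C t) b' d"
proof -
  \<comment> \<open>With the least \<open>k\<close> the row \<open>C\<close> occurs only at the
    upper end of the strip and its mirror row only at the lower end.\<close>
  define k where "k = (LEAST k. chain r u (b ` C) k \<and> (u ^^ k) ` b ` C = C)"
  have k: "chain r u (b ` C) k" "(u ^^ k) ` b ` C = C"
    using LeastI[of "\<lambda>k. chain r u (b ` C) k \<and> (u ^^ k) ` b ` C = C" n] ex by (auto simp: k_def)
  have min: "(u ^^ i) ` b ` C \<noteq> C" if "i < k" for i
    using not_less_Least[of i "\<lambda>k. chain r u (b ` C) k \<and> (u ^^ k) ` b ` C = C"] that
      chain_mono[OF k(1), of i] by (auto simp: k_def)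
  define L where "L i = (u ^^ i) ` b ` C" for i
  have bC: "b ` C \<in> rows X r" by (rule b_row[OF C])
  have L: "L i \<in> rows X r" if "i \<le> k" for i
    unfolding L_def by (rule chain_row[OF origami bC chain_mono[OF k(1) that]])
  have Lk: "L k = C" and L0: "L 0 = b ` C" using k by (simp_all add: L_def)
  have LS: "u x \<in> L (Suc i) \<longleftrightarrow> x \<in> L i" for x i
    unfolding L_def image_funpow_Suc by (auto simp: inj_u)
  have bL: "b ` L i = L (k - i)" if "i \<le> k" for i
  proof -
    have "(u ^^ i) ` b ` L i = C" using chain_mirror(2)[OF bC chain_mono[OF k(1) that]] by (simp add: L_def)
    also have "\<dots> = (u ^^ i) ` L (k - i)" using k(2) that by (simp add: L_def image_funpow_add)
    finally show ?thesis by (simp only: inj_image_funpow)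
  qed
  have Lfl: "flat r u (L i)" if "i < k" for i using k(1) that by (simp add: chain_def L_def)
  let ?J = "\<Union>i \<le> k. L i"
  have "\<exists>b'. hyp X (cshear u r C t) r b' d"
  proof (rule strip_shear[where J = ?J])
    show "hyp X u r b d" by (rule hyp_swap[OF hyp])
    show "?J \<subseteq> X" using L row_subset[OF rp] by blast
    show "C \<subseteq> ?J" using Lk by blast
    show "r x \<in> ?J \<longleftrightarrow> x \<in> ?J" for x using row_step_iff[OF fin rp L] by auto
    have bJ: "b x \<in> ?J" if "x \<in> ?J" for x
    proof -
      obtain i where i: "i \<le> k" "x \<in> L i" using \<open>x \<in> ?J\<close> by blast
      then have "b x \<in> L (k - i)" using bL[OF i(1)] by blast
      then show ?thesis by force
    qed
    show "b x \<in> ?J \<longleftrightarrow> x \<in> ?J" for x using bJ[of x] bJ[of "b x"] by auto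
    show "r x \<in> C \<longleftrightarrow> x \<in> C" for x by (rule row_step_iff[OF fin rp C])
    show "u x \<in> ?J \<and> b (u x) \<notin> C \<and> r (u x) = u (r x)" if "x \<in> ?J" "x \<notin> C" for x
    proof -
      obtain i where i: "i \<le> k" "x \<in> L i" using \<open>x \<in> ?J\<close> by blast
      have ik: "i < k" using i Lk that(2) by (cases "i = k") auto
      have ux: "u x \<in> L (Suc i)" using LS i by simp
      have "b (u x) \<notin> C"
      proof
        assume "b (u x) \<in> C"
        then have "u x \<in> L 0" using L0 by (metis bb image_eqI)
        then have "L (Suc i) = L 0" using rows_disjoint[OF fin rp L[of "Suc i"] L[of 0] ux] ik by simp
        moreover have "L k = (u ^^ (k - Suc i)) ` L (Suc i)"
          unfolding L_def image_funpow_add using ik by simp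
        ultimately have "L k = (u ^^ (k - Suc i)) ` b ` C" using L0 by simp
        then show False using min[of "k - Suc i"] Lk ik by simp
      qed
      moreover have "r (u x) = u (r x)" using Lfl[OF ik] i(2) by (simp add: flat_def)
      ultimately show ?thesis using ux ik by (auto intro: Suc_leI)
    qed
    show "u x \<notin> ?J \<or> b (u x) \<in> C" if "x \<notin> ?J \<or> x \<in> C" for x
    proof (rule ccontr)
      assume "\<not> ?thesis"
      then obtain i where i: "i \<le> k" "u x \<in> L i" and n: "b (u x) \<notin> C" by blast
      obtain j where j: "i = Suc j" using i n L0 by (cases i) auto
      then have xj: "x \<in> L j" "j < k" using i LS by auto
      then have "x \<in> C" using that by auto
      then have "L j = C" using rows_disjoint[OF fin rp L[OF less_imp_le[OF xj(2)]] C xj(1)] by blast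
      then show False using min[OF xj(2)] L_def[of j] by simp
    qed
  qed
  then show ?thesis using hyp_swap by blast
qed

end

text \<open>If the mirror row is above \<open>C\<close>, then it is below \<open>C\<close> for
  \<open>pinv u\<close>, where \<open>twist_upper\<close> applies. Inverting the sheared map again
  leaves the twist on the wrong side of \<open>u\<close>; conjugation by the twist \<open>w\<close>,
  which commutes with \<open>r\<close>, moves it to the right side.\<close>

lemma shear_hyp_u:
  assumes "hyp X r u b d" "C \<in> rows X r"
  shows "\<exists>b'. hyp X r (cshear u r C t) b' d"
proof -
  interpret hyp_origami X r u b d by unfold_locales (rule assms(1))
  show ?thesis
    using assms(2)
  proof (cases rule: cylinder_invariant)
    case (2 k)
    then show ?thesis using twist_upper[OF assms(2)] by blast
  next
    case (1 k)
    have iu: "u (pinv u x) = x" "pinv u (u x) = x" for x using permutes_inverses[OF up] by auto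
    have h': "hyp X r (pinv u) b d" by (rule hyp_swap[OF hyp_inv[OF hyp_swap[OF hyp]]])
    interpret I: hyp_origami X r "pinv u" b d by unfold_locales (rule h')
    have im: "(pinv u ^^ i) ` (u ^^ i) ` A = A" for i A
    proof (induction i)
      case (Suc i)
      have "(pinv u ^^ Suc i) ` (u ^^ Suc i) ` A = (pinv u ^^ i) ` (pinv u ` u ` (u ^^ i) ` A)"
        by (simp only: image_funpow_Suc2[of i "pinv u"] image_funpow_Suc[of i u])
      also have "pinv u ` u ` (u ^^ i) ` A = (u ^^ i) ` A" by (simp add: image_image iu)
      finally show ?case using Suc by simp
    qed simp
    have lev: "(pinv u ^^ i) ` b ` C = (u ^^ (k - i)) ` C" if "i \<le> k" for i
      using im[of i "(u ^^ (k - i)) ` C"] 1(2) that by (simp add: image_funpow_add)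
    have ch: "chain r (pinv u) (b ` C) k"
      unfolding chain_def
    proof (intro allI impI)
      fix i assume i: "i < k"
      have fl: "flat r u ((u ^^ (k - Suc i)) ` C)" using 1(1) i by (simp add: chain_def)
      have e: "(u ^^ (k - i)) ` C = u ` (u ^^ (k - Suc i)) ` C"
        using image_funpow_Suc[of "k - Suc i" u C] i by (simp add: Suc_diff_Suc del: funpow.simps)
      show "flat r (pinv u) ((pinv u ^^ i) ` b ` C)"
        unfolding lev[OF less_imp_le[OF i]] e flat_def
      proof
        fix x assume "x \<in> u ` (u ^^ (k - Suc i)) ` C"
        then obtain y where y: "x = u y" "y \<in> (u ^^ (k - Suc i)) ` C" by blast
        have "u (r y) = r (u y)" using fl y(2) unfolding flat_def by (rule bspec)
        then have "r x = u (r y)" using y(1) by simp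
        then show "pinv u (r x) = r (pinv u x)" using y by (simp add: iu)
      qed
    qed
    have end': "(pinv u ^^ k) ` b ` C = C" using lev[of k] by simp
    obtain k0 where k0: "k0 > 0" "r ^^ k0 = id" using permutes_funpow_id[OF fin rp] by blast
    \<comment> \<open>Exponent of the inverse twist: \<open>r ^^ s\<close> undoes
      \<open>r ^^ t\<close>.\<close>
    define s where "s = (k0 - 1) * t"
    have "(r ^^ (s + t)) x = x" for x
    proof -
      have "s + t = k0 * t" using k0(1) by (cases k0) (simp_all add: s_def)
      then have "r ^^ (s + t) = (r ^^ k0) ^^ t" by (simp add: funpow_mult mult.commute)
      then show ?thesis using k0(2) by simp
    qed
    then have st: "(r ^^ s) ((r ^^ t) x) = x" "(r ^^ t) ((r ^^ s) x) = x" for x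
      by (metis funpow_add comp_apply, metis funpow_add comp_apply add.commute)
    have cl: "(r ^^ n) x \<in> C \<longleftrightarrow> x \<in> C" for x n
      by (induction n) (simp_all add: row_step_iff[OF fin rp assms(2)])
    define w where "w x = (if x \<in> C then (r ^^ s) x else x)" for x
    define w' where "w' x = (if x \<in> C then (r ^^ t) x else x)" for x
    have ww: "w (w' x) = x" "w' (w x) = x" for x by (simp_all add: w_def w'_def cl st)
    obtain b1 where b1: "hyp X r (cshear (pinv u) r C s) b1 d"
      using I.twist_upper[OF assms(2) ch end'] by blast
    have b2: "hyp X r (pinv (cshear (pinv u) r C s)) b1 d"
      by (rule hyp_swap[OF hyp_inv[OF hyp_swap[OF b1]]])
    have e: "pinv (cshear (pinv u) r C s) x = w' (u x)" for x
    proof (rule inv_f_eq)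
      show "inj (cshear (pinv u) r C s)"
        using b1 origamiD(3) permutes_inj unfolding hyp_def by blast
      have "cshear (pinv u) r C s y = pinv u (w y)" for y by (simp add: cshear_def w_def)
      then show "cshear (pinv u) r C s (w' (u x)) = x" by (simp add: ww iu)
    qed
    have wp: "w permutes X"
      using cshear_permutes[OF fin permutes_id rp, of C s] row_subset[OF rp assms(2)]
        row_step_iff[OF fin rp assms(2)]
      by (simp add: cshear_def[abs_def] w_def[abs_def])
    show ?thesis
    proof (rule hyp_conj[OF b2 wp])
      show "r (w x) = w (r x)" for x
        by (simp add: w_def row_step_iff[OF fin rp assms(2)] funpow_swap1)
      have "cshear u r C t x = u (w' x)" for x by (simp add: cshear_def w'_def)
      then show "cshear u r C t (w x) = w (pinv (cshear (pinv u) r C s) x)" for x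
        by (simp add: e ww)
    qed
  qed
qed

lemma shear_hyp_r:
  assumes "hyp X r u b d" "C \<in> rows X u"
  shows "\<exists>b'. hyp X (cshear r u C t) u b' d"
  using shear_hyp_u[OF hyp_swap[OF assms(1)] assms(2)] hyp_swap by blast

section \<open>Merging rows\<close>

text \<open>The counter counts shears only, since relabelling the squares does not change the
  isomorphism class. The exponent \<open>t\<close> may be 0; \<open>chart_move\<close> supplies a
  positive exponent with the same effect.\<close>

inductive reach :: "'a set \<Rightarrow> ('a \<Rightarrow> 'a) \<Rightarrow> ('a \<Rightarrow> 'a) \<Rightarrow> nat \<Rightarrow>
    'a set \<Rightarrow> ('a \<Rightarrow> 'a) \<Rightarrow> ('a \<Rightarrow> 'a) \<Rightarrow> bool" for X r u where
  reach_refl: "reach X r u 0 X r u"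
| reach_u: "reach X r u n Y s v \<Longrightarrow> C \<in> rows Y s \<Longrightarrow> reach X r u (Suc n) Y s (cshear v s C t)"
| reach_r: "reach X r u n Y s v \<Longrightarrow> C \<in> rows Y v \<Longrightarrow> reach X r u (Suc n) Y (cshear s v C t) v"
| reach_relabel: "reach X r u n Y s v \<Longrightarrow> bij_betw p Y Z \<Longrightarrow>
    \<forall>x \<in> Y. s' (p x) = p (s x) \<and> v' (p x) = p (v x) \<Longrightarrow> s' permutes Z \<Longrightarrow> v' permutes Z \<Longrightarrow>
    reach X r u n Z s' v'"

lemma reach_trans:
  assumes "reach Y s v n Z s' v'" "reach X r u m Y s v"
  shows "reach X r u (m + n) Z s' v'"
  using assms(1)
proof induction
  case reach_refl
  then show ?case using assms(2) by simp
next
  case (reach_u n Y s v C t)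
  then show ?case using reach.reach_u by fastforce
next
  case (reach_r n Y s v C t)
  then show ?case using reach.reach_r by fastforce
next
  case (reach_relabel n Y s v p Z s' v')
  show ?case by (rule reach.reach_relabel[OF reach_relabel.IH reach_relabel.hyps(2-)])
qed

lemma cshear_1: "cshear r w c (Suc 0) x = (if x \<in> c then r (w x) else r x)"
  by (simp add: cshear_def)

text \<open>From \<open>y \<in> c\<close> the new map jumps to the row of \<open>w y\<close>, runs
  once around it until it is back at \<open>w y\<close>, the only point of \<open>c\<close> on that
  row, and then jumps on to the row of \<open>w (w y)\<close>. So the rows are concatenated in the
  order in which \<open>c\<close> crosses them.\<close>

lemma merge_rows:
  assumes fin: "finite X" and rp: "r permutes X" and wp: "w permutes X" and c: "c \<in> rows X w"
    and once: "\<And>y z. y \<in> c \<Longrightarrow> z \<in> c \<Longrightarrow> z \<in> orbit r y \<Longrightarrow> z = y"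
  defines "r3 \<equiv> cshear r w c 1" and "A \<equiv> \<Union>y \<in> c. orbit r y"
  shows "y \<in> c \<Longrightarrow> orbit r3 y = A" and "x \<notin> A \<Longrightarrow> orbit r3 x = orbit r x"
proof -
  have r3: "r3 x = (if x \<in> c then r (w x) else r x)" for x by (simp add: r3_def cshear_1)
  have wc: "w x \<in> c \<longleftrightarrow> x \<in> c" for x by (rule row_step_iff[OF fin wp c])
  have r3p: "r3 permutes X"
    unfolding r3_def by (rule cshear_permutes[OF fin rp wp row_subset[OF wp c] wc])
  have self: "x \<in> orbit r x" for x by (rule permutes_self_in_orbit[OF fin rp])
  have self3: "x \<in> orbit r3 x" for x by (rule permutes_self_in_orbit[OF fin r3p])
  have nxt: "orbit r (w y) \<subseteq> orbit r3 y" if y: "y \<in> c" for y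
  proof -
    have "orbit r (r (w y)) \<subseteq> {z \<in> orbit r (w y). z \<in> orbit r3 y}"
    proof (rule orbit_subset_closed)
      have "r3 y = r (w y)" using y by (simp add: r3)
      then have base: "r (w y) \<in> orbit r3 y" using orbit.base[of r3 y] by simp
      then show "r (w y) \<in> {z \<in> orbit r (w y). z \<in> orbit r3 y}" by (auto intro: orbit.base)
      fix z assume z: "z \<in> {z \<in> orbit r (w y). z \<in> orbit r3 y}"
      have "r z \<in> orbit r3 y"
      proof (cases "z = w y")
        case True then show ?thesis using base by simp
      next
        case False
        then have "z \<notin> c" using once[of "w y" z] y z wc by auto
        then have "r3 z = r z" by (simp add: r3)
        then show ?thesis using orbit.step[of z r3 y] z by simp
      qed
      then show "r z \<in> {z \<in> orbit r (w y). z \<in> orbit r3 y}" using z orbit.step[of z r "w y"] by simp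
    qed
    moreover have "orbit r (r (w y)) = orbit r (w y)" by (rule permutes_orbit_eq[OF fin rp orbit.base])
    ultimately show ?thesis by blast
  qed
  have nxt_eq: "orbit r3 (w y) = orbit r3 y" if y: "y \<in> c" for y
    using nxt[OF y] self permutes_orbit_eq[OF fin r3p] by blast
  have A_closed: "r3 z \<in> A" if z: "z \<in> A" for z
  proof (cases "z \<in> c")
    case True
    then show ?thesis using wc by (auto simp: r3 A_def intro: orbit.base)
  next
    case False
    then show ?thesis using z by (auto simp: r3 A_def intro: orbit.step)
  qed
  show "orbit r3 y = A" if y: "y \<in> c"
  proof
    show "orbit r3 y \<subseteq> A"
      by (rule orbit_subset_closed) (use y self A_closed in \<open>auto simp: A_def\<close>)
    have cy: "c = orbit w y" by (rule row_eq_orbit[OF fin wp c y])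
    have "orbit w y \<subseteq> {z \<in> c. orbit r3 z = orbit r3 y}"
      by (rule orbit_subset_closed) (use y nxt_eq wc in auto)
    then have all: "orbit r3 z = orbit r3 y" if "z \<in> c" for z using cy that by blast
    show "A \<subseteq> orbit r3 y" unfolding A_def
    proof (rule UN_least)
      fix z assume z: "z \<in> c"
      obtain z' where z': "z = w z'" using permutes_surj[OF wp] by (metis surjD)
      then have "z' \<in> c" using z wc by simp
      then show "orbit r z \<subseteq> orbit r3 y" using nxt[of z'] all[of z'] z' by simp
    qed
  qed
  show "orbit r3 x = orbit r x" if x: "x \<notin> A"
  proof -
    have dis: "z \<notin> c" if z: "z \<in> orbit r x" for z
    proof
      assume "z \<in> c"
      then have "orbit r z \<subseteq> A" by (auto simp: A_def)
      moreover have "orbit r z = orbit r x" by (rule permutes_orbit_eq[OF fin rp z])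
      ultimately show False using x self by blast
    qed
    show ?thesis
    proof
      show 1: "orbit r3 x \<subseteq> orbit r x"
        by (rule orbit_subset_closed) (use self dis in \<open>auto simp: r3 intro: orbit.step\<close>)
      have "orbit r x \<subseteq> {z \<in> orbit r x. z \<in> orbit r3 x}"
      proof (rule orbit_subset_closed)
        fix z assume z: "z \<in> {z \<in> orbit r x. z \<in> orbit r3 x}"
        then have "r3 z = r z" using dis by (simp add: r3)
        then show "r z \<in> {z \<in> orbit r x. z \<in> orbit r3 x}"
          using z orbit.step[of z r3 x] orbit.step[of z r x] by simp
      qed (use self self3 in blast)
      then show "orbit r x \<subseteq> orbit r3 x" by blast
    qed
  qed
qed

lemma row_transport:
  assumes "finite X" "r permutes X" "y \<in> orbit r x"
  obtains t where "(r ^^ t) x = y"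
proof -
  have "y \<in> {(r ^^ n) x | n. True}" using assms permutes_orbit_altdef by metis
  then show ?thesis using that by blast
qed

context hyp_origami
begin

lemma self_row: "x \<in> orbit r x"
  by (rule permutes_self_in_orbit[OF fin rp])

lemma orbit_row: "x \<in> X \<Longrightarrow> orbit r x \<in> rows X r"
  by (simp add: rows_def)

lemma u_funpow_in: "x \<in> X \<Longrightarrow> (u ^^ i) x \<in> X"
  using permutes_in_image[OF permutes_funpow[OF up]] by blast

lemma climb:
  assumes x: "x \<in> X" and i: "i \<le> ht (orbit r x)"
  shows "orbit r ((u ^^ i) x) = (u ^^ i) ` orbit r x"
    "ht (orbit r ((u ^^ i) x)) = ht (orbit r x) - i" "tp (orbit r ((u ^^ i) x)) = tp (orbit r x)"
proof -
  note C = orbit_row[OF x]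
  have ch: "chain r u (orbit r x) i" by (rule chain_mono[OF height_prop(1)[OF C] i])
  have "(u ^^ i) ` orbit r x \<in> rows X r" by (rule chain_row[OF origami C ch])
  moreover have "(u ^^ i) x \<in> (u ^^ i) ` orbit r x" using self_row by blast
  ultimately show e: "orbit r ((u ^^ i) x) = (u ^^ i) ` orbit r x" using row_eq_orbit[OF fin rp] by blast
  show "ht (orbit r ((u ^^ i) x)) = ht (orbit r x) - i" "tp (orbit r ((u ^^ i) x)) = tp (orbit r x)"
    unfolding e using height_chain[OF C ch] by auto
qed

lemma top_of_top:
  assumes "C \<in> tops X r u"
  shows "tp C = C" "ht C = 0"
proof -
  have "\<not> flat r u ((u ^^ 0) ` C)" using assms by (simp add: tops_def)
  then show "ht C = 0" unfolding height_def by (rule Least_eq_0)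
  then show "tp C = C" by (simp add: top_row_def)
qed

lemma climb_top:
  assumes x: "x \<in> X"
  shows "(u ^^ ht (orbit r x)) x \<in> tp (orbit r x)"
  unfolding top_row_def using self_row by blast

lemma climb_not_top:
  assumes x: "x \<in> X" "i < ht (orbit r x)" "T \<in> tops X r u"
  shows "(u ^^ i) x \<notin> T"
proof
  assume "(u ^^ i) x \<in> T"
  then have "orbit r ((u ^^ i) x) = T"
    using row_eq_orbit[OF fin rp, of T] assms(3) by (auto simp: tops_def)
  then have "ht T = ht (orbit r x) - i" using climb(2)[OF x(1), of i] x(2) by simp
  then show False using top_of_top(2)[OF assms(3)] x(2) by simp
qed

text \<open>With a single maximal cylinder, the climb from \<open>u x\<close>, with \<open>x\<close>
  in the top row, returns to the top row after passing each row once. A twist of the top row closes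
  this climb to a vertical cycle, and a shear along that cycle merges all rows.\<close>

lemma merge_last:
  assumes one: "tops X r u = {T}"
  shows "\<exists>r' u' b'. reach X r u 2 X r' u' \<and> hyp X r' u' b' d \<and> rows X r' = {X}"
proof -
  have T: "T \<in> tops X r u" "T \<in> rows X r" using one by (auto simp: tops_def)
  obtain x where xT: "x \<in> T" using row_nonempty[OF T(2)] by blast
  have x: "x \<in> X" using xT row_subset[OF rp T(2)] by blast
  have ux: "u x \<in> X" using x permutes_in_image[OF up] by simp
  define k where "k = ht (orbit r (u x))"
  have tpT: "tp D = T" if "D \<in> rows X r" for D using height_prop(2)[OF that] one by simp
  have y0: "(u ^^ k) (u x) \<in> T" using climb_top[OF ux] tpT[OF orbit_row[OF ux]] by (simp add: k_def)
  then have "x \<in> orbit r ((u ^^ k) (u x))" using row_eq_orbit[OF fin rp T(2)] xT by metis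
  then obtain t where t: "(r ^^ t) ((u ^^ k) (u x)) = x" by (rule row_transport[OF fin rp])
  define u1 where "u1 = cshear u r T t"
  obtain b1 where b1: "hyp X r u1 b1 d" using shear_hyp_u[OF hyp T(2)] unfolding u1_def by blast
  define a where "a i = (u ^^ i) (u x)" for i
  have a_X: "a i \<in> X" for i using u_funpow_in[OF ux] by (simp add: a_def)
  have u1a: "u1 (a i) = a (Suc i)" if "i < k" for i
    using climb_not_top[OF ux _ T(1), of i] that by (simp add: u1_def cshear_def a_def k_def)
  have u1k: "u1 (a k) = a 0" using y0 t by (simp add: u1_def cshear_def a_def)
  define c where "c = orbit u1 (a 0)"
  have u1p: "u1 permutes X" using b1 by (simp add: hyp_def origami_def)
  have c: "c \<in> rows X u1" using a_X by (simp add: c_def rows_def)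
  have c_eq: "c = a ` {..k}"
  proof
    show "c \<subseteq> a ` {..k}" unfolding c_def
    proof (rule orbit_subset_closed)
      fix y assume "y \<in> a ` {..k}"
      then obtain i where i: "i \<le> k" "y = a i" by auto
      show "u1 y \<in> a ` {..k}"
      proof (cases "i = k")
        case True then show ?thesis using i u1k by auto
      next
        case False
        then have "u1 y = a (Suc i)" "Suc i \<le> k" using i u1a by auto
        then show ?thesis by auto
      qed
    qed auto
    have "a i \<in> c" if "i \<le> k" for i using that
    proof (induction i)
      case 0 then show ?case using permutes_self_in_orbit[OF fin u1p] by (simp add: c_def)
    next
      case (Suc i)
      then have "u1 (a i) \<in> c" unfolding c_def by (intro orbit.step) simp
      then show ?case using u1a[of i] Suc.prems by simp
    qed
    then show "a ` {..k} \<subseteq> c" by auto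
  qed
  have hta: "ht (orbit r (a i)) = k - i" if "i \<le> k" for i
    using climb(2)[OF ux, of i] that by (simp add: a_def k_def)
  have once: "z = y" if "y \<in> c" "z \<in> c" "z \<in> orbit r y" for y z
  proof -
    obtain i j where ij: "i \<le> k" "j \<le> k" "y = a i" "z = a j" using \<open>y \<in> c\<close> \<open>z \<in> c\<close> c_eq by auto
    have "orbit r z = orbit r y" by (rule permutes_orbit_eq[OF fin rp \<open>z \<in> orbit r y\<close>])
    then have "k - i = k - j" using hta ij by metis
    then show ?thesis using ij by (simp add: diff_diff_cancel) (metis diff_diff_cancel)
  qed
  define r3 where "r3 = cshear r u1 c 1"
  obtain b3 where b3: "hyp X r3 u1 b3 d" using shear_hyp_r[OF b1 c] unfolding r3_def by blast
  have "reach X r u (Suc (Suc 0)) X r3 u1" unfolding r3_def u1_def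
    by (intro reach_r reach_u reach_refl T(2) c[unfolded u1_def])
  moreover have "rows X r3 = {X}"
  proof -
    have all: "D \<in> (\<lambda>y. orbit r y) ` c" if D: "D \<in> rows X r" for D
    proof -
      have C0: "orbit r (u x) \<in> rows X r" by (rule orbit_row[OF ux])
      \<comment> \<open>No row is lower than that of \<open>u x\<close>: the row directly below it
        would be flat, but it would contain \<open>x\<close> and hence be \<open>T\<close>.\<close>
      have "ht D \<le> k"
      proof (rule ccontr)
        assume gt: "\<not> ht D \<le> k"
        define m where "m = ht D - k - 1"
        have mm: "ht D - k = Suc m" "m < ht D" using gt by (auto simp: m_def)
        have "(u ^^ Suc m) ` D = orbit r (u x)"
          using same_top[of D "orbit r (u x)"] tpT[OF D] tpT[OF C0] gt mm(1) by (simp add: k_def)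
        then have "u ` (u ^^ m) ` D = orbit r (u x)" by (simp only: image_funpow_Suc)
        then have "u x \<in> u ` (u ^^ m) ` D" using self_row by simp
        then have xD: "x \<in> (u ^^ m) ` D" by (auto simp: inj_u)
        have chD: "chain r u D (ht D)" by (rule height_prop(1)[OF D])
        then have fl: "flat r u ((u ^^ m) ` D)" using mm(2) by (simp add: chain_def)
        have "(u ^^ m) ` D \<in> rows X r"
          by (rule chain_row[OF origami D chain_mono[OF chD]]) (use mm in simp)
        then have "(u ^^ m) ` D = T" using rows_disjoint[OF fin rp _ T(2) xD xT] by blast
        then show False using fl T(1) by (simp add: tops_def)
      qed
      then have "(u ^^ (k - ht D)) ` orbit r (u x) = D"
        using same_top[of "orbit r (u x)" D] tpT[OF D] tpT[OF C0] by (simp add: k_def)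
      then have "D = orbit r (a (k - ht D))"
        using climb(1)[OF ux, of "k - ht D"] by (simp add: a_def k_def)
      then show ?thesis using c_eq by auto
    qed
    have A: "(\<Union>y \<in> c. orbit r y) = X"
    proof
      show "(\<Union>y \<in> c. orbit r y) \<subseteq> X"
        using a_X row_subset[OF rp orbit_row] by (fastforce simp: c_eq)
      show "X \<subseteq> (\<Union>y \<in> c. orbit r y)"
      proof
        fix z assume "z \<in> X"
        then have "orbit r z \<in> (\<lambda>y. orbit r y) ` c" using all orbit_row by blast
        then show "z \<in> (\<Union>y \<in> c. orbit r y)" using self_row by blast
      qed
    qed
    have a0: "a 0 \<in> c" using c_eq by auto
    have oX: "orbit r3 (a 0) = X"
      using merge_rows(1)[OF fin rp u1p c once a0] A by (simp add: r3_def)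
    have r3p: "r3 permutes X" using b3 by (simp add: hyp_def origami_def)
    have "orbit r3 z = X" if "z \<in> X" for z
      using permutes_orbit_eq[OF fin r3p, of z "a 0"] oX that by simp
    then show ?thesis using ne by (auto simp: rows_def)
  qed
  ultimately show ?thesis using b3 unfolding numeral_2_eq_2 by blast
qed

text \<open>A step up from \<open>x\<close> in a top row \<open>T\<close> to another cylinder, with
  top \<open>T'\<close>, has a mirror image: the step from \<open>b (u x)\<close> to
  \<open>b x\<close> leads from \<open>T'\<close> back to the cylinder of \<open>T\<close>. Twists
  of \<open>T'\<close> and \<open>T\<close> join the climbs from \<open>u x\<close> and from
  \<open>b x\<close> to one vertical cycle, which meets every row at most once.\<close>

lemma merge_two:
  assumes two: "card (tops X r u) \<ge> 2"
  shows "\<exists>r' u' b'. reach X r u 3 X r' u' \<and> hyp X r' u' b' d \<and> card (tops X r' u') < card (tops X r u)"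
proof -
  have fT: "finite (tops X r u)" using finite_rows[OF fin] by (simp add: tops_def)
  obtain T where T: "T \<in> tops X r u" using two by fastforce
  have Tr: "T \<in> rows X r" using T by (simp add: tops_def)
  \<comment> \<open>Otherwise the squares of the cylinder below \<open>T\<close> would be closed
    under \<open>r\<close> and \<open>u\<close> and there would be no second top.\<close>
  have "\<exists>x \<in> T. tp (orbit r (u x)) \<noteq> T"
  proof (rule ccontr)
    assume "\<not> ?thesis"
    then have no: "tp (orbit r (u x)) = T" if "x \<in> T" for x using that by blast
    have "{z \<in> X. tp (orbit r z) = T} = X"
    proof (rule origami_closed[OF origami])
      obtain z where z: "z \<in> T" using row_nonempty[OF Tr] by blast
      then have "orbit r z = T" "z \<in> X" using row_eq_orbit[OF fin rp Tr] row_subset[OF rp Tr] by auto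
      then show "{z \<in> X. tp (orbit r z) = T} \<noteq> {}" using top_of_top(1)[OF T] by auto
      fix z assume z: "z \<in> {z \<in> X. tp (orbit r z) = T}"
      show "r z \<in> {z \<in> X. tp (orbit r z) = T}"
        using z permutes_in_image[OF rp] permutes_orbit_eq[OF fin rp orbit.base, of z] by simp
      have "tp (orbit r (u z)) = T"
      proof (cases "flat r u (orbit r z)")
        case True
        then show ?thesis
          using height_flat(2)[OF orbit_row True] flat_image_orbit[OF fin rp True] z by simp
      next
        case False
        then have "orbit r z \<in> tops X r u" using z orbit_row by (simp add: tops_def)
        then have "orbit r z = T" using top_of_top(1) z by simp
        then show ?thesis using no self_row by blast
      qed
      then show "u z \<in> {z \<in> X. tp (orbit r z) = T}" using z permutes_in_image[OF up] by simp
    qed auto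
    then have "tops X r u \<subseteq> {T}" using top_of_top(1) by (auto simp: tops_def rows_def)
    then show False using two card_mono[of "{T}" "tops X r u"] by simp
  qed
  then obtain x where xT: "x \<in> T" and xn: "tp (orbit r (u x)) \<noteq> T" by blast
  have x: "x \<in> X" using xT row_subset[OF rp Tr] by blast
  have ux: "u x \<in> X" and bx: "b x \<in> X" and bux: "b (u x) \<in> X"
    using x permutes_in_image[OF up] permutes_in_image[OF b_permutes] by simp_all
  define T' where "T' = tp (orbit r (u x))"
  have T': "T' \<in> tops X r u" "T' \<in> rows X r" "T' \<noteq> T"
    using height_prop(2)[OF orbit_row[OF ux]] xn by (auto simp: T'_def tops_def)
  have Tx: "T = orbit r x" by (rule row_eq_orbit[OF fin rp Tr xT])
  have bo: "orbit r (b z) = b ` orbit r z" for z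
    by (rule inverts_image_orbit[OF fin rp inverts_br, symmetric])
  have tpb: "tp (orbit r (b x)) = T"
    unfolding bo Tx[symmetric] using top_mirror[OF Tr] top_of_top(1)[OF T] by simp
  have tpbu: "tp (orbit r (b (u x))) = T'"
    unfolding bo T'_def by (rule top_mirror[OF orbit_row[OF ux]])
  \<comment> \<open>The square \<open>b (u x)\<close> is in the cylinder of \<open>T'\<close>, but
    \<open>u\<close> takes it to \<open>b x\<close> in the cylinder of \<open>T\<close>, so it is in
    the top row.\<close>
  have "\<not> flat r u (orbit r (b (u x)))"
  proof
    assume fl: "flat r u (orbit r (b (u x)))"
    have "tp (orbit r (u (b (u x)))) = T'"
      using height_flat(2)[OF orbit_row[OF bux] fl] flat_image_orbit[OF fin rp fl] tpbu by simp
    then show False using tpb T'(3) by simp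
  qed
  then have "orbit r (b (u x)) \<in> tops X r u" using orbit_row[OF bux] by (simp add: tops_def)
  then have "orbit r (b (u x)) = T'" using top_of_top(1) tpbu by simp
  then have yT': "b (u x) \<in> T'" using self_row by blast
  define k where "k = ht (orbit r (u x))"
  define l where "l = ht (orbit r (b x))"
  define a where "a i = (u ^^ i) (u x)" for i
  define e where "e i = (u ^^ i) (b x)" for i
  have ak: "a k \<in> T'" using climb_top[OF ux] by (simp add: a_def k_def T'_def)
  have el: "e l \<in> T" using climb_top[OF bx] tpb by (simp add: e_def l_def)
  have "b (u x) \<in> orbit r (a k)" using row_eq_orbit[OF fin rp T'(2) ak] yT' by simp
  then obtain t where t: "(r ^^ t) (a k) = b (u x)" by (rule row_transport[OF fin rp])
  have "x \<in> orbit r (e l)" using row_eq_orbit[OF fin rp Tr el] xT by simp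
  then obtain s where s: "(r ^^ s) (e l) = x" by (rule row_transport[OF fin rp])
  define u1 where "u1 = cshear u r T' t"
  define u2 where "u2 = cshear u1 r T s"
  obtain b1 where b1: "hyp X r u1 b1 d" using shear_hyp_u[OF hyp T'(2)] unfolding u1_def by blast
  obtain b2 where b2: "hyp X r u2 b2 d" using shear_hyp_u[OF b1 Tr] unfolding u2_def by blast
  have dis: "z \<notin> T'" if "z \<in> T" for z using rows_disjoint[OF fin rp Tr T'(2) that] T'(3) by blast
  have rT: "(r ^^ n) z \<in> T \<longleftrightarrow> z \<in> T" for n z
    by (induction n) (simp_all add: row_step_iff[OF fin rp Tr])
  have u2: "u2 z = (if z \<in> T then u ((r ^^ s) z) else if z \<in> T' then u ((r ^^ t) z) else u z)" for z
    using dis rT by (auto simp: u2_def u1_def cshear_def)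
  have u2p: "u2 permutes X" using b2 by (simp add: hyp_def origami_def)
  have aX: "a i \<in> X" and eX: "e i \<in> X" for i
    using u_funpow_in[OF ux] u_funpow_in[OF bx] by (simp_all add: a_def e_def)
  have u2a: "u2 (a i) = a (Suc i)" if "i < k" for i
    using climb_not_top[OF ux _ T(1), of i] climb_not_top[OF ux _ T'(1), of i] that
    by (simp add: u2 a_def k_def)
  have u2e: "u2 (e i) = e (Suc i)" if "i < l" for i
    using climb_not_top[OF bx _ T(1), of i] climb_not_top[OF bx _ T'(1), of i] that
    by (simp add: u2 e_def l_def)
  have u2k: "u2 (a k) = e 0" using ak dis[of "a k"] t by (auto simp: u2 e_def)
  have u2l: "u2 (e l) = a 0" using el s by (simp add: u2 a_def)
  define P where "P = a ` {..k} \<union> e ` {..l}"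
  define c where "c = orbit u2 (a 0)"
  have c: "c \<in> rows X u2" using aX by (simp add: c_def rows_def)
  have c_eq: "c = P"
  proof
    show "c \<subseteq> P" unfolding c_def
    proof (rule orbit_subset_closed)
      fix y assume "y \<in> P"
      then consider i where "i \<le> k" "y = a i" | i where "i \<le> l" "y = e i" by (auto simp: P_def)
      then show "u2 y \<in> P"
      proof cases
        case (1 i)
        then show ?thesis using u2k u2a[of i] by (cases "i = k") (auto simp: P_def)
      next
        case (2 i)
        then show ?thesis using u2l u2e[of i] by (cases "i = l") (auto simp: P_def)
      qed
    qed (auto simp: P_def)
    have ac: "a i \<in> c" if "i \<le> k" for i using that
    proof (induction i)
      case 0 then show ?case using permutes_self_in_orbit[OF fin u2p] by (simp add: c_def)
    next
      case (Suc i)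
      then have "u2 (a i) \<in> c" unfolding c_def by (intro orbit.step) simp
      then show ?case using u2a[of i] Suc.prems by simp
    qed
    have ec: "e i \<in> c" if "i \<le> l" for i using that
    proof (induction i)
      case 0
      have "u2 (a k) \<in> c" using ac[of k] unfolding c_def by (intro orbit.step) simp
      then show ?case using u2k by simp
    next
      case (Suc i)
      then have "u2 (e i) \<in> c" unfolding c_def by (intro orbit.step) simp
      then show ?case using u2e[of i] Suc.prems by simp
    qed
    show "P \<subseteq> c" using ac ec by (auto simp: P_def)
  qed
  have hta: "ht (orbit r (a i)) = k - i" "tp (orbit r (a i)) = T'" if "i \<le> k" for i
    using climb(2,3)[OF ux, of i] that by (simp_all add: a_def k_def T'_def)
  have hte: "ht (orbit r (e i)) = l - i" "tp (orbit r (e i)) = T" if "i \<le> l" for i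
    using climb(2,3)[OF bx, of i] that tpb by (simp_all add: e_def l_def)
  have once: "z = y" if "y \<in> c" "z \<in> c" "z \<in> orbit r y" for y z
  proof -
    have eq: "orbit r z = orbit r y" by (rule permutes_orbit_eq[OF fin rp \<open>z \<in> orbit r y\<close>])
    have d1: "i = j" if "i \<le> n" "j \<le> n" "n - i = n - j" for i j n :: nat using that by linarith
    consider i j where "i \<le> k" "j \<le> k" "y = a i" "z = a j" | i j where "i \<le> l" "j \<le> l" "y = e i" "z = e j"
      | i j where "i \<le> k" "j \<le> l" "y = a i" "z = e j" | i j where "i \<le> l" "j \<le> k" "y = e i" "z = a j"
      using \<open>y \<in> c\<close> \<open>z \<in> c\<close> unfolding c_eq P_def by blast
    then show ?thesis
    proof cases
      case (1 i j)
      then have "k - i = k - j" using hta(1)[of i] hta(1)[of j] eq by simp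
      then show ?thesis using d1[of i k j] 1 by simp
    next
      case (2 i j)
      then have "l - i = l - j" using hte(1)[of i] hte(1)[of j] eq by simp
      then show ?thesis using d1[of i l j] 2 by simp
    next
      case (3 i j)
      then show ?thesis using hta(2)[of i] hte(2)[of j] eq T'(3) by simp
    next
      case (4 i j)
      then show ?thesis using hta(2)[of j] hte(2)[of i] eq T'(3) by simp
    qed
  qed
  define r3 where "r3 = cshear r u2 c 1"
  define A where "A = (\<Union>y \<in> c. orbit r y)"
  note mr = merge_rows[OF fin rp u2p c once, folded r3_def A_def]
  obtain b3 where b3: "hyp X r3 u2 b3 d" using shear_hyp_r[OF b2 c] unfolding r3_def by blast
  have r3p: "r3 permutes X" using b3 by (simp add: hyp_def origami_def)
  have "reach X r u (Suc (Suc (Suc 0))) X r3 u2" unfolding r3_def u2_def u1_def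
    by (intro reach_r reach_u reach_refl T'(2) Tr c[unfolded u1_def u2_def])
  moreover have "card (tops X r3 u2) < card (tops X r u)"
  proof -
    have cA: "c \<subseteq> A" using self_row by (auto simp: A_def)
    have TA: "T \<subseteq> A" "T' \<subseteq> A"
    proof -
      have "e l \<in> c" "a k \<in> c" by (auto simp: c_eq P_def)
      then show "T \<subseteq> A" "T' \<subseteq> A"
        using row_eq_orbit[OF fin rp Tr el] row_eq_orbit[OF fin rp T'(2) ak] unfolding A_def by blast+
    qed
    \<comment> \<open>Rows outside the merged row \<open>A\<close> keep their squares, and the flat
      ones among them stay flat. So \<open>T\<close> and \<open>T'\<close> are traded for at most
      one new top.\<close>
    have "tops X r3 u2 \<subseteq> insert A (tops X r u - {T, T'})"
    proof
      fix D assume D: "D \<in> tops X r3 u2"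
      then obtain z where z: "z \<in> X" "D = orbit r3 z" by (auto simp: tops_def rows_def)
      have a0: "a 0 \<in> c" by (auto simp: c_eq P_def)
      show "D \<in> insert A (tops X r u - {T, T'})"
      proof (cases "z \<in> A")
        case True
        then have "z \<in> orbit r3 (a 0)" using mr(1)[OF _ _ _ a0] by simp
        then have "orbit r3 z = orbit r3 (a 0)" by (rule permutes_orbit_eq[OF fin r3p])
        then show ?thesis using mr(1)[OF _ _ _ a0] z by simp
      next
        case False
        then have Dr: "D = orbit r z" using mr(2) z by simp
        have Drow: "D \<in> rows X r" using z(1) Dr unfolding rows_def by blast
        have DA: "w \<notin> A" if w: "w \<in> D" for w
        proof
          assume "w \<in> A"
          then obtain y where y: "y \<in> c" "w \<in> orbit r y" by (auto simp: A_def)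
          have "orbit r w = orbit r y" "orbit r w = orbit r z"
            using permutes_orbit_eq[OF fin rp] y w Dr by blast+
          then have "z \<in> orbit r y" using self_row by metis
          then show False using y False by (auto simp: A_def)
        qed
        have "\<not> flat r u D"
        proof
          assume fl: "flat r u D"
          have "flat r3 u2 D" unfolding flat_def
          proof
            fix w assume w: "w \<in> D"
            have rw: "r w \<in> D" using w row_step_iff[OF fin rp Drow] by simp
            have "w \<notin> T" "w \<notin> T'" "r w \<notin> T" "r w \<notin> T'" "w \<notin> c" "r w \<notin> c"
              using DA[OF w] DA[OF rw] TA cA by auto
            then have e1: "r3 w = r w" "u2 w = u w" "u2 (r w) = u (r w)"
              by (simp_all add: r3_def cshear_1 u2)
            \<comment> \<open>From outside \<open>c\<close>, the map \<open>u\<close> enters it only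
              at \<open>x\<close>, which is in \<open>T\<close>, and at \<open>b (u x)\<close>,
              which is in \<open>T'\<close>.\<close>
            have "u w \<notin> c"
            proof
              assume "u w \<in> c"
              then consider i where "i \<le> k" "u w = a i" | i where "i \<le> l" "u w = e i"
                unfolding c_eq P_def by blast
              then show False
              proof cases
                case (1 i)
                show ?thesis
                proof (cases i)
                  case 0
                  then have "w = x" using 1 by (simp add: a_def inj_u)
                  then show ?thesis using xT \<open>w \<notin> T\<close> by simp
                next
                  case (Suc j)
                  then have "w = a j" using 1 by (simp add: a_def inj_u)
                  then show ?thesis using \<open>w \<notin> c\<close> 1 Suc by (auto simp: c_eq P_def)
                qed
              next
                case (2 i)
                show ?thesis
                proof (cases i)
                  case 0
                  then have "u w = u (b (u x))" using 2 by (simp add: e_def)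
                  then have "w = b (u x)" using inj_u[of w "b (u x)"] by simp
                  then show ?thesis using yT' \<open>w \<notin> T'\<close> by simp
                next
                  case (Suc j)
                  then have "w = e j" using 2 by (simp add: e_def inj_u)
                  then show ?thesis using \<open>w \<notin> c\<close> 2 Suc by (auto simp: c_eq P_def)
                qed
              qed
            qed
            then have "r3 (u w) = r (u w)" by (simp add: r3_def cshear_1)
            moreover have "u (r w) = r (u w)" using fl w unfolding flat_def by (rule bspec)
            ultimately show "u2 (r3 w) = r3 (u2 w)" using e1 by simp
          qed
          then show False using D by (simp add: tops_def)
        qed
        moreover have "D \<noteq> T" "D \<noteq> T'" using DA TA row_nonempty[OF Drow] by blast+
        ultimately show ?thesis using Drow by (simp add: tops_def)
      qed
    qed
    then have "card (tops X r3 u2) \<le> card (insert A (tops X r u - {T, T'}))"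
      using fT by (intro card_mono) auto
    also have "\<dots> \<le> Suc (card (tops X r u - {T, T'}))" by (rule card_insert_le_m1) auto
    also have "card (tops X r u - {T, T'}) = card (tops X r u) - 2"
      using T T' fT by (subst card_Diff_subset) auto
    finally show ?thesis using two by simp
  qed
  ultimately show ?thesis using b3 unfolding numeral_3_eq_3 by blast
qed

end

text \<open>Every top contains a singular square, so there are at most \<open>d\<close> of them, and
  \<open>merge_two\<close> removes at least one with 3 moves until \<open>merge_last\<close>
  applies.\<close>

lemma reach_one_row:
  assumes "hyp X r u b d"
  shows "\<exists>n r' u' b'. n \<le> 3 * d \<and> reach X r u n X r' u' \<and> hyp X r' u' b' d \<and> rows X r' = {X}"
proof -
  have gen: "\<exists>n r' u' b'. n \<le> 3 * f \<and> reach X r u n X r' u' \<and> hyp X r' u' b' d \<and> rows X r' = {X}"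
    if "hyp X r u b d" "card (tops X r u) \<le> f" for f r u b
    using that
  proof (induction f arbitrary: r u b)
    case 0
    interpret hyp_origami X r u b d by unfold_locales (rule 0(1))
    have "finite (tops X r u)" using finite_rows[OF fin] by (simp add: tops_def)
    then have "tops X r u = {}" using 0 by simp
    moreover obtain x where "x \<in> X" using ne by blast
    ultimately show ?case using height_prop(2)[of "orbit r x"] by (auto simp: rows_def)
  next
    case (Suc f)
    interpret hyp_origami X r u b d by unfold_locales (rule Suc.prems(1))
    have fT: "finite (tops X r u)" using finite_rows[OF fin] by (simp add: tops_def)
    obtain x where "x \<in> X" using ne by blast
    then have "tops X r u \<noteq> {}" using height_prop(2)[of "orbit r x"] by (auto simp: rows_def)
    then have pos: "card (tops X r u) \<noteq> 0" using fT by simp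
    show ?case
    proof (cases "card (tops X r u) = 1")
      case True
      then obtain T where "tops X r u = {T}" by (rule card_1_singletonE)
      from merge_last[OF this] obtain r' u' b' where
        "reach X r u 2 X r' u'" "hyp X r' u' b' d" "rows X r' = {X}" by blast
      then show ?thesis by (intro exI[of _ 2] exI[of _ r'] exI[of _ u'] exI[of _ b']) auto
    next
      case False
      then have "card (tops X r u) \<ge> 2" using pos by linarith
      from merge_two[OF this] obtain r' u' b' where 1: "reach X r u 3 X r' u'" "hyp X r' u' b' d"
        "card (tops X r' u') < card (tops X r u)" by blast
      then have "card (tops X r' u') \<le> f" using Suc.prems(2) by simp
      from Suc.IH[OF 1(2) this] obtain n r'' u'' b'' where 2: "n \<le> 3 * f"
        "reach X r' u' n X r'' u''" "hyp X r'' u'' b'' d" "rows X r'' = {X}" by blast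
      have "reach X r u (3 + n) X r'' u''" by (rule reach_trans[OF 2(2) 1(1)])
      then show ?thesis using 2 by (intro exI[of _ "3 + n"] exI[of _ r''] exI[of _ u''] exI[of _ b'']) auto
    qed
  qed
  interpret hyp_origami X r u b d by unfold_locales (rule assms)
  have "card (tops X r u) \<le> card {x \<in> X. u (r x) \<noteq> r (u x)}"
  proof (rule card_rows_le[OF fin rp])
    fix C assume C: "C \<in> tops X r u"
    then have "C \<subseteq> X" using row_subset[OF rp] by (auto simp: tops_def)
    then show "C \<in> rows X r \<and> C \<inter> {x \<in> X. u (r x) \<noteq> r (u x)} \<noteq> {}"
      using C by (auto simp: tops_def flat_def)
  qed (use fin in simp)
  then show ?thesis using gen[OF assms] card_sing by simp
qed

section \<open>One-row origamis\<close>

definition cyc :: "nat \<Rightarrow> nat \<Rightarrow> nat" where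
  "cyc N x = (if x < N then (x + 1) mod N else x)"

fun brev :: "nat list \<Rightarrow> nat \<Rightarrow> nat" where
  "brev [] x = x"
| "brev (a # L) x = (if x < a then a - 1 - x else a + brev L (x - a))"

text \<open>In coordinates along a single row, \<open>b\<close> is the reflection
  \<open>x \<mapsto> s - x\<close> and \<open>R\<close> reverses blocks of the lengths in
  \<open>L\<close>, so this is \<open>u\<close> written as \<open>R \<circ> b\<close>. Integers keep
  the difference from being truncated.\<close>

definition ustar :: "nat list \<Rightarrow> int \<Rightarrow> nat \<Rightarrow> nat" where
  "ustar L s x = (if x < sum_list L then brev L (nat ((s - int x) mod int (sum_list L))) else x)"

lemma brev_less: "x < sum_list L \<Longrightarrow> brev L x < sum_list L"
  by (induction L x rule: brev.induct) auto

lemma brev_brev: "x < sum_list L \<Longrightarrow> brev L (brev L x) = x"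
  by (induction L x rule: brev.induct) auto

lemma brev_append:
  "brev (L @ M) x = (if x < sum_list L then brev L x else sum_list L + brev M (x - sum_list L))"
  by (induction L x rule: brev.induct) auto

lemma cyc_permutes: "cyc N permutes {..<N}"
proof (rule inj_imp_permutes)
  show "inj_on (cyc N) {..<N}"
  proof (rule inj_onI)
    fix x y assume *: "x \<in> {..<N}" "y \<in> {..<N}" "cyc N x = cyc N y"
    then show "x = y" by (auto simp: cyc_def mod_Suc split: if_splits)
  qed
qed (auto simp: cyc_def)

lemma ustar_permutes: "ustar L s permutes {..<sum_list L}"
proof (rule inj_imp_permutes)
  let ?N = "sum_list L"
  show "inj_on (ustar L s) {..<?N}"
  proof (rule inj_onI)
    fix x y assume *: "x \<in> {..<?N}" "y \<in> {..<?N}" "ustar L s x = ustar L s y"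
    then have N: "int ?N > 0" by auto
    have lt: "nat ((s - int z) mod int ?N) < ?N" for z using N by (simp add: nat_less_iff)
    have "nat ((s - int x) mod int ?N) = nat ((s - int y) mod int ?N)"
      using * brev_brev[OF lt] by (simp add: ustar_def) metis
    then have "(s - int x) mod int ?N = (s - int y) mod int ?N"
      using N by (metis nat_eq_iff2 pos_mod_sign)
    then have "(s - (s - int x)) mod int ?N = (s - (s - int y)) mod int ?N" by (rule mod_diff_cong[OF refl])
    then show "x = y" using * by simp
  qed
  show "ustar L s x \<in> {..<?N}" if "x \<in> {..<?N}" for x
  proof -
    have "nat ((s - int x) mod int ?N) < ?N" using that by (auto simp: nat_less_iff)
    then show ?thesis using that brev_less by (simp add: ustar_def)
  qed
qed (auto simp: ustar_def)

lemma cyc_funpow: "x < N \<Longrightarrow> (cyc N ^^ t) x = (x + t) mod N"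
proof (induction t)
  case (Suc t)
  then show ?case by (simp add: cyc_def mod_Suc_eq)
qed simp

lemma cyc_row:
  assumes "N > 0"
  shows "{..<N} \<in> rows {..<N} (cyc N)"
proof -
  have "orbit (cyc N) 0 = {(cyc N ^^ n) 0 | n. True}"
    by (rule permutes_orbit_altdef[OF _ cyc_permutes]) simp
  also have "\<dots> = {n mod N | n. True}" using assms by (simp add: cyc_funpow)
  also have "\<dots> = {..<N}"
  proof
    show "{..<N} \<subseteq> {n mod N | n. True}"
    proof
      fix x assume "x \<in> {..<N}"
      then have "x = x mod N" by simp
      then show "x \<in> {n mod N | n. True}" by blast
    qed
  qed (use assms in auto)
  finally show ?thesis using assms by (force simp: rows_def)
qed

lemma reach_relabel_inv:
  assumes "reach X r u n Y s v" "bij_betw p Z Y"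
    "\<And>x. x \<in> Z \<Longrightarrow> s' x \<in> Z \<and> v' x \<in> Z \<and> s (p x) = p (s' x) \<and> v (p x) = p (v' x)"
    "s' permutes Z" "v' permutes Z"
  shows "reach X r u n Z s' v'"
proof (rule reach_relabel[OF assms(1)])
  let ?q = "the_inv_into Z p"
  show "bij_betw ?q Y Z" by (rule bij_betw_the_inv_into[OF assms(2)])
  have inj: "inj_on p Z" using assms(2) by (simp add: bij_betw_def)
  show "\<forall>x\<in>Y. s' (?q x) = ?q (s x) \<and> v' (?q x) = ?q (v x)"
  proof
    fix y assume "y \<in> Y"
    then obtain x where x: "x \<in> Z" "y = p x" using assms(2) by (auto simp: bij_betw_def)
    then show "s' (?q y) = ?q (s y) \<and> v' (?q y) = ?q (v y)"
      using assms(3)[OF x(1)] the_inv_into_f_f[OF inj] by simp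
  qed
qed (rule assms(4,5))+

lemma star_twist:
  assumes "reach X r u n {..<sum_list L} (cyc (sum_list L)) (ustar L s)" "sum_list L > 0"
  shows "reach X r u (Suc n) {..<sum_list L} (cyc (sum_list L)) (ustar L s')"
proof -
  let ?N = "sum_list L"
  \<comment> \<open>Shearing by \<open>t\<close> replaces \<open>x\<close> by \<open>x + t\<close>
    and hence the offset \<open>s\<close> by \<open>s - t\<close>.\<close>
  define t where "t = nat ((s - s') mod int ?N)"
  have t: "int t = (s - s') mod int ?N" using assms(2) by (simp add: t_def)
  have "cshear (ustar L s) (cyc ?N) {..<?N} t = ustar L s'"
  proof
    fix x
    show "cshear (ustar L s) (cyc ?N) {..<?N} t x = ustar L s' x"
    proof (cases "x < ?N")
      case True
      have "(s - int ((x + t) mod ?N)) mod int ?N = (s - (int x + (s - s') mod int ?N)) mod int ?N"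
        unfolding zmod_int of_nat_add t by (rule mod_diff_right_eq)
      also have "\<dots> = (s' - int x) mod int ?N"
      proof -
        have "s - (int x + (s - s') mod int ?N) = (s - int x) - (s - s') mod int ?N" by simp
        moreover have "((s - int x) - (s - s') mod int ?N) mod int ?N = ((s - int x) - (s - s')) mod int ?N"
          by (rule mod_diff_right_eq)
        moreover have "(s - int x) - (s - s') = s' - int x" by simp
        ultimately show ?thesis by (simp only:)
      qed
      finally show ?thesis using True by (simp add: cshear_def cyc_funpow ustar_def)
    qed (simp add: cshear_def ustar_def)
  qed
  then show ?thesis using reach_u[OF assms(1) cyc_row[OF assms(2)], of t] by simp
qed

text \<open>The squares are counted from the end of the first block. The shift by \<open>a\<close>
  affects both the argument and the value of the reflection \<open>s - x\<close>, hence the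
  correction \<open>2 * int a\<close>.\<close>

lemma star_rotate:
  assumes "reach X r u n {..<sum_list (a # L)} (cyc (sum_list (a # L))) (ustar (a # L) s)"
  shows "reach X r u n {..<sum_list (L @ [a])} (cyc (sum_list (L @ [a]))) (ustar (L @ [a]) (s - 2 * int a))"
proof (cases "sum_list (a # L) = 0")
  case True
  then have z: "sum_list (L @ [a]) = 0" by simp
  have "ustar (a # L) s = ustar (L @ [a]) (s - 2 * int a)"
    by (intro ext) (simp only: ustar_def True z not_less_zero if_False)
  then show ?thesis using assms unfolding z True by simp
next
  case False
  define N where "N = sum_list (a # L)"
  have N: "N > 0" "sum_list (L @ [a]) = N" "sum_list L = N - a" "a \<le> N"
    using False by (auto simp: N_def)
  define p where "p x = (x + a) mod N" for x
  have p_less: "p x < N" for x using N by (simp add: p_def)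
  have bp: "bij_betw p {..<N} {..<N}"
  proof (rule bij_betwI[where g = "\<lambda>x. (x + (N - a)) mod N"])
    have *: "(x + a + (N - a)) mod N = x" "(x + (N - a) + a) mod N = x" if "x \<in> {..<N}" for x
      using that N(4) by simp_all
    show "(p x + (N - a)) mod N = x" if "x \<in> {..<N}" for x
      unfolding p_def mod_add_left_eq by (rule *(1)[OF that])
    show "p ((x + (N - a)) mod N) = x" if "x \<in> {..<N}" for x
      unfolding p_def mod_add_left_eq by (rule *(2)[OF that])
  qed (use N in \<open>auto simp: p_def\<close>)
  have br: "brev (a # L) (p y) = p (brev (L @ [a]) y)" if y: "y < N" for y
  proof (cases "y < N - a")
    case True
    then have "p y = y + a" using N by (simp add: p_def)
    moreover have "brev L y < N - a" using brev_less[of y L] True N by simp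
    then have "p (brev L y) = brev L y + a" using N by (simp add: p_def)
    ultimately show ?thesis using True N by (simp add: brev_append)
  next
    case False
    define i where "i = y - (N - a)"
    have i: "y = N - a + i" "i < a" using False y N by (auto simp: i_def)
    have "p y = i" using i N by (simp add: p_def)
    moreover have "p (N - a + (a - 1 - i)) = a - 1 - i"
    proof -
      have "N - a + (a - 1 - i) + a = a - 1 - i + N" using i N by simp
      then show ?thesis using i N unfolding p_def by (simp only: mod_add_self2) simp
    qed
    ultimately show ?thesis using i N by (simp add: brev_append)
  qed
  have rf: "nat ((s - int (p x)) mod int N) = p (nat ((s - 2 * int a - int x) mod int N))" for x
  proof -
    have "int (p (nat ((s - 2 * int a - int x) mod int N))) = ((s - 2 * int a - int x) + int a) mod int N"
      using N by (simp add: p_def zmod_int mod_simps)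
    also have "\<dots> = (s - int (p x)) mod int N"
      by (simp add: p_def zmod_int mod_simps) (simp add: algebra_simps)
    finally show ?thesis by linarith
  qed
  have "reach X r u n {..<N} (cyc N) (ustar (L @ [a]) (s - 2 * int a))"
  proof (rule reach_relabel_inv[OF assms[folded N_def] bp])
    fix x assume "x \<in> {..<N}"
    then have x: "x < N" by simp
    let ?y = "nat ((s - 2 * int a - int x) mod int N)"
    have y: "?y < N" using N by (simp add: nat_less_iff)
    have 1: "ustar (L @ [a]) (s - 2 * int a) x = brev (L @ [a]) ?y" using x N by (simp add: ustar_def)
    have 2: "brev (L @ [a]) ?y < N" using brev_less[of ?y "L @ [a]"] y N by simp
    have "ustar (a # L) s (p x) = brev (a # L) (nat ((s - int (p x)) mod int N))"
      using p_less[of x] unfolding ustar_def N_def[symmetric] by simp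
    also have "\<dots> = p (brev (L @ [a]) ?y)" unfolding rf by (rule br[OF y])
    finally have 3: "ustar (a # L) s (p x) = p (ustar (L @ [a]) (s - 2 * int a) x)" unfolding 1 .
    have "cyc N (p x) = p (cyc N x)" using x p_less[of x] by (simp add: cyc_def) (simp add: p_def mod_simps)
    then show "cyc N x \<in> {..<N} \<and> ustar (L @ [a]) (s - 2 * int a) x \<in> {..<N} \<and>
        cyc N (p x) = p (cyc N x) \<and> ustar (a # L) s (p x) = p (ustar (L @ [a]) (s - 2 * int a) x)"
      using 1 2 3 x N by (simp add: cyc_def)
  qed (use cyc_permutes ustar_permutes[of "L @ [a]"] N in auto)
  then show ?thesis unfolding N .
qed

text \<open>By \<open>one_row_reversal\<close> the points of \<open>E\<close> cut the row into
  \<open>d\<close> intervals, each reversed by \<open>R\<close>. The origin is placed at the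
  beginning of one of them, so that no block wraps around.\<close>

lemma (in hyp_origami) one_row_star:
  assumes one: "rows X r = {X}"
  shows "\<exists>L s p. length L = d \<and> (\<forall>a \<in> set L. a > 0) \<and> sum_list L = card X \<and>
    bij_betw p {..<card X} X \<and> (\<forall>x < card X. r (p x) = p (cyc (card X) x) \<and> u (p x) = p (ustar L s x))"
proof -
  \<comment> \<open>The condition \<open>R z \<in> E\<close> marks the beginning \<open>z\<close> of
    an interval; this says that the square after the end of an interval begins the next one.\<close>
  have mirror: "R (r y) \<in> E" if "y \<in> E" for y
  proof (rule ccontr)
    assume "R (r y) \<notin> E"
    from not_E_D[OF this] have "R (r (R (r y))) = y" by (simp add: inj_r)
    then have "r (R (r y)) = R y" by (metis RR)
    then show False using that by (simp add: E_def)
  qed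
  have mirror': "y \<in> E" if "R (r y) \<in> E" for y using not_E_mirror that by blast
  have inj_rp: "(r ^^ i) x = (r ^^ i) y \<longleftrightarrow> x = y" for i x y
    using permutes_inj[OF permutes_funpow[OF rp]] by (simp add: inj_eq)
  \<comment> \<open>Induction on the length of a stretch that consists of whole intervals; the first
    interval, of length \<open>k + 1\<close>, is split off.\<close>
  have blocks: "\<exists>L. length L = card {i. i < n \<and> (r ^^ i) z \<in> E} \<and> (\<forall>a \<in> set L. a > 0) \<and> sum_list L = n \<and>
      (\<forall>i < n. R ((r ^^ i) z) = (r ^^ (brev L i)) z)"
    if "n > 0" "R z \<in> E" "(r ^^ (n - 1)) z \<in> E" for n z
    using that
  proof (induction n arbitrary: z rule: less_induct)
    case (less n)
    define k where "k = (LEAST k. (r ^^ k) z \<in> E)"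
    have kE: "(r ^^ k) z \<in> E" unfolding k_def by (rule LeastI[of _ "n - 1"]) (rule less.prems(3))
    have kn: "k < n"
      using Least_le[of "\<lambda>k. (r ^^ k) z \<in> E", OF less.prems(3)] less.prems(1) by (simp add: k_def)
    have ki: "(r ^^ i) z \<notin> E" if "i < k" for i using not_less_Least that by (simp add: k_def)
    have Rz: "(r ^^ k) z = R z" by (rule one_row_reversal[OF one less.prems(2) ki kE])
    have rev: "(r ^^ i) (R ((r ^^ i) z)) = R z" if "i \<le> k" for i using that
    proof (induction i)
      case (Suc i)
      have "(r ^^ Suc i) (R ((r ^^ Suc i) z)) = (r ^^ i) (r (R (r ((r ^^ i) z))))" by (simp add: funpow_swap1)
      also have "\<dots> = (r ^^ i) (R ((r ^^ i) z))" using not_E_D ki Suc.prems by simp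
      finally show ?case using Suc by simp
    qed simp
    have first: "R ((r ^^ i) z) = (r ^^ (k - i)) z" if "i \<le> k" for i
    proof -
      have "(r ^^ i) (R ((r ^^ i) z)) = (r ^^ i) ((r ^^ (k - i)) z)"
        using rev[OF that] Rz that by (simp add: funpow_add[symmetric, unfolded comp_def, THEN fun_cong])
      then show ?thesis by (simp only: inj_rp)
    qed
    let ?a = "Suc k"
    have set0: "{i. i < Suc k \<and> (r ^^ i) z \<in> E} = {k}" using ki kE by (auto simp: less_Suc_eq)
    show ?case
    proof (cases "n = Suc k")
      case True
      then show ?thesis using set0 first by (intro exI[of _ "[?a]"]) auto
    next
      case False
      define z' where "z' = (r ^^ ?a) z"
      define n' where "n' = n - ?a"
      have n': "n' > 0" "n' < n" "n = ?a + n'" using False kn by (auto simp: n'_def)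
      have sh: "(r ^^ i) z' = (r ^^ (?a + i)) z" for i
        unfolding z'_def by (simp only: funpow_add comp_apply add.commute[of ?a i])
      have "R z' \<in> E" using mirror[OF kE] by (simp add: z'_def)
      moreover have "(r ^^ (n' - 1)) z' \<in> E"
        using less.prems(3) n' by (simp only: sh) simp
      ultimately obtain L where L: "length L = card {i. i < n' \<and> (r ^^ i) z' \<in> E}" "\<forall>a \<in> set L. a > 0"
        "sum_list L = n'" "\<forall>i < n'. R ((r ^^ i) z') = (r ^^ (brev L i)) z'"
        using less.IH[OF n'(2,1)] by blast
      have "{i. i < n \<and> (r ^^ i) z \<in> E} = {k} \<union> (\<lambda>i. ?a + i) ` {i. i < n' \<and> (r ^^ i) z' \<in> E}"
      proof (intro equalityI subsetI)
        fix i assume i: "i \<in> {i. i < n \<and> (r ^^ i) z \<in> E}"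
        show "i \<in> {k} \<union> (\<lambda>i. ?a + i) ` {i. i < n' \<and> (r ^^ i) z' \<in> E}"
        proof (cases "i < ?a")
          case True
          then show ?thesis using i set0 by blast
        next
          case False
          then have "i = ?a + (i - ?a)" by simp
          moreover from this have "(r ^^ (i - ?a)) z' \<in> E" using i sh[of "i - ?a"] by simp
          moreover have "i - ?a < n'" using i False n' by auto
          ultimately show ?thesis by blast
        qed
      next
        fix i assume "i \<in> {k} \<union> (\<lambda>i. ?a + i) ` {i. i < n' \<and> (r ^^ i) z' \<in> E}"
        then show "i \<in> {i. i < n \<and> (r ^^ i) z \<in> E}"
          using kE kn sh n'(3) by (auto simp del: funpow.simps)
      qed
      then have "card {i. i < n \<and> (r ^^ i) z \<in> E}
          = card ({k} \<union> (\<lambda>i. ?a + i) ` {i. i < n' \<and> (r ^^ i) z' \<in> E})" by simp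
      also have "\<dots> = Suc (card ((\<lambda>i. ?a + i) ` {i. i < n' \<and> (r ^^ i) z' \<in> E}))"
        by (subst card_Un_disjoint) auto
      also have "\<dots> = Suc (length L)" using L(1) by (subst card_image) (auto simp: inj_on_def)
      finally have "length (?a # L) = card {i. i < n \<and> (r ^^ i) z \<in> E}" by simp
      moreover have "R ((r ^^ i) z) = (r ^^ (brev (?a # L) i)) z" if i: "i < n" for i
      proof (cases "i < ?a")
        case True
        then show ?thesis using first[of i] by simp
      next
        case False
        then have "R ((r ^^ i) z) = R ((r ^^ (i - ?a)) z')" by (simp only: sh) simp
        also have "\<dots> = (r ^^ (brev L (i - ?a))) z'" using L(4) i False n' by simp
        finally show ?thesis using False by (simp only: sh) simp
      qed
      ultimately show ?thesis using L n' by (intro exI[of _ "?a # L"]) auto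
    qed
  qed
  let ?N = "card X"
  have "E \<noteq> {}" using card_E d_pos by auto
  then obtain e where e: "e \<in> E" by blast
  define z where "z = R e"
  have zX: "z \<in> X" using e E_subset permutes_in_image[OF R_permutes] by (auto simp: z_def)
  have XX: "X \<in> rows X r" using one by simp
  obtain n where n: "n > 0" "X = (\<lambda>i. (r ^^ i) z) ` {..<n}" "inj_on (\<lambda>i. (r ^^ i) z) {..<n}"
    "\<And>i j. (r ^^ i) z = (r ^^ j) z \<longleftrightarrow> i mod n = j mod n"
    using row_coords[OF fin rp XX zX] by metis
  have nN: "?N = n" using card_image[OF n(3)] unfolding n(2)[symmetric] by simp
  have N0: "?N > 0" using n(1) nN by simp
  have rN: "(r ^^ ?N) z = z" using n(4)[of n 0] unfolding nN by simp
  have lastE: "(r ^^ (?N - 1)) z \<in> E"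
  proof (rule mirror')
    have "r ((r ^^ (?N - 1)) z) = z" using rN N0 by (cases ?N) auto
    then show "R (r ((r ^^ (?N - 1)) z)) \<in> E" using e by (simp add: z_def)
  qed
  have "R z \<in> E" using e by (simp add: z_def)
  then obtain L where L: "length L = card {i. i < ?N \<and> (r ^^ i) z \<in> E}" "\<forall>a \<in> set L. a > 0"
    "sum_list L = ?N" "\<forall>i < ?N. R ((r ^^ i) z) = (r ^^ (brev L i)) z"
    using blocks[OF N0 _ lastE] by blast
  define p where "p i = (r ^^ i) z" for i
  have bij: "bij_betw p {..<?N} X"
    unfolding nN bij_betw_def p_def[abs_def] using n(2,3) by blast
  have "p ` {i. i < ?N \<and> p i \<in> E} = E"
  proof (intro equalityI subsetI)
    fix y assume y: "y \<in> E"
    then have "y \<in> p ` {..<?N}" using bij_betw_imp_surj_on[OF bij] E_subset by blast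
    then show "y \<in> p ` {i. i < ?N \<and> p i \<in> E}" using y by auto
  qed auto
  then have "p ` {i. i < ?N \<and> (r ^^ i) z \<in> E} = E" by (simp only: p_def)
  moreover have "inj_on p {i. i < ?N \<and> (r ^^ i) z \<in> E}"
    by (rule inj_on_subset[OF bij_betw_imp_inj_on[OF bij]]) auto
  ultimately have "card E = card {i. i < ?N \<and> (r ^^ i) z \<in> E}" using card_image by fastforce
  then have len: "length L = d" using L(1) card_E by simp
  have "b z \<in> X" using zX permutes_in_image[OF b_permutes] by simp
  then obtain k where k: "k < ?N" "b z = (r ^^ k) z" unfolding nN using n(2) by blast
  have pm: "p i = p j" if "i mod ?N = j mod ?N" for i j using that n(4) unfolding nN by (simp add: p_def)
  have bp: "b (p i) = p (nat ((int k - int i) mod int ?N))" if i: "i < ?N" for i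
  proof -
    let ?j = "nat ((int k - int i) mod int ?N)"
    have "int ((i + ?j) mod ?N) = int (k mod ?N)" using N0 by (simp add: zmod_int mod_simps)
    then have "(i + ?j) mod ?N = k mod ?N" by linarith
    then have "p (i + ?j) = p k" by (rule pm)
    then have "(r ^^ i) (p ?j) = (r ^^ i) (b (p i))"
      using inverts_funpow[OF inverts_br, of i z] k by (simp add: p_def funpow_add)
    then show ?thesis by (simp only: inj_rp)
  qed
  have "r (p x) = p (cyc ?N x) \<and> u (p x) = p (ustar L (int k) x)" if x: "x < ?N" for x
  proof
    have "r (p x) = p (Suc x)" by (simp add: p_def)
    also have "\<dots> = p (cyc ?N x)" by (rule pm) (use x in \<open>simp add: cyc_def\<close>)
    finally show "r (p x) = p (cyc ?N x)" .
    let ?j = "nat ((int k - int x) mod int ?N)"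
    have j: "?j < ?N" using N0 by (simp add: nat_less_iff)
    have "u (p x) = R (b (p x))" by (simp add: R_def)
    also have "\<dots> = p (brev L ?j)" using L(4) j bp[OF x] by (simp add: p_def)
    finally show "u (p x) = p (ustar L (int k) x)" using x L(3) by (simp add: ustar_def)
  qed
  then show ?thesis using len L bij by blast
qed

section \<open>Standardising two adjacent blocks\<close>

lemma multiple_mod_exists:
  assumes "a > 0"
  shows "\<exists>n. (n * a) mod M = (gcd a M * q) mod (M :: nat)"
proof -
  obtain x where "[a * x = gcd a M] (mod M)" using cong_solve_nat[of a M] assms by blast
  then have "[a * x * q = gcd a M * q] (mod M)" by (rule cong_scalar_right)
  then have "((x * q) * a) mod M = (gcd a M * q) mod M" by (simp add: cong_def mult_ac)
  then show ?thesis by blast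
qed

text \<open>\<open>a\<close> generates the residues modulo \<open>l\<close>, so \<open>l\<close>
  steps visit each of them once. The value 1 is the index of the row which carries the twist in
  \<open>V\<close>.\<close>

lemma count_hits:
  assumes "coprime a l" "l \<ge> (2::nat)"
  shows "card {i. i < l \<and> (q + i * a) mod l = 1} = 1"
proof -
  let ?f = "\<lambda>i. (q + i * a) mod l"
  have inj: "inj_on ?f {..<l}"
  proof (rule inj_onI)
    fix i j assume *: "i \<in> {..<l}" "j \<in> {..<l}" "?f i = ?f j"
    then have "[q + i * a = q + j * a] (mod l)" by (simp add: cong_def)
    then have "[i * a = j * a] (mod l)" by (simp only: cong_add_lcancel_nat)
    then have "[i = j] (mod l)" using assms(1) by (simp only: cong_mult_rcancel_nat)
    then show "i = j" using * by (simp add: cong_def)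
  qed
  have "?f ` {..<l} = {..<l}"
    by (rule endo_inj_surj[OF _ _ inj]) (use assms in auto)
  moreover have "(1::nat) \<in> {..<l}" using assms(2) by simp
  ultimately obtain i where i: "i < l" "?f i = 1" by (metis (no_types, lifting) imageE lessThan_iff)
  have "{i. i < l \<and> ?f i = 1} = {i}"
  proof (intro equalityI subsetI)
    fix j assume "j \<in> {i. i < l \<and> ?f i = 1}"
    then show "j \<in> {i}" using i inj_onD[OF inj, of j i] by simp
  qed (use i in simp)
  then show ?thesis by simp
qed

text \<open>A torus with \<open>l\<close> closed rows of length \<open>h\<close>; the number
  \<open>h * q + s\<close> stands for position \<open>s\<close> in row \<open>q\<close>.
  \<open>Rt\<close> moves along a row, and \<open>V\<close> moves from row \<open>q\<close> to row
  \<open>q + a'\<close>, with a twist by one position on leaving row 1.\<close>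

locale torus =
  fixes h l a' :: nat
  assumes h: "h > 0" and l: "l \<ge> 2" and cop: "coprime a' l"
begin

definition Rt :: "nat \<Rightarrow> nat" where
  "Rt x = h * (x div h) + (x mod h + 1) mod h"

definition V :: "nat \<Rightarrow> nat" where
  "V x = h * ((x div h + a') mod l) + (x mod h + (if x div h = 1 then 1 else 0)) mod h"

lemma coord: "s < h \<Longrightarrow> (h * q + s) div h = q" "s < h \<Longrightarrow> (h * q + s) mod h = s"
  using h by simp_all

lemma less_iff: "s < h \<Longrightarrow> h * q + s < h * l \<longleftrightarrow> q < l"
proof
  assume s: "s < h"
  show "h * q + s < h * l \<Longrightarrow> q < l" using s by (metis coord(1) div_less_iff_less_mult h mult.commute)
  assume "q < l"
  then have "h * (q + 1) \<le> h * l" by (intro mult_le_mono) auto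
  then show "h * q + s < h * l" using s by simp
qed

lemma Rt_coord: "s < h \<Longrightarrow> Rt (h * q + s) = h * q + (s + 1) mod h"
  by (simp only: Rt_def coord)

lemma V_coord: "s < h \<Longrightarrow> V (h * q + s) = h * ((q + a') mod l) + (s + (if q = 1 then 1 else 0)) mod h"
  by (simp only: V_def coord)

lemma coordE:
  assumes "x < h * l"
  obtains q s where "x = h * q + s" "q < l" "s < h"
proof -
  have "x = h * (x div h) + x mod h" "x mod h < h" using h by simp_all
  then show ?thesis using that less_iff assms by metis
qed

lemma Rt_less: "x < h * l \<Longrightarrow> Rt x < h * l"
  using h by (elim coordE) (simp add: Rt_coord less_iff)

lemma V_less: "x < h * l \<Longrightarrow> V x < h * l"
  using h l by (elim coordE) (simp add: V_coord less_iff)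

lemma Rt_funpow: "s < h \<Longrightarrow> (Rt ^^ n) (h * q + s) = h * q + (s + n) mod h"
proof (induction n)
  case (Suc n)
  then show ?case using h by (simp add: Rt_coord mod_Suc_eq)
qed simp

lemma V_funpow:
  assumes "s < h" "q < l"
  shows "(V ^^ n) (h * q + s)
    = h * ((q + n * a') mod l) + (s + card {i. i < n \<and> (q + i * a') mod l = 1}) mod h"
proof (induction n)
  case 0
  then show ?case using assms by simp
next
  case (Suc n)
  let ?S = "\<lambda>n. {i. i < n \<and> (q + i * a') mod l = 1}"
  have S: "?S (Suc n) = (if (q + n * a') mod l = 1 then insert n (?S n) else ?S n)"
    by (auto simp: less_Suc_eq)
  have c: "card (?S (Suc n)) = card (?S n) + (if (q + n * a') mod l = 1 then 1 else 0)"
    unfolding S by simp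
  have "(V ^^ Suc n) (h * q + s) = V (h * ((q + n * a') mod l) + (s + card (?S n)) mod h)"
    using Suc by simp
  also have "\<dots> = h * (((q + n * a') mod l + a') mod l)
      + ((s + card (?S n)) mod h + (if (q + n * a') mod l = 1 then 1 else 0)) mod h"
    using h by (intro V_coord) simp
  also have "((q + n * a') mod l + a') mod l = (q + Suc n * a') mod l"
    unfolding mod_add_left_eq by (simp add: algebra_simps)
  also have "((s + card (?S n)) mod h + (if (q + n * a') mod l = 1 then 1 else 0)) mod h
      = (s + card (?S (Suc n))) mod h"
    unfolding mod_add_left_eq c by (simp only: add.assoc)
  finally show ?case .
qed

text \<open>In \<open>l\<close> steps a column passes row 1 exactly once and picks up one unit of
  twist.\<close>

lemma V_l: "x < h * l \<Longrightarrow> (V ^^ l) x = Rt x"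
proof (elim coordE)
  fix q s assume x: "x = h * q + s" "q < l" "s < h"
  have "(V ^^ l) x = h * ((q + l * a') mod l) + (s + 1) mod h"
    unfolding x(1) V_funpow[OF x(3,2)] count_hits[OF cop l] ..
  also have "\<dots> = Rt x" using x by (simp add: Rt_coord)
  finally show "(V ^^ l) x = Rt x" .
qed

lemma V_M: "x < h * l \<Longrightarrow> (V ^^ (h * l)) x = x"
proof -
  assume x: "x < h * l"
  have "(V ^^ (l * n)) x = (Rt ^^ n) x \<and> (Rt ^^ n) x < h * l" for n
  proof (induction n)
    case 0
    then show ?case using x by simp
  next
    case (Suc n)
    have "(V ^^ (l * Suc n)) x = (V ^^ l) ((V ^^ (l * n)) x)" by (simp add: funpow_add)
    then show ?case using Suc V_l Rt_less by simp
  qed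
  then have "(V ^^ (h * l)) x = (Rt ^^ h) x" by (simp add: mult.commute)
  also have "\<dots> = x"
    using x by (elim coordE) (simp add: Rt_funpow)
  finally show ?thesis .
qed

text \<open>Single steps of \<open>V\<close> reach the right row, after which rounds of
  \<open>l\<close> steps, each acting as \<open>Rt\<close>, adjust the position. So \<open>V\<close>
  has a single cycle.\<close>

lemma V_orbit:
  assumes "x < h * l"
  shows "\<exists>n. (V ^^ n) 0 = x"
  using assms
proof (elim coordE)
  fix q s assume x: "x = h * q + s" "q < l" "s < h"
  obtain n where n: "(n * a') mod l = q"
  proof (cases "a' = 0")
    case True
    then show ?thesis using cop l by simp
  next
    case False
    then show ?thesis using multiple_mod_exists[of a' l q] cop x that by auto
  qed
  let ?c = "card {i. i < n \<and> (0 + i * a') mod l = 1} mod h"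
  have 1: "(V ^^ n) 0 = h * q + ?c"
    using V_funpow[of 0 0 n] h l n by simp
  \<comment> \<open>The summand \<open>h\<close> prevents truncation and disappears modulo
    \<open>h\<close>.\<close>
  define m where "m = s + h - ?c"
  have ch: "?c < h" using h by simp
  have lt: "h * q + ?c < h * l" using less_iff[OF ch] x by blast
  have it: "(V ^^ (l * m)) y = (Rt ^^ m) y \<and> (Rt ^^ m) y < h * l" if y: "y < h * l" for m y
  proof (induction m)
    case 0
    then show ?case using y by simp
  next
    case (Suc n)
    have "(V ^^ (l * Suc n)) y = (V ^^ l) ((V ^^ (l * n)) y)" by (simp add: funpow_add)
    then show ?case using Suc V_l Rt_less by simp
  qed
  have "(V ^^ (l * m + n)) 0 = (Rt ^^ m) (h * q + ?c)"
    unfolding funpow_add comp_apply 1 using it[OF lt] by blast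
  also have "\<dots> = h * q + (?c + m) mod h" by (rule Rt_funpow[OF ch])
  also have "?c + m = s + h" using ch by (simp add: m_def)
  finally show ?thesis using x by (intro exI[of _ "l * m + n"]) simp
qed

end

text \<open>The rotation by \<open>a\<close> of the first \<open>M\<close> squares cuts them into a torus which is attached to the
  remaining squares by one square only. The first shear separates \<open>l - 1\<close> closed rows of length
  \<open>h = gcd a M\<close>, the second one twists one of them and thereby joins all columns of the torus, and
  the third one makes a single row again.\<close>

lemma torus_standardise:
  assumes start: "reach X r u n {..<N} (cyc N) v"
    and a: "0 < a" "a < M" "M < N"
    and v: "\<And>x. x < M \<Longrightarrow> v x = (x + a) mod M" and vp: "v permutes {..<N}"
    and v': "\<And>x. x < M \<Longrightarrow> v' x = (x + 1) mod M" "\<And>x. x \<ge> M \<Longrightarrow> v' x = v x" and vp': "v' permutes {..<N}"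
  shows "reach X r u (n + 3) {..<N} (cyc N) v'"
proof -
  define h where "h = gcd a M"
  define l where "l = M div h"
  define a' where "a' = a div h"
  have h: "h > 0" using a by (simp add: h_def)
  have M: "M = h * l" and ah: "a = h * a'" by (simp_all add: l_def a'_def h_def)
  have "l \<noteq> 0" "l \<noteq> 1"
  proof -
    show "l \<noteq> 0" using M a by (cases l) auto
    show "l \<noteq> 1"
    proof
      assume "l = 1"
      then have "M = h" using M by simp
      moreover have "h \<le> a" using a gcd_le1_nat[of a M] by (simp add: h_def)
      ultimately show False using a by simp
    qed
  qed
  then have l: "l \<ge> 2" by linarith
  have cop: "coprime a' l" unfolding a'_def l_def h_def using a by (intro div_gcd_coprime) auto
  interpret torus h l a' by unfold_locales (rule h l cop)+
  have finN: "finite {..<N}" by simp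
  have cM: "x < h * l \<longleftrightarrow> x < M" for x by (simp add: M)
  have v_coord: "v (h * q + s) = h * ((q + a') mod l) + s" if "q < l" "s < h" for q s
  proof -
    have "h * q + s < M" using less_iff[OF that(2)] that(1) M by blast
    then have "v (h * q + s) = (h * q + s + h * a') mod (h * l)" using v ah M by simp
    also have "h * q + s + h * a' = h * (q + a') + s" by (simp add: algebra_simps)
    also have "\<dots> mod (h * l) = h * ((q + a') mod l) + s"
      using that(2) by (simp add: mod_mult2_eq)
    finally show ?thesis .
  qed
  have vM: "v x < M \<longleftrightarrow> x < M" for x
  proof -
    have "{..<M} \<subseteq> {..<N}" using a by auto
    have 1: "v y < M" if "y < M" for y using v[OF that] a by simp
    show ?thesis
    proof
      assume "v x < M"
      then have "x \<in> {..<M}" using permutes_inv_closed[OF finN vp, of "{..<M}" x] 1 by simp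
      then show "x < M" by simp
    qed (rule 1)
  qed
  \<comment> \<open>The cycle of \<open>v\<close> through the last square of every block of
    \<open>h\<close> squares.\<close>
  define c where "c = {x. x < M \<and> x mod h = h - 1}"
  have vfun: "(v ^^ i) x = (x + i * a) mod M" if "x < M" for i x
  proof (induction i)
    case (Suc i)
    have "(v ^^ Suc i) x = ((x + i * a) mod M + a) mod M" using Suc v a by simp
    then show ?case unfolding mod_add_left_eq by (simp add: algebra_simps)
  qed (use that in simp)
  have c: "c \<in> rows {..<N} v"
  proof -
    have h1: "h - 1 < M" using less_iff[of "h - 1" 0] h l M by simp
    have hc: "h - 1 \<in> c" using h1 h by (simp add: c_def)
    have "orbit v (h - 1) = c"
    proof
      show "orbit v (h - 1) \<subseteq> c"
      proof (rule orbit_subset_closed[OF hc])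
        fix y assume y: "y \<in> c"
        then obtain q s where qs: "y = h * q + s" "q < l" "s < h" using coordE[of y] by (auto simp: c_def M)
        then have s: "s = h - 1" using y by (simp add: c_def)
        have "v y mod h = h - 1"
          unfolding qs(1) v_coord[OF qs(2,3)] coord(2)[OF qs(3)] by (rule s)
        then show "v y \<in> c" using vM[of y] y by (simp add: c_def)
      qed
      show "c \<subseteq> orbit v (h - 1)"
      proof
        fix y assume y: "y \<in> c"
        then obtain q s where qs: "y = h * q + s" "q < l" "s < h" using coordE[of y] by (auto simp: c_def M)
        then have s: "s = h - 1" using y by (simp add: c_def)
        obtain i where "(i * a) mod M = (h * q) mod M" using multiple_mod_exists[OF a(1), of M q] by (auto simp: h_def)
        then have "(h - 1 + i * a) mod M = (h - 1 + h * q) mod M" by (metis mod_add_right_eq)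
        then have "(v ^^ i) (h - 1) = y" using vfun[OF h1, of i] qs s y by (simp add: c_def add.commute)
        then show "y \<in> orbit v (h - 1)" unfolding permutes_orbit_altdef[OF finN vp] by blast
      qed
    qed
    moreover have "h - 1 \<in> {..<N}" using h1 a by simp
    ultimately show ?thesis unfolding rows_def by blast
  qed
  \<comment> \<open>\<open>v ^^ p\<close> goes back by \<open>h\<close> modulo \<open>M\<close>, so
    that after the shear the last square of every block but the first is followed by the first
    square of the same block.\<close>
  obtain p where p: "(p * a) mod M = (M - h) mod M"
  proof -
    have "h * (l - 1) = M - h" by (simp add: M diff_mult_distrib2)
    then show ?thesis using that multiple_mod_exists[OF a(1), of M "l - 1"] unfolding h_def[symmetric] by metis
  qed
  define r1 where "r1 = cshear (cyc N) v c p"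
  have hM: "h \<le> M" using M l by simp
  have r1c: "r1 x = cyc N ((x + (M - h)) mod M)" if "x \<in> c" for x
      proof -
    have "x < M" using that by (simp add: c_def)
    then have "(v ^^ p) x = (x + p * a) mod M" by (rule vfun)
    also have "\<dots> = (x + (M - h)) mod M" using p by (metis mod_add_right_eq)
    finally show ?thesis using that by (simp add: r1_def cshear_def)
  qed
  \<comment> \<open>In the first block the step back wraps around to \<open>M - 1\<close>, whose
    successor is the first square outside the torus; this is the only exit.\<close>
  have r1_gate: "r1 (h - 1) = M"
  proof -
    have "h - 1 \<in> c" using h hM by (auto simp: c_def)
    then have "r1 (h - 1) = cyc N ((h - 1 + (M - h)) mod M)" by (rule r1c)
    also have "h - 1 + (M - h) = M - 1" using h hM by simp
    finally show ?thesis using a by (simp add: cyc_def)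
  qed
  have r1_in: "r1 x = Rt x" if x: "x < M" "x \<noteq> h - 1" for x
  proof -
    obtain q s where qs: "x = h * q + s" "q < l" "s < h" using coordE[of x] x by (auto simp: M)
    show ?thesis
    proof (cases "s = h - 1")
      case True
      have "x mod h = h - 1" unfolding qs(1) coord(2)[OF qs(3)] by (rule True)
      then have xc: "x \<in> c" using x by (simp add: c_def)
      have q: "q \<ge> 1" using qs x True by (cases q) auto
      have hx: "h \<le> x" using qs(1) q by (simp add: trans_le_add1)
      have "x + (M - h) = x - h + M" using hx hM by simp
      then have "(x + (M - h)) mod M = x - h" using x(1) by (simp only: mod_add_self2) simp
      then have "r1 x = x - h + 1" using r1c[OF xc] x a hx h by (simp add: cyc_def)
      also have "\<dots> = h * q" using qs(1) True hx h by simp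
      also have "h * q = Rt x" unfolding qs(1) Rt_coord[OF qs(3)] using True h by simp
      finally show ?thesis .
    next
      case False
      then have "x \<notin> c" using qs by (simp add: c_def)
      then have "r1 x = x + 1" using x a by (simp add: r1_def cshear_def cyc_def)
      then show ?thesis using qs False by (simp add: Rt_coord)
    qed
  qed
  have r1_out: "r1 x = cyc N x" if "x \<ge> M" for x
    using that by (simp add: r1_def cshear_def c_def)
  have r1p: "r1 permutes {..<N}"
    unfolding r1_def
    by (rule cshear_permutes[OF finN cyc_permutes vp row_subset[OF vp c] row_step_iff[OF finN vp c]])
  have reach1: "reach X r u (Suc n) {..<N} r1 v"
    unfolding r1_def by (rule reach_r[OF start c])
  \<comment> \<open>One of the closed rows; it exists because \<open>l \<ge> 2\<close>.\<close>
  define D where "D = {x. x < M \<and> x div h = 1}"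
  have hMM: "h < M" using less_iff[of 0 1] h l M by simp
  have D_coord: "x \<in> D \<longleftrightarrow> (\<exists>s < h. x = h * 1 + s)" for x
  proof
    assume x: "x \<in> D"
    then have "x = h * 1 + x mod h" by (metis (mono_tags, lifting) D_def mem_Collect_eq mult_div_mod_eq)
    then show "\<exists>s < h. x = h * 1 + s" using h by (metis mod_less_divisor)
  next
    assume "\<exists>s < h. x = h * 1 + s"
    then obtain s where s: "s < h" "x = h * 1 + s" by blast
    then have "x div h = 1" using coord(1)[OF s(1), of 1] by simp
    moreover have "x < M" using less_iff[OF s(1), of 1] s(2) l M by simp
    ultimately show "x \<in> D" by (simp add: D_def)
  qed
  have D_ge: "h - 1 \<notin> D" using h by (auto simp: D_def)
  have D: "D \<in> rows {..<N} r1"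
  proof -
    have "orbit r1 h = D"
    proof
      show "orbit r1 h \<subseteq> D"
      proof (rule orbit_subset_closed)
        show "h \<in> D" using h by (auto simp: D_coord)
        fix y assume y: "y \<in> D"
        then obtain s where s: "s < h" "y = h * 1 + s" by (auto simp: D_coord)
        have "r1 y = Rt y" using r1_in[of y] y D_ge by (auto simp: D_def)
        also have "\<dots> = h * 1 + (s + 1) mod h" unfolding s(2) by (rule Rt_coord[OF s(1)])
        finally show "r1 y \<in> D" using h by (subst D_coord) auto
      qed
      show "D \<subseteq> orbit r1 h"
      proof
        fix y assume "y \<in> D"
        then obtain s where s: "s < h" "y = h + s" by (auto simp: D_coord)
        have "h + i \<in> orbit r1 h" if "i < h" for i using that
        proof (induction i)
          case 0
          then show ?case using permutes_self_in_orbit[OF finN r1p, of h] by simp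
        next
          case (Suc i)
          have hi: "h + i \<in> D" using Suc.prems by (subst D_coord) auto
          have "h + i \<noteq> h - 1" using h by simp
          then have "r1 (h + i) = Rt (h * 1 + i)" using r1_in[of "h + i"] hi by (simp add: D_def)
          also have "\<dots> = h + Suc i" using Suc.prems Rt_coord[of i 1] by simp
          finally show ?case using Suc orbit.step[of "h + i" r1 h] by simp
        qed
        then show "y \<in> orbit r1 h" using s by simp
      qed
    qed
    moreover have "h \<in> {..<N}" using hMM a by simp
    ultimately show ?thesis unfolding rows_def by blast
  qed
  define u1 where "u1 = cshear v r1 D (Suc 0)"
  have u1_in: "u1 x = V x" if x: "x < M" for x
  proof -
    obtain q s where qs: "x = h * q + s" "q < l" "s < h" using coordE[of x] x by (auto simp: M)
    show ?thesis
    proof (cases "q = 1")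
      case True
      then have xD: "x \<in> D" using qs x coord(1)[OF qs(3)] by (simp add: D_def)
      then have "x \<noteq> h - 1" using D_ge by blast
      then have "u1 x = v (Rt x)" using r1_in[OF x] xD by (simp add: u1_def cshear_1)
      also have "\<dots> = v (h * q + (s + 1) mod h)" using qs by (simp add: Rt_coord)
      also have "\<dots> = h * ((q + a') mod l) + (s + 1) mod h" by (rule v_coord[OF qs(2)]) (use h in simp)
      also have "\<dots> = V x" unfolding qs(1) V_coord[OF qs(3)] using True by simp
      finally show ?thesis .
    next
      case False
      then have "x \<notin> D" using qs coord(1)[OF qs(3)] by (simp add: D_def)
      then show ?thesis using qs False v_coord[OF qs(2,3)] by (simp add: u1_def cshear_1 V_coord)
    qed
  qed
  have u1_out: "u1 x = v x" if "x \<ge> M" for x using that by (simp add: u1_def cshear_1 D_def)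
  have u1p: "u1 permutes {..<N}"
    unfolding u1_def
    by (rule cshear_permutes[OF finN vp r1p row_subset[OF r1p D] row_step_iff[OF finN r1p D]])
  have reach2: "reach X r u (Suc (Suc n)) {..<N} r1 u1"
    unfolding u1_def by (rule reach_u[OF reach1 D])
  have u1f: "(u1 ^^ i) x = (V ^^ i) x \<and> (V ^^ i) x < M" if "x < M" for i x
  proof (induction i)
    case (Suc i)
    then show ?case using u1_in V_less by (simp add: M)
  qed (use that in simp)
  have M0: "0 < M" using a by simp
  have orb: "orbit u1 0 = {..<M}"
  proof
    show "orbit u1 0 \<subseteq> {..<M}"
      by (rule orbit_subset_closed) (use M0 u1_in V_less M in auto)
    show "{..<M} \<subseteq> orbit u1 0"
    proof
      fix x assume "x \<in> {..<M}"
      then obtain i where "(V ^^ i) 0 = x" using V_orbit M by auto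
      then have "(u1 ^^ i) 0 = x" using u1f[OF M0] by simp
      then show "x \<in> orbit u1 0" unfolding permutes_orbit_altdef[OF finN u1p] by blast
    qed
  qed
  have J: "{..<M} \<in> rows {..<N} u1" using orb M0 a unfolding rows_def by force
  \<comment> \<open>Up to the exit, \<open>r1\<close> is \<open>Rt\<close>, that is,
    \<open>V ^^ l\<close>. So \<open>r1\<close> after \<open>V ^^ t\<close> is
    \<open>V ^^ (M + 1)\<close>, which is \<open>V\<close>: the third shear makes \<open>r\<close>
    and \<open>u\<close> agree on the torus except where it is left.\<close>
  define t where "t = M + 1 - l"
  have lM: "l \<le> M" using h by (simp add: M)
  define r2 where "r2 = cshear r1 u1 {..<M} t"
  have r2_in: "r2 x = (if u1 x = 0 then M else u1 x)" if x: "x < M" for x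
  proof -
    let ?y = "(V ^^ t) x"
    have y: "?y < M" using u1f[OF x] by simp
    have "Rt ?y = (V ^^ l) ?y" using V_l y M by simp
    also have "\<dots> = (V ^^ (l + t)) x" by (simp add: funpow_add)
    also have "l + t = Suc M" using lM by (simp add: t_def)
    also have "(V ^^ Suc M) x = V x" using V_M[of x] x M by simp
    finally have Rty: "Rt ?y = u1 x" using u1_in[OF x] by simp
    have "Rt (h - 1) = 0" using Rt_coord[of "h - 1" 0] h by simp
    have "u1 x = 0 \<longleftrightarrow> ?y = h - 1"
    proof
      assume "?y = h - 1" then show "u1 x = 0" using Rty \<open>Rt (h - 1) = 0\<close> by simp
    next
      assume *: "u1 x = 0"
      obtain q s where qs: "?y = h * q + s" "q < l" "s < h" using coordE[of ?y] y by (auto simp: M)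
      then have "h * q + (s + 1) mod h = 0" using Rty * Rt_coord[OF qs(3), of q] by simp
      then have "q = 0" "(s + 1) mod h = 0" using h by auto
      then have "s = h - 1" using qs(3) by (metis Suc_eq_plus1 diff_Suc_1 mod_Suc mod_less nat.distinct(1))
      then show "?y = h - 1" using qs \<open>q = 0\<close> by simp
    qed
    moreover have "r2 x = r1 ?y" using x u1f[OF x] by (simp add: r2_def cshear_def)
    ultimately show ?thesis using r1_gate r1_in[OF y] Rty by (cases "?y = h - 1") simp_all
  qed
  have r2_out: "r2 x = cyc N x" if "x \<ge> M" for x using that r1_out by (simp add: r2_def cshear_def)
  have reach3: "reach X r u (Suc (Suc (Suc n))) {..<N} r2 u1"
    unfolding r2_def by (rule reach_r[OF reach2 J])
  \<comment> \<open>Numbering the torus along its single column, starting from 0, makes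
    \<open>r2\<close> the standard row and \<open>u1\<close> the rotation by 1.\<close>
  define f where "f i = (if i < M then (u1 ^^ i) 0 else i)" for i
  have z: "0 \<in> {..<M}" using M0 by simp
  obtain m where m: "{..<M} = (\<lambda>i. (u1 ^^ i) 0) ` {..<m}" "inj_on (\<lambda>i. (u1 ^^ i) 0) {..<m}"
    "\<And>i j. (u1 ^^ i) 0 = (u1 ^^ j) 0 \<longleftrightarrow> i mod m = j mod m"
    using row_coords[OF finN u1p J z] by metis
  have mM: "m = M" using card_image[OF m(2)] unfolding m(1)[symmetric] by simp
  note m = m[unfolded mM]
  have f_low: "f i < M \<longleftrightarrow> i < M" for i using u1f[OF M0, of i] by (simp add: f_def)
  have bij: "bij_betw f {..<N} {..<N}"
  proof -
    have "inj_on f {..<N}"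
    proof (rule inj_onI)
      fix i j assume "f i = f j"
      moreover from this have "i < M \<longleftrightarrow> j < M" using f_low by metis
      ultimately show "i = j" using m(3)[of i j] by (auto simp: f_def split: if_splits)
    qed
    moreover have "f ` {..<N} \<subseteq> {..<N}" 
    proof (rule image_subsetI)
      fix i assume "i \<in> {..<N}"
      then show "f i \<in> {..<N}" using f_low[of i] a(3) by (cases "i < M") (auto simp: f_def)
    qed
    ultimately show ?thesis using endo_inj_surj[of "{..<N}" f] by (auto simp: bij_betw_def)
  qed
  have u1_0: "u1 ((u1 ^^ i) 0) = 0 \<longleftrightarrow> i = M - 1" if "i < M" for i
  proof -
    have "u1 ((u1 ^^ i) 0) = (u1 ^^ 0) 0 \<longleftrightarrow> Suc i mod M = 0 mod M" using m(3)[of "Suc i" 0] by simp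
    then show ?thesis using that by (auto simp: mod_Suc)
  qed
  have "reach X r u (Suc (Suc (Suc n))) {..<N} (cyc N) v'"
  proof (rule reach_relabel_inv[OF reach3 bij _ cyc_permutes vp'])
    fix i assume "i \<in> {..<N}"
    then have i: "i < N" by simp
    have "cyc N i \<in> {..<N}" "v' i \<in> {..<N}"
      using i permutes_in_image[OF vp'] permutes_in_image[OF cyc_permutes] by auto
    moreover have "r2 (f i) = f (cyc N i)"
    proof (cases "i < M")
      case True
      have fi: "f i < M" "f i = (u1 ^^ i) 0"
        using f_low[of i] True by (simp, simp add: f_def True)
      have ci: "cyc N i = Suc i" using True a by (simp add: cyc_def)
      show ?thesis using r2_in[OF fi(1)] u1_0[OF True] True fi(2) ci by (auto simp: f_def)
    next
      case False
      then have "r2 (f i) = cyc N i" using r2_out by (simp add: f_def)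
      moreover have "f (cyc N i) = cyc N i" using False i M0 by (auto simp: f_def cyc_def mod_Suc)
      ultimately show ?thesis by simp
    qed
    moreover have "u1 (f i) = f (v' i)"
    proof (cases "i < M")
      case True
      then have "v' i = (i + 1) mod M" using v' by simp
      moreover have "u1 (f i) = (u1 ^^ (i + 1)) 0" using True by (simp add: f_def)
      moreover have "\<dots> = (u1 ^^ ((i + 1) mod M)) 0" by (subst m(3)) simp
      ultimately show ?thesis using M0 by (simp add: f_def)
    next
      case False
      then have "u1 (f i) = v i" using u1_out by (simp add: f_def)
      moreover have "\<not> v i < M" using vM False by simp
      ultimately show ?thesis using v'(2)[of i] False by (simp add: f_def)
    qed
    ultimately show "cyc N i \<in> {..<N} \<and> v' i \<in> {..<N} \<and> r2 (f i) = f (cyc N i) \<and> u1 (f i) = f (v' i)"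
      by blast
  qed
  then show ?thesis by (simp add: numeral_3_eq_3)
qed

text \<open>With this offset the reflection preserves the first \<open>a + b\<close> squares, and
  followed by the reversal of two blocks it is a rotation. Beyond these squares only the sum
  \<open>a + b\<close> enters, so changing the rotation changes just the first two blocks.\<close>

lemma ustar_two_blocks:
  assumes "0 < b"
  shows "x < a + b \<Longrightarrow> ustar (a # b # L) (int (a + b) - 1) x = (x + a) mod (a + b)"
    "x \<ge> a + b \<Longrightarrow> ustar (a # b # L) (int (a + b) - 1) x =
       (if x < a + b + sum_list L then a + b + brev L (a + b + sum_list L - 1 - x) else x)"
proof -
  let ?N = "a + b + sum_list L"
  have N: "sum_list (a # b # L) = ?N" by simp
  show "ustar (a # b # L) (int (a + b) - 1) x = (x + a) mod (a + b)" if x: "x < a + b"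
  proof -
    have "(int (a + b) - 1 - int x) mod int ?N = int (a + b) - 1 - int x"
      using x by (intro mod_pos_pos_trivial) auto
    then have *: "nat ((int (a + b) - 1 - int x) mod int ?N) = a + b - 1 - x" using x by linarith
    have "ustar (a # b # L) (int (a + b) - 1) x = brev (a # b # L) (a + b - 1 - x)"
      using x unfolding ustar_def N * by simp
    also have "\<dots> = (x + a) mod (a + b)"
      using x by (cases "x < b") (auto simp: mod_if)
    finally show ?thesis .
  qed
  show "ustar (a # b # L) (int (a + b) - 1) x = (if x < ?N then a + b + brev L (?N - 1 - x) else x)"
    if x: "x \<ge> a + b"
  proof (cases "x < ?N")
    case True
    have "(int (a + b) - 1 - int x) mod int ?N = (int (a + b) - 1 - int x + int ?N) mod int ?N"
      by (rule mod_add_self2[symmetric])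
    also have "\<dots> = int (a + b) - 1 - int x + int ?N"
      using x True assms by (intro mod_pos_pos_trivial) auto
    finally have *: "nat ((int (a + b) - 1 - int x) mod int ?N) = a + b + (?N - 1 - x)" using x True by linarith
    have "ustar (a # b # L) (int (a + b) - 1) x = brev (a # b # L) (a + b + (?N - 1 - x))"
      unfolding ustar_def N * using True by (rule if_P)
    moreover have "brev (a # b # L) (a + b + k) = a + b + brev L k" for k by simp
    ultimately have "ustar (a # b # L) (int (a + b) - 1) x = a + b + brev L (?N - 1 - x)" by (simp only:)
    then show ?thesis using True by (simp only: if_True)
  qed (simp add: ustar_def)
qed

text \<open>One twist installs the offset of \<open>ustar_two_blocks\<close>, and
  \<open>torus_standardise\<close> takes three moves; rotation by 1 belongs to the blocks
  \<open>1\<close> and \<open>a + b - 1\<close>. A third block ensures that the torus is not the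
  whole surface.\<close>

lemma star_two_blocks:
  assumes st: "reach X r u n {..<sum_list (a # b # L)} (cyc (sum_list (a # b # L))) (ustar (a # b # L) s)"
    and pos: "0 < a" "0 < b" "0 < sum_list L"
  shows "\<exists>s'. reach X r u (n + 4) {..<sum_list (a # b # L)} (cyc (sum_list (a # b # L)))
    (ustar (1 # (a + b - 1) # L) s')"
proof -
  let ?N = "sum_list (a # b # L)" and ?M = "a + b"
  let ?s = "int ?M - 1"
  have 1: "reach X r u (Suc n) {..<?N} (cyc ?N) (ustar (a # b # L) ?s)"
    by (rule star_twist[OF st]) (use pos in simp)
  note U = ustar_two_blocks[OF pos(2), where a = a and L = L]
  have b1: "0 < a + b - 1" "1 + (a + b - 1) = a + b" using pos by auto
  note U' = ustar_two_blocks[OF b1(1), where a = 1 and L = L, unfolded b1(2)]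
  have N': "sum_list (1 # (a + b - 1) # L) = ?N" using pos by simp
  have "reach X r u (Suc n + 3) {..<?N} (cyc ?N) (ustar (1 # (a + b - 1) # L) ?s)"
  proof (rule torus_standardise[OF 1, of a ?M])
    show "ustar (1 # (a + b - 1) # L) ?s permutes {..<?N}"
      using ustar_permutes[of "1 # (a + b - 1) # L"] unfolding N' .
    show "ustar (a # b # L) ?s permutes {..<?N}" by (rule ustar_permutes)
    show "ustar (1 # (a + b - 1) # L) ?s x = ustar (a # b # L) ?s x" if "?M \<le> x" for x
      using U(2)[OF that] U'(2)[OF that] by (simp only:)
    show "ustar (1 # (a + b - 1) # L) ?s x = (x + 1) mod ?M" if "x < ?M" for x by (rule U'(1)[OF that])
    show "ustar (a # b # L) ?s x = (x + a) mod ?M" if "x < ?M" for x by (rule U(1)[OF that])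
  qed (use pos in auto)
  then show ?thesis by (auto simp: numeral_eq_Suc)
qed

text \<open>After the leading blocks \<open>a\<close>, \<open>b\<close> have become
  \<open>1\<close>, \<open>a + b - 1\<close>, the 1 is rotated to the end of the list and the large
  block meets the next one. \<open>j\<close> counts the blocks of length 1 collected so far, and
  \<open>length L + j \<ge> 2\<close> keeps a third block available.\<close>

lemma star_normalise:
  assumes "reach X r u n {..<N} (cyc N) (ustar (a # L @ replicate j 1) s)"
    "sum_list (a # L @ replicate j 1) = N" "0 < a" "\<forall>x \<in> set L. 0 < x" "length L + j \<ge> 2"
  shows "\<exists>s' k. 0 < k \<and> sum_list (k # replicate (j + length L) 1) = N \<and>
    reach X r u (n + 4 * length L) {..<N} (cyc N) (ustar (k # replicate (j + length L) 1) s')"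
  using assms
proof (induction L arbitrary: a n j s)
  case Nil
  then show ?case by (intro exI[of _ s] exI[of _ a]) simp
next
  case (Cons b L)
  let ?L = "L @ replicate j 1"
  have posL: "0 < sum_list ?L"
  proof -
    have "?L \<noteq> []" using Cons.prems(5) by auto
    then have y: "hd ?L \<in> set ?L" by (rule list.set_sel(1))
    moreover have "\<forall>x \<in> set ?L. 0 < x" using Cons.prems(4) by auto
    ultimately have "0 < hd ?L" by blast
    also have "hd ?L \<le> sum_list ?L" by (intro member_le_sum_list[OF y]) simp
    finally show ?thesis .
  qed
  have "reach X r u n {..<sum_list (a # b # ?L)} (cyc (sum_list (a # b # ?L))) (ustar (a # b # ?L) s)"
    using Cons.prems(1,2) by simp
  then obtain s1 where s1: "reach X r u (n + 4) {..<N} (cyc N) (ustar (1 # (a + b - 1) # ?L) s1)"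
    using star_two_blocks[of X r u n a b ?L s] posL Cons.prems(2-4) by auto
  have sN: "sum_list (1 # (a + b - 1) # ?L) = N" using Cons.prems(2,3) by simp
  have rep: "replicate j (1::nat) @ [1] = replicate (Suc j) 1" by (induction j) auto
  have l2: "((a + b - 1) # ?L) @ [1] = (a + b - 1) # L @ replicate (Suc j) 1"
    by (simp only: rep[symmetric] append_Cons append_assoc)
  have sN2: "sum_list ((a + b - 1) # L @ replicate (Suc j) 1) = N" using sN by simp
  have "reach X r u (n + 4) {..<N} (cyc N) (ustar ((a + b - 1) # L @ replicate (Suc j) 1) (s1 - 2 * int 1))"
    using star_rotate[of X r u "n + 4" 1 "(a + b - 1) # ?L" s1] s1
    unfolding sN l2 sN2 by blast
  from Cons.IH[OF this sN2] obtain s' k where "0 < k" "sum_list (k # replicate (Suc j + length L) 1) = N"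
    "reach X r u (n + 4 + 4 * length L) {..<N} (cyc N) (ustar (k # replicate (Suc j + length L) 1) s')"
    using Cons.prems(3-5) by auto
  then show ?case by (intro exI[of _ s'] exI[of _ k]) (simp add: add.assoc)
qed

text \<open>The target depends on \<open>card X\<close> and \<open>d\<close> only and thus is a
  common meeting point.\<close>

theorem reach_normal_form:
  assumes "hyp X r u b d" "d \<ge> 3"
  shows "\<exists>n \<le> 8 * d. reach X r u n {..<card X} (cyc (card X))
    (ustar ((card X - (d - 1)) # replicate (d - 1) 1) 0)"
proof -
  obtain n1 r1 u1 b1 where 1: "n1 \<le> 3 * d" "reach X r u n1 X r1 u1" "hyp X r1 u1 b1 d" "rows X r1 = {X}"
    using reach_one_row[OF assms(1)] by blast
  interpret hyp_origami X r1 u1 b1 d by unfold_locales (rule 1(3))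
  let ?N = "card X"
  obtain L s p where L: "length L = d" "\<forall>a \<in> set L. a > 0" "sum_list L = ?N" "bij_betw p {..<?N} X"
    "\<forall>x < ?N. r1 (p x) = p (cyc ?N x) \<and> u1 (p x) = p (ustar L s x)"
    using one_row_star[OF 1(4)] by blast
  have up': "ustar L s permutes {..<?N}" using ustar_permutes[of L s] L(3) by simp
  have 2: "reach X r u n1 {..<?N} (cyc ?N) (ustar L s)"
  proof (rule reach_relabel_inv[OF 1(2) L(4) _ cyc_permutes up'])
    fix x assume x: "x \<in> {..<?N}"
    then show "cyc ?N x \<in> {..<?N} \<and> ustar L s x \<in> {..<?N} \<and> r1 (p x) = p (cyc ?N x) \<and> u1 (p x) = p (ustar L s x)"
      using L(5) permutes_in_image[OF up', of x] permutes_in_image[OF cyc_permutes[of ?N], of x] by auto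
  qed
  obtain a L' where aL: "L = a # L'" using L(1) assms(2) by (cases L) auto
  have len: "length L' = d - 1" using L(1) aL by simp
  have 3: "reach X r u n1 {..<?N} (cyc ?N) (ustar (a # L' @ replicate 0 1) s)" using 2 aL by simp
  have 4: "sum_list (a # L' @ replicate 0 1) = ?N" "0 < a" "\<forall>x \<in> set L'. 0 < x" using L(2,3) aL by auto
  have 5: "2 \<le> length L' + 0" using len assms(2) by simp
  then obtain s' k where k: "sum_list (k # replicate (d - 1) 1) = ?N"
    "reach X r u (n1 + 4 * (d - 1)) {..<?N} (cyc ?N) (ustar (k # replicate (d - 1) 1) s')"
    using star_normalise[OF 3 4 5] unfolding len add_0 by blast
  have kN: "k = ?N - (d - 1)" using k(1) by (simp add: sum_list_replicate)
  have N0: "?N > 0" using fin ne by (simp add: card_gt_0_iff)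
  have "reach X r u (Suc (n1 + 4 * (d - 1))) {..<?N} (cyc ?N) (ustar (k # replicate (d - 1) 1) 0)"
    by (rule star_twist[of X r u "n1 + 4 * (d - 1)" "k # replicate (d - 1) 1" s' 0, unfolded k(1), OF k(2) N0])
  moreover have "Suc (n1 + 4 * (d - 1)) \<le> 8 * d" using 1(1) assms(2) by simp
  ultimately show ?thesis unfolding kN by blast
qed

section \<open>Surfaces and origamis\<close>

lemma origami_relabel:
  assumes "origami Y s v" "bij_betw p Y Z" "\<forall>x \<in> Y. s' (p x) = p (s x) \<and> v' (p x) = p (v x)"
    "s' permutes Z" "v' permutes Z"
  shows "origami Z s' v'"
  unfolding origami_def
proof (intro conjI allI impI)
  have pY: "p ` Y = Z" using assms(2) by (simp add: bij_betw_def)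
  show "finite Z" using origamiD(1)[OF assms(1)] pY by blast
  show "Z \<noteq> {}" using origamiD(4)[OF assms(1)] pY by blast
  fix A assume A: "A \<subseteq> Z" "A \<noteq> {}" "s' ` A \<subseteq> A" "v' ` A \<subseteq> A"
  have "{x \<in> Y. p x \<in> A} = Y"
  proof (rule origami_closed[OF assms(1)])
    show "{x \<in> Y. p x \<in> A} \<noteq> {}" using A pY by blast
    fix x assume x: "x \<in> {x \<in> Y. p x \<in> A}"
    have "s x \<in> Y" "v x \<in> Y"
      using x permutes_in_image[OF origamiD(2)[OF assms(1)]] permutes_in_image[OF origamiD(3)[OF assms(1)]] by auto
    moreover have "p (s x) = s' (p x)" "p (v x) = v' (p x)" using x assms(3) by simp_all
    moreover have "s' (p x) \<in> A" "v' (p x) \<in> A" using x A by blast+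
    ultimately show "s x \<in> {x \<in> Y. p x \<in> A}" "v x \<in> {x \<in> Y. p x \<in> A}" by simp_all
  qed auto
  then show "A = Z" using pY A(1) by blast
qed (use assms in auto)

section \<open>Moves preserve origamis and are reversible\<close>

lemma origami_cshear_r: "origami X r u \<Longrightarrow> C \<in> rows X u \<Longrightarrow> origami X (cshear r u C t) u"
  by (rule origami_cshear) (use row_subset row_step_iff origamiD in metis)+

lemma origami_cshear_u: "origami X r u \<Longrightarrow> C \<in> rows X r \<Longrightarrow> origami X r (cshear u r C t)"
  using origami_cshear_r origami_swap by blast

lemma reach_origami: "reach X r u n Y s v \<Longrightarrow> origami X r u \<Longrightarrow> origami Y s v"
proof (induction rule: reach.induct)
  case (reach_relabel n Y s v p Z s' v')
  then show ?case using origami_relabel by blast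
qed (simp_all add: origami_cshear_r origami_cshear_u)

lemma cshear_undo:
  assumes "finite X" "r permutes X" "C \<in> rows X r"
  shows "\<exists>t'. cshear (cshear u r C t) r C t' = u"
proof -
  obtain k where k: "k > 0" "r ^^ k = id" using permutes_funpow_id[OF assms(1,2)] by blast
  define t' where "t' = (k - 1) * t"
  have "t + t' = k * t" using k(1) by (cases k) (simp_all add: t'_def)
  then have "r ^^ (t + t') = (r ^^ k) ^^ t" by (simp add: funpow_mult mult.commute)
  then have id: "(r ^^ t) ((r ^^ t') x) = x" for x
    using k(2) by (metis comp_apply funpow_add id_apply id_funpow)
  have cl: "(r ^^ n) x \<in> C \<longleftrightarrow> x \<in> C" for n x
    by (induction n) (simp_all add: row_step_iff[OF assms])
  show ?thesis
    by (intro exI[of _ t'] ext) (simp add: cshear_def cl id)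
qed

text \<open>By \<open>cshear_undo\<close> a shear is undone by one shear along the same cycle, and a
  relabelling by its inverse, so the counter is kept.\<close>

lemma reach_sym:
  assumes "reach X r u n Y s v" "origami X r u"
  shows "reach Y s v n X r u"
  using assms
proof (induction rule: reach.induct)
  case reach_refl
  show ?case by (rule reach.reach_refl)
next
  case (reach_u n Y s v C t)
  have o: "origami Y s v" by (rule reach_origami[OF reach_u.hyps(1) reach_u.prems])
  obtain t' where t': "cshear (cshear v s C t) s C t' = v"
    using cshear_undo[OF origamiD(1,2)[OF o] reach_u.hyps(2)] by blast
  have "reach Y s (cshear v s C t) (Suc 0) Y s v"
    using reach.reach_u[OF reach.reach_refl reach_u.hyps(2), of "cshear v s C t" t'] t' by simp
  from reach_trans[OF reach_u.IH[OF reach_u.prems] this] show ?case by simp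
next
  case (reach_r n Y s v C t)
  have o: "origami Y s v" by (rule reach_origami[OF reach_r.hyps(1) reach_r.prems])
  obtain t' where t': "cshear (cshear s v C t) v C t' = s"
    using cshear_undo[OF origamiD(1,3)[OF o] reach_r.hyps(2)] by blast
  have "reach Y (cshear s v C t) v (Suc 0) Y s v"
    using reach.reach_r[OF reach.reach_refl reach_r.hyps(2), of "cshear s v C t" t'] t' by simp
  from reach_trans[OF reach_r.IH[OF reach_r.prems] this] show ?case by simp
next
  case (reach_relabel n Y s v p Z s' v')
  have o: "origami Y s v" by (rule reach_origami[OF reach_relabel.hyps(1) reach_relabel.prems])
  have "reach Z s' v' 0 Y s v"
  proof (rule reach_relabel_inv[OF reach.reach_refl reach_relabel.hyps(2)])
    show "s x \<in> Y \<and> v x \<in> Y \<and> s' (p x) = p (s x) \<and> v' (p x) = p (v x)" if "x \<in> Y" for x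
      using that reach_relabel.hyps(3) permutes_in_image[OF origamiD(2)[OF o]] permutes_in_image[OF origamiD(3)[OF o]]
      by auto
  qed (use origamiD[OF o] in auto)
  from reach_trans[OF reach_relabel.IH[OF reach_relabel.prems] this] show ?case by simp
qed

section \<open>Generated groups and transitivity\<close>

lemma Sym_simps [simp]:
  "carrier (Sym X) = {p. p permutes X}" "mult (Sym X) = (\<circ>)" "one (Sym X) = id"
  by (simp_all add: Sym_def)

lemma m_inv_Sym_involution:
  assumes "g permutes X" "g \<circ> g = id"
  shows "m_inv (Sym X) g = g"
proof -
  have "y = g" if "g \<circ> y = id" for y
    using that assms(2) by (metis comp_assoc comp_id id_comp)
  then show ?thesis
    unfolding m_inv_def using assms by (intro the_equality) auto
qed

lemma generate_closed:
  assumes "h \<in> generate (Sym X) K" "\<And>k. k \<in> K \<Longrightarrow> k permutes X \<and> k \<circ> k = id"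
    "\<And>k y. k \<in> K \<Longrightarrow> y \<in> A \<Longrightarrow> k y \<in> A" "x \<in> A"
  shows "h x \<in> A"
  using assms(1,4)
proof (induction arbitrary: x rule: generate.induct)
  case (inv h)
  then show ?case using m_inv_Sym_involution[of h X] assms(2,3) by simp
qed (use assms(3) in auto)

lemma group_orbit_generate_subset:
  assumes "\<And>k. k \<in> K \<Longrightarrow> k permutes X \<and> k \<circ> k = id"
    "\<And>k y. k \<in> K \<Longrightarrow> y \<in> A \<Longrightarrow> k y \<in> A" "x \<in> A"
  shows "group_orbit (generate (Sym X) K) x \<subseteq> A"
  unfolding group_orbit_def
proof (rule image_subsetI)
  fix h assume "h \<in> generate (Sym X) K"
  then show "h x \<in> A" using generate_closed[of h X K A x] assms by blast
qed

lemma group_orbit_generate_self: "x \<in> group_orbit (generate (Sym X) K) x"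
  unfolding group_orbit_def using generate.one[of "Sym X" K] by (intro image_eqI[of _ _ id]) simp_all

lemma group_orbit_generate_step:
  assumes "y \<in> group_orbit (generate (Sym X) K) x" "k \<in> K"
  shows "k y \<in> group_orbit (generate (Sym X) K) x"
proof -
  obtain h where h: "h \<in> generate (Sym X) K" "y = h x" using assms(1) by (auto simp: group_orbit_def)
  have "k \<circ> h \<in> generate (Sym X) K"
    using generate.eng[OF generate.incl[OF assms(2)] h(1)] by simp
  then show ?thesis unfolding group_orbit_def using h(2) by (intro image_eqI[of _ _ "k \<circ> h"]) simp_all
qed

text \<open>\<open>square_tiled\<close> without connectedness. A shear is checked to preserve this
  part directly, and connectedness is read off the origami in
  \<open>chart_square_tiled\<close>.\<close>

definition glued :: "'a surface \<Rightarrow> bool" where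
  "glued S \<longleftrightarrow> finite (triangles S) \<and> (\<forall>c. glue S c permutes triangles S \<and> glue S c \<circ> glue S c = id)"

lemma gluedD:
  assumes "glued S"
  shows "finite (triangles S)" "glue S c permutes triangles S" "glue S c (glue S c x) = x"
    "glue S c x \<in> triangles S \<longleftrightarrow> x \<in> triangles S"
proof -
  show "finite (triangles S)" and gp: "glue S c permutes triangles S" and "glue S c (glue S c x) = x"
    using assms by (simp_all add: glued_def fun_eq_iff)
  show "glue S c x \<in> triangles S \<longleftrightarrow> x \<in> triangles S" by (rule permutes_in_image[OF gp])
qed

text \<open>An orbit is the smallest closed set around its point. This form matches the definition
  of \<open>origami\<close> and avoids words in the generators.\<close>

lemma square_tiled_iff:
  "square_tiled S \<longleftrightarrow> glued S \<and> triangles S \<noteq> {} \<and>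
    (\<forall>A \<subseteq> triangles S. A \<noteq> {} \<longrightarrow> (\<forall>c. glue S c ` A \<subseteq> A) \<longrightarrow> A = triangles S)"
  (is "?L \<longleftrightarrow> ?R")
proof -
  let ?K = "{glue S Red, glue S Green, glue S Blue}"
  let ?H = "generate (Sym (triangles S)) ?K"
  have K: "k permutes triangles S \<and> k \<circ> k = id" if "glued S" "k \<in> ?K" for k
    using that by (auto simp: glued_def)
  have Kc: "glue S c \<in> ?K" for c by (cases c) auto
  show ?thesis
  proof
    assume L: ?L
    then have g: "glued S" by (auto simp: square_tiled_def glued_def)
    have "A = triangles S" if A: "A \<subseteq> triangles S" "A \<noteq> {}" "\<forall>c. glue S c ` A \<subseteq> A" for A
    proof -
      obtain x where x: "x \<in> A" using A by blast
      have "group_orbit ?H x \<subseteq> A"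
        by (rule group_orbit_generate_subset[OF K[OF g]]) (use A(3) x in auto)
      moreover have "group_orbit ?H x = triangles S" using L x A(1) by (auto simp: square_tiled_def)
      ultimately show ?thesis using A(1) by blast
    qed
    then show ?R using L g by (auto simp: square_tiled_def)
  next
    assume R: ?R
    then have g: "glued S" by blast
    have "group_orbit ?H x = triangles S" if x: "x \<in> triangles S" for x
    proof -
      have "group_orbit ?H x \<subseteq> triangles S"
        by (rule group_orbit_generate_subset[OF K[OF g]]) (use x gluedD(4)[OF g] in auto)
      moreover have "group_orbit ?H x \<noteq> {}" using group_orbit_generate_self by fast
      moreover have "\<forall>c. glue S c ` group_orbit ?H x \<subseteq> group_orbit ?H x"
        using group_orbit_generate_step[OF _ Kc] by (intro allI image_subsetI)
      ultimately show ?thesis using R by blast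
    qed
    then show ?L using R by (auto simp: square_tiled_def glued_def)
  qed
qed

text \<open>Square \<open>x\<close> consists of the positive triangle \<open>p x\<close> and the
  negative triangle \<open>q x\<close>, glued along the hypotenuse. The colours are parameters so
  that horizontal and vertical shears are treated at once.\<close>

definition chart :: "'b surface \<Rightarrow> 'a set \<Rightarrow> colour \<Rightarrow> ('a \<Rightarrow> 'a) \<Rightarrow> colour \<Rightarrow> ('a \<Rightarrow> 'a) \<Rightarrow>
    ('a \<Rightarrow> 'b) \<Rightarrow> ('a \<Rightarrow> 'b) \<Rightarrow> bool" where
  "chart S X i w j w' p q \<longleftrightarrow> glued S \<and> inj_on p X \<and> inj_on q X \<and> p ` X \<inter> q ` X = {} \<and>
     p ` X \<union> q ` X = triangles S \<and>
     (\<forall>x \<in> X. glue S Green (p x) = q x \<and> glue S i (q x) = p (w x) \<and> glue S j (q x) = p (w' x))"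

definition rep :: "nat surface \<Rightarrow> 'a set \<Rightarrow> ('a \<Rightarrow> 'a) \<Rightarrow> ('a \<Rightarrow> 'a) \<Rightarrow> bool" where
  "rep S X r u \<longleftrightarrow> S \<in> square_tiled_surfaces \<and> origami X r u \<and> (\<exists>p q. chart S X Red u Blue r p q)"

section \<open>Shears of surfaces read in charts\<close>

lemma chart_swap: "chart S X i w j w' p q \<Longrightarrow> chart S X j w' i w p q"
  by (auto simp: chart_def)

lemma chart_square_tiled:
  assumes "chart S X Red u Blue r p q" "origami X r u"
  shows "square_tiled S"
  unfolding square_tiled_iff
proof (intro conjI allI impI)
  note ch = assms(1)[unfolded chart_def]
  show g: "glued S" using ch by (elim conjE)
  have cov: "p ` X \<union> q ` X = triangles S" using ch by (elim conjE)
  show "triangles S \<noteq> {}" unfolding cov[symmetric] using origamiD(4)[OF assms(2)] by simp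
  fix A assume A: "A \<subseteq> triangles S" "A \<noteq> {}" "\<forall>c. glue S c ` A \<subseteq> A"
  have Ac: "glue S c y \<in> A" if "y \<in> A" for c y using A(3) that by blast
  have pq: "q x \<in> A \<longleftrightarrow> p x \<in> A" if "x \<in> X" for x
  proof -
    have e: "glue S Green (p x) = q x" using that ch by blast
    then have "glue S Green (q x) = p x" using gluedD(3)[OF g, of Green "p x"] by simp
    then show ?thesis using e Ac[of "p x" Green] Ac[of "q x" Green] by metis
  qed
  have "{x \<in> X. p x \<in> A} = X"
  proof (rule origami_closed[OF assms(2)])
    obtain y where y: "y \<in> A" using A by blast
    then have "y \<in> p ` X \<union> q ` X" using A(1) unfolding cov by (rule_tac subsetD)
    then obtain x where x: "x \<in> X" "y = p x \<or> y = q x" by blast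
    then have "p x \<in> A" using y pq[OF x(1)] by (elim disjE) simp_all
    then show "{x \<in> X. p x \<in> A} \<noteq> {}" using x(1) by blast
    fix x assume x: "x \<in> {x \<in> X. p x \<in> A}"
    then have "q x \<in> A" using pq by blast
    then have "p (u x) \<in> A" "p (r x) \<in> A"
      using Ac[of "q x" Red] Ac[of "q x" Blue] x ch by auto
    then show "r x \<in> {x \<in> X. p x \<in> A}" "u x \<in> {x \<in> X. p x \<in> A}"
      using x permutes_in_image[OF origamiD(2)[OF assms(2)]] permutes_in_image[OF origamiD(3)[OF assms(2)]] by auto
  qed auto
  then have pA: "p x \<in> A" if "x \<in> X" for x using that by blast
  then have "q x \<in> A" if "x \<in> X" for x using pq[OF that] that by simp
  then have "p ` X \<union> q ` X \<subseteq> A" using pA by blast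
  then show "A = triangles S" using A(1) unfolding cov by simp
qed

text \<open>After the shear the green side of \<open>p x\<close> with \<open>x \<in> c\<close> is
  glued to \<open>q (w x)\<close>, so the negative triangles are renumbered by \<open>q'\<close>. In
  the new numbering \<open>w\<close> is unchanged, and the third colour, itself untouched, picks up
  a factor \<open>w\<close> on \<open>c\<close>.\<close>

lemma chart_shear:
  assumes ch: "chart S X i w j w' p q" and c: "c \<subseteq> X" "\<And>x. w x \<in> c \<longleftrightarrow> x \<in> c" and wX: "w permutes X"
    and ij: "i \<noteq> j" "i \<noteq> Green" "j \<noteq> Green"
  defines "C \<equiv> p ` c \<union> q ` c" and "q' \<equiv> \<lambda>x. if x \<in> c then q (w x) else q x"
  shows "chart (shear C i Green S) X i w j (cshear w' w c (Suc 0)) p q'" "C = p ` c \<union> q' ` c"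
    "triangles (shear C i Green S) = triangles S"
proof -
  let ?T = "shear C i Green S"
  show tri: "triangles ?T = triangles S" by (simp add: shear_def)
  note chD = ch[unfolded chart_def]
  have g: "glued S" using chD by blast
  have gl: "glue ?T k = (if k = i then (\<lambda>x. if x \<in> C then glue S Green x else glue S i x)
      else if k = Green then (\<lambda>x. if x \<in> C then glue S Green (glue S i (glue S Green x)) else glue S Green x)
      else glue S k)" for k
    using ij by (simp add: shear_def fun_upd_def)
  have wc: "w ` c = c"
  proof
    show "w ` c \<subseteq> c" using c(2) by blast
    show "c \<subseteq> w ` c"
    proof
      fix y assume "y \<in> c"
      moreover obtain z where "y = w z" using permutes_surj[OF wX] by (metis surjD)
      ultimately show "y \<in> w ` c" using c(2) by blast
    qed
  qed
  have q'c: "q' ` c = q ` c"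
  proof -
    have "q' ` c = q ` w ` c" by (auto simp: q'_def image_image)
    then show ?thesis by (simp add: wc)
  qed
  then show "C = p ` c \<union> q' ` c" by (simp add: C_def)
  have Gp: "glue S Green (p x) = q x" and iq: "glue S i (q x) = p (w x)" and jq: "glue S j (q x) = p (w' x)"
    if "x \<in> X" for x using chD that by auto
  have Gq: "glue S Green (q x) = p x" if "x \<in> X" for x
    using Gp[OF that] gluedD(3)[OF g, of Green "p x"] by simp
  have ip: "glue S i (p (w x)) = q x" if "x \<in> X" for x
    using iq[OF that] gluedD(3)[OF g, of i "q x"] by simp
  have wX': "w x \<in> X \<longleftrightarrow> x \<in> X" for x by (rule permutes_in_image[OF wX])
  have injp: "inj_on p X" and injq: "inj_on q X" and dis: "p ` X \<inter> q ` X = {}" using chD by auto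
  have pC: "p x \<in> C \<longleftrightarrow> x \<in> c" and qC: "q x \<in> C \<longleftrightarrow> x \<in> c" if x: "x \<in> X" for x
  proof -
    have "p x \<notin> q ` c" "q x \<notin> p ` c" using dis x c(1) by blast+
    then show "p x \<in> C \<longleftrightarrow> x \<in> c" "q x \<in> C \<longleftrightarrow> x \<in> c"
      using inj_on_image_mem_iff[OF injp x c(1)] inj_on_image_mem_iff[OF injq x c(1)]
      unfolding C_def by blast+
  qed
  have GC: "glue S Green y \<in> C" if "y \<in> C" for y
    using that Gp Gq c(1) unfolding C_def by auto
  have iC: "glue S i y \<in> C" if y: "y \<in> C" for y
  proof -
    from y consider x where "x \<in> c" "y = p x" | x where "x \<in> c" "y = q x" unfolding C_def by blast
    then show ?thesis
    proof cases
      case (1 x)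
      then obtain z where z: "x = w z" "z \<in> c" using wc by blast
      then show ?thesis using ip[of z] 1 c(1) unfolding C_def by auto
    next
      case (2 x)
      then show ?thesis using iq[of x] c unfolding C_def by auto
    qed
  qed
  have GC': "glue S Green y \<in> C \<longleftrightarrow> y \<in> C" for y
    using GC[of y] GC[of "glue S Green y"] unfolding gluedD(3)[OF g] by blast
  have iC': "glue S i y \<in> C \<longleftrightarrow> y \<in> C" for y
    using iC[of y] iC[of "glue S i y"] unfolding gluedD(3)[OF g] by blast
  have CX: "C \<subseteq> triangles S" using chD c(1) unfolding C_def by blast
  have inv: "glue ?T k (glue ?T k x) = x" for k x
    by (simp add: gl GC' iC' gluedD(3)[OF g])
  have gT: "glued ?T"
    unfolding glued_def tri
  proof (intro conjI allI)
    show "finite (triangles S)" by (rule gluedD(1)[OF g])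
    fix k
    show "glue ?T k \<circ> glue ?T k = id" using inv by (simp add: fun_eq_iff)
    show "glue ?T k permutes triangles S"
    proof (rule inj_imp_permutes)
      show "inj_on (glue ?T k) (triangles S)" by (metis inv inj_onI)
      show "glue ?T k x \<in> triangles S" if "x \<in> triangles S" for x
        using that by (simp add: gl gluedD(4)[OF g])
      show "glue ?T k x = x" if "x \<notin> triangles S" for x
      proof -
        have "x \<notin> C" using that CX by blast
        then show ?thesis using that permutes_not_in[OF gluedD(2)[OF g]] by (simp add: gl)
      qed
    qed (rule gluedD(1)[OF g])
  qed
  have "inj_on q' X"
  proof (rule inj_onI)
    fix x y assume *: "x \<in> X" "y \<in> X" "q' x = q' y"
    have iq: "inj_on q X" using chD by blast
    have "x \<in> c \<longleftrightarrow> y \<in> c"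
    proof -
      have "q' x \<in> C \<longleftrightarrow> x \<in> c" if "x \<in> X" for x using that qC wX' c by (simp add: q'_def)
      then show ?thesis using * by metis
    qed
    then show "x = y" using * inj_onD[OF iq, of x y] inj_onD[OF iq, of "w x" "w y"] wX'
        injD[OF permutes_inj[OF wX], of x y] by (cases "x \<in> c") (auto simp: q'_def)
  qed
  moreover have "q' ` X = q ` X"
  proof -
    have "X = c \<union> (X - c)" using c(1) by blast
    then have "q' ` X = q' ` c \<union> q' ` (X - c)" by blast
    also have "q' ` (X - c) = q ` (X - c)" by (auto simp: q'_def)
    also have "q' ` c \<union> q ` (X - c) = q ` X" unfolding q'c using c(1) by blast
    finally show ?thesis .
  qed
  moreover have "glue ?T Green (p x) = q' x \<and> glue ?T i (q' x) = p (w x) \<and>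
      glue ?T j (q' x) = p (cshear w' w c (Suc 0) x)" if x: "x \<in> X" for x
  proof (cases "x \<in> c")
    case True
    then show ?thesis
      using x pC[OF x] qC[of "w x"] c(2) wX' Gp[OF x] iq[OF x] Gp[of "w x"] Gq[of "w x"] jq[of "w x"] ij
      by (simp add: gl q'_def cshear_1)
  next
    case False
    then show ?thesis using x pC[OF x] qC[OF x] Gp[OF x] iq[OF x] jq[OF x] ij
      by (simp add: gl q'_def cshear_1)
  qed
  ultimately show "chart ?T X i w j (cshear w' w c (Suc 0)) p q'"
    using gT chD unfolding chart_def tri by simp
qed

lemma chart_shear_power:
  assumes "chart S X i w j w' p q" "c \<subseteq> X" "\<And>x. w x \<in> c \<longleftrightarrow> x \<in> c" "w permutes X"
    "i \<noteq> j" "i \<noteq> Green" "j \<noteq> Green"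
  shows "\<exists>q'. chart ((shear (p ` c \<union> q ` c) i Green ^^ m) S) X i w j (cshear w' w c m) p q' \<and>
    p ` c \<union> q ` c = p ` c \<union> q' ` c \<and> triangles ((shear (p ` c \<union> q ` c) i Green ^^ m) S) = triangles S"
proof (induction m)
  case 0
  have "cshear w' w c 0 = w'" by (rule ext) (simp add: cshear_def)
  then show ?case using assms(1) by (intro exI[of _ q]) simp
next
  case (Suc m)
  let ?C = "p ` c \<union> q ` c"
  obtain q' where q': "chart ((shear ?C i Green ^^ m) S) X i w j (cshear w' w c m) p q'"
    "?C = p ` c \<union> q' ` c" "triangles ((shear ?C i Green ^^ m) S) = triangles S" using Suc by blast
  from chart_shear[OF q'(1) assms(2-7)] obtain q'' where
    "chart (shear ?C i Green ((shear ?C i Green ^^ m) S)) X i w j (cshear (cshear w' w c m) w c (Suc 0)) p q''"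
    "?C = p ` c \<union> q'' ` c" "triangles (shear ?C i Green ((shear ?C i Green ^^ m) S)) = triangles S"
    unfolding q'(2)[symmetric] q'(3) by blast
  moreover have "cshear (cshear w' w c m) w c (Suc 0) = cshear w' w c (Suc m)"
    using cshear_Suc[of w c w' m] assms(3) by simp
  ultimately show ?case by (intro exI[of _ q'']) simp
qed

lemma chart_component:
  assumes ch: "chart S X i w j w' p q" and w: "w permutes X" "finite X" and c: "c \<in> rows X w"
  shows "p ` c \<union> q ` c \<in> components S i Green"
proof -
  note chD = ch[unfolded chart_def]
  have g: "glued S" using chD by blast
  let ?K = "{glue S i, glue S Green}"
  let ?H = "generate (Sym (triangles S)) ?K"
  have K: "k permutes triangles S \<and> k \<circ> k = id" if "k \<in> ?K" for k using that g by (auto simp: glued_def)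
  obtain x where x: "x \<in> X" "c = orbit w x" using c by (auto simp: rows_def)
  have cX: "c \<subseteq> X" by (rule row_subset[OF w(1) c])
  have wc: "w y \<in> c \<longleftrightarrow> y \<in> c" for y by (rule row_step_iff[OF w(2,1) c])
  have Gp: "glue S Green (p y) = q y" and iq: "glue S i (q y) = p (w y)" if "y \<in> X" for y using chD that by auto
  have Gq: "glue S Green (q y) = p y" if "y \<in> X" for y
    using Gp[OF that] gluedD(3)[OF g, of Green "p y"] by simp
  have ip: "glue S i (p (w y)) = q y" if "y \<in> X" for y
    using iq[OF that] gluedD(3)[OF g, of i "q y"] by simp
  have xc: "x \<in> c" using x permutes_self_in_orbit[OF w(2,1)] by simp
  have "group_orbit ?H (p x) = p ` c \<union> q ` c"
  proof
    show "group_orbit ?H (p x) \<subseteq> p ` c \<union> q ` c"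
    proof (rule group_orbit_generate_subset[OF K])
      show "p x \<in> p ` c \<union> q ` c" using xc by blast
      fix k y assume k: "k \<in> ?K" and y: "y \<in> p ` c \<union> q ` c"
      from y consider z where "z \<in> c" "y = p z" | z where "z \<in> c" "y = q z" by blast
      then show "k y \<in> p ` c \<union> q ` c"
      proof cases
        case (1 z)
        obtain z' where z': "z = w z'" using permutes_surj[OF w(1)] by (metis surjD)
        then have "z' \<in> c" using 1 wc by blast
        then show ?thesis using k 1 z' Gp[of z] ip[of z'] cX by auto
      next
        case (2 z)
        then have "w z \<in> c" using wc by blast
        then show ?thesis using k 2 Gq[of z] iq[of z] cX by auto
      qed
    qed
    have "orbit w x \<subseteq> {y \<in> c. p y \<in> group_orbit ?H (p x)}"
    proof (rule orbit_subset_closed)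
      show "x \<in> {y \<in> c. p y \<in> group_orbit ?H (p x)}" using xc group_orbit_generate_self by simp
      fix y assume y: "y \<in> {y \<in> c. p y \<in> group_orbit ?H (p x)}"
      then have yX: "y \<in> X" using cX by blast
      have "glue S Green (p y) \<in> group_orbit ?H (p x)"
        by (rule group_orbit_generate_step) (use y in auto)
      then have "q y \<in> group_orbit ?H (p x)" using Gp[OF yX] by simp
      then have "glue S i (q y) \<in> group_orbit ?H (p x)"
        by (rule group_orbit_generate_step) simp
      then have "p (w y) \<in> group_orbit ?H (p x)" using iq[OF yX] by simp
      then show "w y \<in> {y \<in> c. p y \<in> group_orbit ?H (p x)}" using y wc by blast
    qed
    then have pc: "p y \<in> group_orbit ?H (p x)" if "y \<in> c" for y using that x(2) by blast
    have qc: "q y \<in> group_orbit ?H (p x)" if "y \<in> c" for y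
    proof -
      have "glue S Green (p y) \<in> group_orbit ?H (p x)"
        by (rule group_orbit_generate_step[OF pc[OF that]]) simp
      moreover have "y \<in> X" using that cX by blast
      ultimately show ?thesis using Gp[of y] by simp
    qed
    show "p ` c \<union> q ` c \<subseteq> group_orbit ?H (p x)" using pc qc by blast
  qed
  moreover have "p x \<in> triangles S" using x chD by blast
  ultimately show ?thesis unfolding components_def group_orbits_def by blast
qed

lemma chart_move:
  assumes ch: "chart S X i w j w' p q" and w: "w permutes X" "finite X" and c: "c \<in> rows X w"
    and ij: "i \<noteq> j" "i \<noteq> Green" "j \<noteq> Green"
  shows "\<exists>T q'. cylinder_shear_power S T \<and> triangles T = triangles S \<and> chart T X i w j (cshear w' w c t) p q'"
proof -
  obtain k where k: "k > 0" "w ^^ k = id" using permutes_funpow_id[OF w(2,1)] by blast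
  \<comment> \<open>A power of a shear has a positive exponent; adding \<open>k\<close> with
    \<open>w ^^ k = id\<close> ensures this and does not change the result.\<close>
  let ?C = "p ` c \<union> q ` c" and ?m = "t + k"
  let ?T = "(shear ?C i Green ^^ ?m) S"
  have "cshear w' w c ?m = cshear w' w c t"
    by (rule ext) (simp add: cshear_def funpow_add k(2))
  moreover obtain q' where "chart ?T X i w j (cshear w' w c ?m) p q'" "triangles ?T = triangles S"
    using chart_shear_power[OF ch row_subset[OF w(1) c] row_step_iff[OF w(2,1) c] w(1) ij, of ?m] by blast
  moreover have "cylinder_shear_power S ?T"
    unfolding cylinder_shear_power_def
  proof (intro exI conjI)
    show "(i, Green) \<in> {(Green, Blue), (Blue, Green), (Red, Green), (Green, Red)}" using ij by (cases i) auto
    show "?C \<in> components S i Green" by (rule chart_component[OF ch w c])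
    show "1 \<le> ?m" using k(1) by simp
  qed (rule refl)
  ultimately show ?thesis by auto
qed

lemma sts_triangles:
  assumes "S \<in> square_tiled_surfaces" "triangles T = triangles S" "square_tiled T"
  shows "T \<in> square_tiled_surfaces"
  using assms by (auto simp: square_tiled_surfaces_def)

lemma rep_move_u:
  assumes "rep S X r u" "C \<in> rows X r"
  shows "\<exists>T. cylinder_shear_power S T \<and> rep T X r (cshear u r C t)"
proof -
  have o: "origami X r u" and S: "S \<in> square_tiled_surfaces" using assms(1) by (auto simp: rep_def)
  obtain p q where "chart S X Red u Blue r p q" using assms(1) by (auto simp: rep_def)
  then have ch: "chart S X Blue r Red u p q" by (rule chart_swap)
  obtain T q' where T: "cylinder_shear_power S T" "triangles T = triangles S"
    "chart T X Blue r Red (cshear u r C t) p q'"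
    using chart_move[OF ch origamiD(2)[OF o] origamiD(1)[OF o] assms(2)] by blast
  have o': "origami X r (cshear u r C t)" by (rule origami_cshear_u[OF o assms(2)])
  have "square_tiled T" by (rule chart_square_tiled[OF chart_swap[OF T(3)] o'])
  then show ?thesis using T o' sts_triangles[OF S T(2)] chart_swap[OF T(3)] unfolding rep_def by blast
qed

lemma rep_move_r:
  assumes "rep S X r u" "C \<in> rows X u"
  shows "\<exists>T. cylinder_shear_power S T \<and> rep T X (cshear r u C t) u"
proof -
  have o: "origami X r u" and S: "S \<in> square_tiled_surfaces" using assms(1) by (auto simp: rep_def)
  obtain p q where ch: "chart S X Red u Blue r p q" using assms(1) by (auto simp: rep_def)
  obtain T q' where T: "cylinder_shear_power S T" "triangles T = triangles S"
    "chart T X Red u Blue (cshear r u C t) p q'"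
    using chart_move[OF ch origamiD(3)[OF o] origamiD(1)[OF o] assms(2)] by blast
  have o': "origami X (cshear r u C t) u" by (rule origami_cshear_r[OF o assms(2)])
  have "square_tiled T" by (rule chart_square_tiled[OF T(3) o'])
  then show ?thesis using T o' sts_triangles[OF S T(2)] unfolding rep_def by blast
qed

lemma rep_relabel:
  assumes "rep S Y s v" "bij_betw p Y Z" "\<forall>x \<in> Y. s' (p x) = p (s x) \<and> v' (p x) = p (v x)"
    "s' permutes Z" "v' permutes Z"
  shows "rep S Z s' v'"
proof -
  have o: "origami Y s v" and S: "S \<in> square_tiled_surfaces" using assms(1) by (auto simp: rep_def)
  obtain f h where ch: "chart S Y Red v Blue s f h" using assms(1) by (auto simp: rep_def)
  note chD = ch[unfolded chart_def]
  let ?g = "the_inv_into Y p"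
  have bg: "bij_betw ?g Z Y" by (rule bij_betw_the_inv_into[OF assms(2)])
  have inj: "inj_on p Y" using assms(2) by (simp add: bij_betw_def)
  have gp: "?g (p x) = x" if "x \<in> Y" for x by (rule the_inv_into_f_f[OF inj that])
  have im: "(f \<circ> ?g) ` Z = f ` Y" "(h \<circ> ?g) ` Z = h ` Y"
    unfolding image_comp[symmetric] bij_betw_imp_surj_on[OF bg] by (rule refl)+
  have "chart S Z Red v' Blue s' (f \<circ> ?g) (h \<circ> ?g)"
    unfolding chart_def im
  proof (intro conjI ballI)
    show "inj_on (f \<circ> ?g) Z" "inj_on (h \<circ> ?g) Z"
      using chD bg by (auto simp: bij_betw_def intro!: comp_inj_on)
    fix z assume "z \<in> Z"
    then obtain x where x: "x \<in> Y" "z = p x" using assms(2) by (auto simp: bij_betw_def)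
    have "s x \<in> Y" "v x \<in> Y"
      using x permutes_in_image[OF origamiD(2)[OF o]] permutes_in_image[OF origamiD(3)[OF o]] by auto
    then show "glue S Green ((f \<circ> ?g) z) = (h \<circ> ?g) z" "glue S Red ((h \<circ> ?g) z) = (f \<circ> ?g) (v' z)"
      "glue S Blue ((h \<circ> ?g) z) = (f \<circ> ?g) (s' z)"
      using x chD assms(3) gp by simp_all
  qed (use chD in auto)
  then show ?thesis using S origami_relabel[OF o assms(2-5)] unfolding rep_def by blast
qed

section \<open>Isomorphism classes and the moves between them\<close>

lemma iso_equiv: "equiv square_tiled_surfaces iso_rel"
proof (rule equivI)
  show "iso_rel \<subseteq> square_tiled_surfaces \<times> square_tiled_surfaces" by (auto simp: iso_rel_def)
  show "refl_on square_tiled_surfaces iso_rel"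
  proof (rule refl_onI)
    fix S assume "S \<in> square_tiled_surfaces"
    then show "(S, S) \<in> iso_rel"
      unfolding iso_rel_def by (auto intro!: exI[of _ id] permutes_id)
  qed
  show "sym iso_rel"
  proof (rule symI)
    fix S T assume "(S, T) \<in> iso_rel"
    then obtain \<sigma> where st: "S \<in> square_tiled_surfaces" "T \<in> square_tiled_surfaces" "triangles S = triangles T"
      and s: "\<sigma> permutes triangles S" "\<And>c. glue T c = \<sigma> \<circ> glue S c \<circ> pinv \<sigma>" by (auto simp: iso_rel_def)
    have "glue S c = pinv \<sigma> \<circ> glue T c \<circ> pinv (pinv \<sigma>)" for c
      unfolding s(2) inv_inv_eq[OF permutes_bij[OF s(1)]] using permutes_inverses[OF s(1)] by (auto simp: fun_eq_iff)
    then show "(T, S) \<in> iso_rel"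
      using st permutes_inv[OF s(1)] unfolding iso_rel_def by auto
  qed
  show "trans iso_rel"
  proof (rule transI)
    fix S T U assume "(S, T) \<in> iso_rel" "(T, U) \<in> iso_rel"
    then obtain \<sigma> \<rho> where st: "S \<in> square_tiled_surfaces" "U \<in> square_tiled_surfaces"
        "triangles S = triangles T" "triangles T = triangles U"
      and s: "\<sigma> permutes triangles S" "\<And>c. glue T c = \<sigma> \<circ> glue S c \<circ> pinv \<sigma>"
        "\<rho> permutes triangles T" "\<And>c. glue U c = \<rho> \<circ> glue T c \<circ> pinv \<rho>" by (auto simp: iso_rel_def)
    have "pinv (\<rho> \<circ> \<sigma>) = pinv \<sigma> \<circ> pinv \<rho>"
      by (rule o_inv_distrib[OF permutes_bij[OF s(3)] permutes_bij[OF s(1)]])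
    then have "glue U c = (\<rho> \<circ> \<sigma>) \<circ> glue S c \<circ> pinv (\<rho> \<circ> \<sigma>)" for c
      unfolding s(4) s(2) by (simp add: comp_assoc)
    moreover have "\<rho> \<circ> \<sigma> permutes triangles S" using permutes_compose[OF s(1)] s(3) st(3) by simp
    ultimately show "(S, U) \<in> iso_rel" using st unfolding iso_rel_def by auto
  qed
qed

text \<open>\<open>iso_rel\<close> only relates surfaces with the same set of triangles, so this set
  has to be determined by the origami.\<close>

lemma rep_card:
  assumes "rep S X r u"
  shows "triangles S = {1..2 * card X}"
proof -
  obtain p q n where ch: "inj_on p X" "inj_on q X" "p ` X \<inter> q ` X = {}" "p ` X \<union> q ` X = triangles S"
    and n: "triangles S = {1..n}" and fin: "finite X"
  proof -
    obtain p q where "chart S X Red u Blue r p q" using assms unfolding rep_def by blast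
    moreover obtain n where "triangles S = {1..n}"
      using assms unfolding rep_def square_tiled_surfaces_def by blast
    moreover have "finite X" using assms by (simp add: rep_def origami_def)
    ultimately show thesis using that[of p q n] by (simp add: chart_def)
  qed
  have "card (triangles S) = card (p ` X) + card (q ` X)"
    unfolding ch(4)[symmetric] using ch(3) fin by (intro card_Un_disjoint) auto
  then have "n = 2 * card X" using n ch(1,2) by (simp add: card_image)
  then show ?thesis using n by simp
qed

text \<open>The isomorphism matches \<open>p x\<close> with \<open>p' x\<close> and
  \<open>q x\<close> with \<open>q' x\<close>. For every triangle and colour, the triangle or its
  neighbour is negative, so commutation with the involutions is checked on the negative triangles
  only.\<close>

lemma rep_unique:
  assumes "rep S X r u" "rep T X r u"
  shows "(S, T) \<in> iso_rel"
proof -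
  obtain p q where S: "chart S X Red u Blue r p q" using assms(1) by (auto simp: rep_def)
  obtain p' q' where T: "chart T X Red u Blue r p' q'" using assms(2) by (auto simp: rep_def)
  note SD = S[unfolded chart_def] and TD = T[unfolded chart_def]
  have o: "origami X r u" using assms(1) by (simp add: rep_def)
  have tri: "triangles S = triangles T" using rep_card[OF assms(1)] rep_card[OF assms(2)] by simp
  have gS: "glued S" and gT: "glued T" using SD TD by blast+
  define s where "s y = (if y \<in> p ` X then p' (the_inv_into X p y)
    else if y \<in> q ` X then q' (the_inv_into X q y) else y)" for y
  have sp: "s (p x) = p' x" and sq: "s (q x) = q' x" if "x \<in> X" for x
    using that SD the_inv_into_f_f[of p X x] the_inv_into_f_f[of q X x] by (auto simp: s_def)
  have "s ` triangles S = triangles S"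
  proof -
    have "s ` triangles S = s ` p ` X \<union> s ` q ` X" using SD by (metis image_Un)
    also have "s ` p ` X = p' ` X" unfolding image_image by (rule image_cong[OF refl sp])
    also have "s ` q ` X = q' ` X" unfolding image_image by (rule image_cong[OF refl sq])
    finally show ?thesis using TD tri by simp
  qed
  then have sper: "s permutes triangles S"
  proof (intro inj_imp_permutes)
    assume im: "s ` triangles S = triangles S"
    show "inj_on s (triangles S)"
      using im gluedD(1)[OF gS] eq_card_imp_inj_on by metis
    show "s y = y" if "y \<notin> triangles S" for y using that SD by (auto simp: s_def)
  qed (use gluedD(1)[OF gS] in auto)
  have comm: "glue T c (s y) = s (glue S c y)" for c y
  proof (cases "y \<in> triangles S")
    case False
    then have "s y = y" "glue S c y = y" "glue T c y = y"
      using permutes_not_in[OF sper] permutes_not_in[OF gluedD(2)[OF gS]]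
        permutes_not_in[OF gluedD(2)[OF gT]] tri by auto
    then show ?thesis by simp
  next
    case True
    have q: "glue T c (s (q x)) = s (glue S c (q x))" if x: "x \<in> X" for x c
    proof -
      have "u x \<in> X" "r x \<in> X"
        using x permutes_in_image[OF origamiD(2)[OF o]] permutes_in_image[OF origamiD(3)[OF o]] by auto
      moreover have "glue S Green (q x) = p x" "glue T Green (q' x) = p' x"
        using x SD TD gluedD(3)[OF gS, of Green "p x"] gluedD(3)[OF gT, of Green "p' x"] by auto
      ultimately show ?thesis using x SD TD sp sq by (cases c) auto
    qed
    have "\<exists>x \<in> X. glue S c y = q x \<or> y = q x"
    proof (cases "y \<in> q ` X")
      case False
      then obtain x where x: "x \<in> X" "y = p x" using SD True by blast
      obtain x' where x': "x = u x'" using permutes_surj[OF origamiD(3)[OF o]] by (metis surjD)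
      obtain x'' where x'': "x = r x''" using permutes_surj[OF origamiD(2)[OF o]] by (metis surjD)
      have in1: "x' \<in> X" using permutes_in_image[OF origamiD(3)[OF o], of x'] x(1) x' by simp
      have in2: "x'' \<in> X" using permutes_in_image[OF origamiD(2)[OF o], of x''] x(1) x'' by simp
      have gl: "glue S Green (p z) = q z" "glue S Red (q z) = p (u z)" "glue S Blue (q z) = p (r z)"
        if "z \<in> X" for z using SD that by auto
      have "glue S Green y = q x" using gl(1)[OF x(1)] x(2) by simp
      moreover have "glue S Red (q x') = y" using gl(2)[OF in1] x(2) x' by simp
      then have "glue S Red y = q x'" using gluedD(3)[OF gS, of Red "q x'"] by simp
      moreover have "glue S Blue (q x'') = y" using gl(3)[OF in2] x(2) x'' by simp
      then have "glue S Blue y = q x''" using gluedD(3)[OF gS, of Blue "q x''"] by simp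
      ultimately show ?thesis using x(1) in1 in2 by (cases c) blast+
    qed auto
    then obtain x where x: "x \<in> X" "glue S c y = q x \<or> y = q x" by blast
    from x(2) show ?thesis
    proof
      assume "y = q x" then show ?thesis using q[OF x(1)] by simp
    next
      assume e: "glue S c y = q x"
      then have "y = glue S c (q x)" using gluedD(3)[OF gS, of c y] by simp
      then have "glue T c (s y) = glue T c (glue T c (s (q x)))" using q[OF x(1), of c] by simp
      then show ?thesis using e gluedD(3)[OF gT] by simp
    qed
  qed
  have "glue T c = s \<circ> glue S c \<circ> pinv s" for c
  proof
    fix y
    have "glue T c (s (pinv s y)) = s (glue S c (pinv s y))" by (rule comm)
    then show "glue T c y = (s \<circ> glue S c \<circ> pinv s) y" using permutes_inverses[OF sper] by simp
  qed
  then show ?thesis using assms sper tri unfolding iso_rel_def rep_def by auto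
qed

lemma move_of_power:
  assumes "S \<in> square_tiled_surfaces" "T \<in> square_tiled_surfaces" "cylinder_shear_power S T"
  shows "(iso_rel `` {S}, iso_rel `` {T}) \<in> cylinder_move"
proof -
  have "S \<in> iso_rel `` {S}" "T \<in> iso_rel `` {T}"
    using assms equiv_class_self[OF iso_equiv] by blast+
  then show ?thesis unfolding cylinder_move_def using assms by (auto intro: quotientI)
qed

lemma reach_rep:
  assumes "reach X r u n Y s v" "rep S X r u"
  shows "\<exists>T. rep T Y s v \<and> (iso_rel `` {S}, iso_rel `` {T}) \<in> cylinder_move ^^ n"
  using assms
proof (induction rule: reach.induct)
  case reach_refl
  then show ?case by auto
next
  case (reach_u n Y s v C t)
  then obtain T where T: "rep T Y s v" "(iso_rel `` {S}, iso_rel `` {T}) \<in> cylinder_move ^^ n" by blast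
  obtain U where U: "cylinder_shear_power T U" "rep U Y s (cshear v s C t)"
    using rep_move_u[OF T(1) reach_u.hyps(2)] by blast
  have "(iso_rel `` {T}, iso_rel `` {U}) \<in> cylinder_move"
    by (rule move_of_power) (use T U in \<open>auto simp: rep_def\<close>)
  then show ?case using T(2) U(2) by auto
next
  case (reach_r n Y s v C t)
  then obtain T where T: "rep T Y s v" "(iso_rel `` {S}, iso_rel `` {T}) \<in> cylinder_move ^^ n" by blast
  obtain U where U: "cylinder_shear_power T U" "rep U Y (cshear s v C t) v"
    using rep_move_r[OF T(1) reach_r.hyps(2)] by blast
  have "(iso_rel `` {T}, iso_rel `` {U}) \<in> cylinder_move"
    by (rule move_of_power) (use T U in \<open>auto simp: rep_def\<close>)
  then show ?case using T(2) U(2) by auto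
next
  case (reach_relabel n Y s v p Z s' v')
  then show ?case using rep_relabel by blast
qed

lemma rep_connected:
  fixes X Y :: "nat set"
  assumes "rep S X r u" "hyp X r u b d" "rep T Y s v" "hyp Y s v b' d" "card X = card Y" "d \<ge> 3"
  shows "\<exists>N \<le> 16 * d. (iso_rel `` {S}, iso_rel `` {T}) \<in> cylinder_move ^^ N"
proof -
  obtain n1 where n1: "n1 \<le> 8 * d" "reach X r u n1 {..<card X} (cyc (card X))
    (ustar ((card X - (d - 1)) # replicate (d - 1) 1) 0)" using reach_normal_form[OF assms(2,6)] by blast
  obtain n2 where n2: "n2 \<le> 8 * d" "reach Y s v n2 {..<card X} (cyc (card X))
    (ustar ((card X - (d - 1)) # replicate (d - 1) 1) 0)"
    using reach_normal_form[OF assms(4,6)] assms(5) by auto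
  have "origami Y s v" using assms(4) by (simp add: hyp_def)
  then have "reach X r u (n1 + n2) Y s v" by (intro reach_trans[OF reach_sym[OF n2(2)] n1(2)])
  then obtain U where U: "rep U Y s v" "(iso_rel `` {S}, iso_rel `` {U}) \<in> cylinder_move ^^ (n1 + n2)"
    using reach_rep assms(1) by blast
  have "iso_rel `` {U} = iso_rel `` {T}"
    by (rule equiv_class_eq[OF iso_equiv rep_unique[OF U(1) assms(3)]])
  then show ?thesis using U(2) n1(1) n2(1) by (intro exI[of _ "n1 + n2"]) auto
qed

section \<open>Hyperelliptic surfaces\<close>

lemma orbit_semiconj:
  assumes "\<And>y. y \<in> A \<Longrightarrow> g (h y) = h (f y) \<and> f y \<in> A" "x \<in> A"
  shows "orbit g (h x) = h ` orbit f x"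
proof
  have "z \<in> h ` (orbit f x \<inter> A)" if "z \<in> orbit g (h x)" for z using that
  proof induction
    case base
    then show ?case using assms orbit.base[of f x] by auto
  next
    case (step z)
    then obtain y where "y \<in> orbit f x" "y \<in> A" "z = h y" by blast
    then show ?case using assms(1) orbit.step[of y f x] by auto
  qed
  then show "orbit g (h x) \<subseteq> h ` orbit f x" by blast
  have "y \<in> A \<and> h y \<in> orbit g (h x)" if "y \<in> orbit f x" for y using that
  proof induction
    case base
    then show ?case using assms orbit.base[of g "h x"] by simp
  next
    case (step y)
    then show ?case using assms(1)[of y] orbit.step[of "h y" g "h x"] by simp
  qed
  then show "h ` orbit f x \<subseteq> orbit g (h x)" by blast
qed

lemma sum_cycle_type: "(\<Sum>i \<in># cycle_type S. f i) = (\<Sum>C \<in> vertex_cycles S. f (card C))"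
  by (simp add: cycle_type_def sum_unfold_sum_mset image_mset.compositionality comp_def)

lemma orbit_le_two:
  assumes "f (f x) = x"
  shows "card (orbit f x) \<le> 2"
proof -
  have "orbit f x \<subseteq> {x, f x}" by (rule orbit_subset_closed) (use assms in auto)
  then show ?thesis by (rule card_le_two)
qed

lemma orbit_two:
  assumes "finite X" "f permutes X" "card (orbit f x) = 2"
  shows "f (f x) = x"
proof (rule ccontr)
  assume n: "f (f x) \<noteq> x"
  have "f x \<noteq> f (f x)"
  proof
    assume "f x = f (f x)"
    then have "x = f x" using permutes_inj[OF assms(2)] by (simp add: inj_eq)
    then show False using n by simp
  qed
  moreover have "f x \<noteq> x" using n by auto
  ultimately have "card {x, f x, f (f x)} = 3" using n by auto
  moreover have "{x, f x, f (f x)} \<subseteq> orbit f x"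
    using permutes_self_in_orbit[OF assms(1,2), of x] orbit.base[of f x] orbit.step[OF orbit.base[of f x]] by simp
  moreover have "finite (orbit f x)" using assms(3) card.infinite by fastforce
  ultimately show False using card_mono[of "orbit f x" "{x, f x, f (f x)}"] assms(3) by simp
qed

text \<open>All cycles other than \<open>Z\<close> have length 1 or 2, so each fixed point
  contributes -1 and each transposition 0.\<close>

lemma sum_rows_minus_two:
  assumes "finite X" "v permutes X" and Z: "Z = {x \<in> X. v (v x) \<noteq> x}" "Z \<in> rows X v"
  shows "(\<Sum>D \<in> rows X v. int (card D) - 2) = int (card Z) - 2 - int (card {x \<in> X. v x = x})"
proof -
  have "int (card D) - 2 = (if D = Z then int (card Z) - 2 else 0) - int (card {x \<in> D. v x = x})"
    if D: "D \<in> rows X v" for D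
  proof (cases "D = Z")
    case True
    then have "{x \<in> D. v x = x} = {}" using Z(1) by auto
    then show ?thesis using True by (simp only: card.empty) simp
  next
    case False
    obtain x where x: "x \<in> D" using row_nonempty[OF D] by blast
    have xZ: "x \<notin> Z" using rows_disjoint[OF assms(1,2) D Z(2) x] False by blast
    have xX: "x \<in> X" using row_subset[OF assms(2) D] x by blast
    then have vv: "v (v x) = x" using xZ Z(1) by simp
    have "orbit v x \<subseteq> {x, v x}" by (rule orbit_subset_closed) (use vv in auto)
    then have Deq: "D = {x, v x}"
      using row_eq_orbit[OF assms(1,2) D x] permutes_self_in_orbit[OF assms(1,2), of x] orbit.base[of v x] by auto
    show ?thesis
    proof (cases "v x = x")
      case True
      then have "D = {x}" "{y \<in> D. v y = y} = {x}" using Deq by auto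
      then show ?thesis using False by simp
    next
      case nf: False
      then have "card D = 2" "{y \<in> D. v y = y} = {}" using Deq vv by auto
      then show ?thesis using False by (simp only: card.empty) simp
    qed
  qed
  then have "(\<Sum>D \<in> rows X v. int (card D) - 2)
      = (\<Sum>D \<in> rows X v. (if D = Z then int (card Z) - 2 else 0) - int (card {x \<in> D. v x = x}))" by simp
  also have "\<dots> = (int (card Z) - 2) - int (\<Sum>D \<in> rows X v. card {x \<in> D. v x = x})"
    using finite_rows[OF assms(1), of v] Z(2) by (simp add: sum_subtractf)
  also have "(\<Sum>D \<in> rows X v. card {x \<in> D. v x = x}) = card {x \<in> X. v x = x}"
    by (rule card_split_rows[OF assms(1,2), symmetric])
  finally show ?thesis .
qed

locale hyp_surface =
  fixes S :: "nat surface" and A B :: "nat set" and a :: "nat \<Rightarrow> nat"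
  assumes S: "S \<in> square_tiled_surfaces"
    and AB: "A \<union> B = triangles S" "A \<inter> B = {}" "\<And>c. glue S c ` A = B"
    and inv: "hyperelliptic_involution S a"
begin

abbreviation "G \<equiv> glue S Green"
abbreviation "V \<equiv> vertex_perm S"
abbreviation "Q \<equiv> quotient_surface S (generate (Sym (triangles S)) {a})"

lemma square_tiled: "square_tiled S" and glued: "glued S"
  using S square_tiled_iff by (auto simp: square_tiled_surfaces_def)

lemma finite_tri: "finite (triangles S)" and gg [simp]: "glue S c (glue S c x) = x"
  and glue_permutes: "glue S c permutes triangles S"
  using gluedD[OF glued] by auto

lemma glue_inj: "glue S c x = glue S c y \<longleftrightarrow> x = y"
  using permutes_inj[OF glue_permutes] by (simp add: inj_eq)

lemma gA: "x \<in> A \<Longrightarrow> glue S c x \<in> B"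
  using AB(3) by blast

lemma gB: assumes "x \<in> B" shows "glue S c x \<in> A"
proof -
  obtain y where "y \<in> A" "x = glue S c y" using AB(3)[of c] assms by blast
  then show ?thesis by simp
qed

lemma not_both: "x \<in> A \<Longrightarrow> x \<notin> B" "x \<in> B \<Longrightarrow> x \<notin> A"
  using AB(2) by auto

lemma A_tri: "x \<in> A \<Longrightarrow> x \<in> triangles S" and B_tri: "x \<in> B \<Longrightarrow> x \<in> triangles S"
  and tri_cases: "x \<in> triangles S \<Longrightarrow> x \<in> A \<or> x \<in> B"
  using AB(1) by auto

lemma glue_A_iff: "x \<in> triangles S \<Longrightarrow> glue S c x \<in> A \<longleftrightarrow> x \<notin> A"
  using tri_cases[of x] gA[of x c] gB[of x c] not_both by blast

lemma finite_A: "finite A"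
  using AB(1) finite_tri by (metis finite_Un)

lemma a_permutes: "a permutes triangles S" and a_glue: "a (glue S c x) = glue S c (a x)"
  and aa [simp]: "a (a x) = x" and genus: "has_genus Q 0"
  using inv by (auto simp: hyperelliptic_involution_def automorphism_def fun_eq_iff)

lemma a_tri: "a x \<in> triangles S \<longleftrightarrow> x \<in> triangles S"
  by (rule permutes_in_image[OF a_permutes])

section \<open>The quotient by the involution\<close>

definition pt :: "nat \<Rightarrow> nat set" where "pt x = {x, a x}"

lemma pt_a: "pt (a x) = pt x"
  by (auto simp: pt_def)

lemma group_orbit_a: "group_orbit (generate (Sym (triangles S)) {a}) x = pt x"
proof
  show "group_orbit (generate (Sym (triangles S)) {a}) x \<subseteq> pt x"
  proof (rule group_orbit_generate_subset)
    have "a \<circ> a = id" by (simp add: fun_eq_iff)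
    then show "k permutes triangles S \<and> k \<circ> k = id" if "k \<in> {a}" for k using that a_permutes by simp
  qed (auto simp: pt_def)
  show "pt x \<subseteq> group_orbit (generate (Sym (triangles S)) {a}) x"
    using group_orbit_generate_self[of x] group_orbit_generate_step[OF group_orbit_generate_self[of x]]
    by (auto simp: pt_def)
qed

lemma triangles_Q: "triangles Q = pt ` triangles S"
  by (simp add: quotient_surface_def group_orbits_def group_orbit_a)

lemma glue_Q: "x \<in> triangles S \<Longrightarrow> glue Q c (pt x) = pt (glue S c x)"
  using triangles_Q by (auto simp: quotient_surface_def pt_def a_glue)

lemma vertex_perm_Q:
  assumes "x \<in> triangles S"
  shows "vertex_perm Q (pt x) = pt (V x)"
  using assms gluedD(4)[OF glued] by (simp add: vertex_perm_def glue_Q)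

lemma V_A: "x \<in> A \<Longrightarrow> V x \<in> B" and V_B: "x \<in> B \<Longrightarrow> V x \<in> A"
  using gA gB by (simp_all add: vertex_perm_def)

lemma V_permutes: "V permutes triangles S"
  unfolding vertex_perm_def using glue_permutes by (intro permutes_compose)

lemma V_tri: "V x \<in> triangles S \<longleftrightarrow> x \<in> triangles S"
  by (rule permutes_in_image[OF V_permutes])

lemma V_a: "V (a x) = a (V x)"
  by (simp add: vertex_perm_def a_glue)

text \<open>The gluings exchange the two classes and commute with \<open>a\<close>, so the set of
  triangles whose class \<open>a\<close> preserves is invariant; by transitivity it is empty or
  everything.\<close>

lemma swap_or_preserve:
  "(\<forall>x \<in> triangles S. a x \<in> A \<longleftrightarrow> x \<in> A) \<or> (\<forall>x \<in> triangles S. a x \<in> A \<longleftrightarrow> x \<notin> A)"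
proof -
  let ?P = "{x \<in> triangles S. a x \<in> A \<longleftrightarrow> x \<in> A}"
  have "\<forall>c. glue S c ` ?P \<subseteq> ?P"
  proof (intro allI image_subsetI)
    fix c x assume x: "x \<in> ?P"
    then have t: "x \<in> triangles S" "a x \<in> triangles S" "glue S c x \<in> triangles S"
      using a_tri[of x] gluedD(4)[OF glued, of c x] by auto
    have "a (glue S c x) \<in> A \<longleftrightarrow> glue S c x \<in> A"
      unfolding a_glue using glue_A_iff[OF t(1), of c] glue_A_iff[OF t(2), of c] x by simp
    then show "glue S c x \<in> ?P" using t by simp
  qed
  moreover have "?P \<subseteq> triangles S" by blast
  ultimately have "?P = {} \<or> ?P = triangles S"
    using square_tiled unfolding square_tiled_iff by (metis (no_types, lifting))
  then show ?thesis by blast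
qed

text \<open>If \<open>a\<close> preserved the two classes, the quotient would be Abelian; it would then have no
  fixed points and no vertex of degree one, hence positive genus.\<close>

lemma a_A: assumes x: "x \<in> triangles S" shows "a x \<in> A \<longleftrightarrow> x \<notin> A"
proof (rule ccontr)
  assume "\<not> ?thesis"
  then have pres: "a y \<in> A \<longleftrightarrow> y \<in> A" if "y \<in> triangles S" for y
    using swap_or_preserve x that by blast
  have par: "y \<in> A \<longleftrightarrow> z \<in> A" if "pt y = pt z" "y \<in> triangles S" "z \<in> triangles S" for y z
  proof -
    have "y \<in> pt z" using that(1) by (auto simp: pt_def)
    then show ?thesis using pres[OF that(3)] by (auto simp: pt_def)
  qed
  have "pt (glue S c y) \<noteq> pt y" if "y \<in> triangles S" for c y
    using par[of "glue S c y" y] that glue_A_iff[OF that] gluedD(4)[OF glued] by blast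
  then have "{y \<in> triangles Q. glue Q c y = y} = {}" for c
    unfolding triangles_Q using glue_Q by auto
  then have "num_fixed Q = 0" unfolding num_fixed_def by (simp only: card.empty sum.neutral_const)
  moreover have "2 \<le> card C" if C: "C \<in> vertex_cycles Q" for C
  proof -
    obtain y where y: "y \<in> triangles S" "C = orbit (vertex_perm Q) (pt y)"
      using C by (auto simp: vertex_cycles_def triangles_Q)
    have "C \<subseteq> triangles Q" unfolding y(2) triangles_Q
      by (rule orbit_subset_closed) (use y vertex_perm_Q V_tri in auto)
    then have fC: "finite C"
      unfolding triangles_Q by (rule finite_subset) (rule finite_imageI[OF finite_tri])
    have 1: "pt (V y) \<in> C" using orbit.base[of "vertex_perm Q" "pt y"] y vertex_perm_Q by simp
    then have 2: "pt (V (V y)) \<in> C"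
      using orbit.step[of "pt (V y)" "vertex_perm Q" "pt y"] y vertex_perm_Q[of "V y"] V_tri by simp
    have "V z \<in> A \<longleftrightarrow> z \<notin> A" if "z \<in> triangles S" for z
      using tri_cases[OF that] V_A V_B not_both by blast
    then have "pt (V y) \<noteq> pt (V (V y))" using par[of "V y" "V (V y)"] y(1) V_tri by blast
    then have "card {pt (V y), pt (V (V y))} = 2" by simp
    then show ?thesis using card_mono[OF fC, of "{pt (V y), pt (V (V y))}"] 1 2 by simp
  qed
  then have "(\<Sum>C \<in> vertex_cycles Q. int (card C) - 2) \<ge> 0" by (intro sum_nonneg) fastforce
  ultimately show False using genus unfolding has_genus_def sum_cycle_type by simp
qed

lemma a_swap: "x \<in> A \<Longrightarrow> a x \<in> B" "x \<in> B \<Longrightarrow> a x \<in> A"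
  using a_A[of x] a_tri[of x] A_tri B_tri tri_cases not_both by blast+

section \<open>The origami on the positive triangles and its quotient data\<close>

definition rr :: "nat \<Rightarrow> nat" where "rr x = (if x \<in> A then glue S Blue (G x) else x)"
definition uu :: "nat \<Rightarrow> nat" where "uu x = (if x \<in> A then glue S Red (G x) else x)"
definition bb :: "nat \<Rightarrow> nat" where "bb x = (if x \<in> A then G (a x) else x)"
text \<open>The vertex permutation of the quotient, each orbit of \<open>a\<close> being represented
  by its element in \<open>A\<close>; there it is \<open>V \<circ> a\<close>.\<close>

definition vv :: "nat \<Rightarrow> nat" where "vv x = uu (rr (bb x))"

lemma in_A: "rr x \<in> A \<longleftrightarrow> x \<in> A" "uu x \<in> A \<longleftrightarrow> x \<in> A" "bb x \<in> A \<longleftrightarrow> x \<in> A"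
  using gA gB a_swap by (auto simp: rr_def uu_def bb_def)

lemma permutes_AI: "(\<And>x. x \<in> A \<Longrightarrow> f x \<in> A) \<Longrightarrow> (\<And>x. x \<notin> A \<Longrightarrow> f x = x) \<Longrightarrow> inj_on f A \<Longrightarrow> f permutes A"
  by (rule inj_imp_permutes[OF _ finite_A])

lemma rr_permutes: "rr permutes A"
  by (rule permutes_AI) (auto simp: in_A rr_def inj_on_def glue_inj gA gB)

lemma uu_permutes: "uu permutes A"
  by (rule permutes_AI) (auto simp: in_A uu_def inj_on_def glue_inj gA gB)

lemma bb_permutes: "bb permutes A"
proof (rule permutes_AI)
  show "inj_on bb A"
  proof (rule inj_onI)
    fix x y assume "x \<in> A" "y \<in> A" "bb x = bb y"
    then have "a x = a y" by (simp add: bb_def glue_inj)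
    then show "x = y" by (metis aa)
  qed
qed (auto simp: in_A bb_def gB a_swap)

lemma inverts_bb: "inverts bb rr" "inverts bb uu"
proof -
  have "bb (bb x) = x" for x using in_A(3)[of x] by (auto simp: bb_def a_glue)
  moreover have "rr (bb (rr x)) = bb x" for x
    using in_A(1)[of x] in_A(3)[of "rr x"] by (auto simp: bb_def rr_def a_glue gA gB a_swap)
  moreover have "uu (bb (uu x)) = bb x" for x
    using in_A(2)[of x] in_A(3)[of "uu x"] by (auto simp: bb_def uu_def a_glue gA gB a_swap)
  ultimately show "inverts bb rr" "inverts bb uu" by (simp_all add: inverts_def)
qed

lemma vv_eq: "x \<in> A \<Longrightarrow> vv x = V (a x)"
  using in_A by (simp add: vv_def uu_def rr_def bb_def vertex_perm_def gA gB a_swap)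

lemma vv_permutes: "vv permutes A"
  using permutes_compose[OF permutes_compose[OF bb_permutes rr_permutes] uu_permutes]
  by (simp add: vv_def[abs_def] comp_def)

lemma vv_A: "vv x \<in> A \<longleftrightarrow> x \<in> A"
  by (rule permutes_in_image[OF vv_permutes])

lemma vv_vv: assumes "x \<in> A" shows "vv (vv x) = V (V x)"
proof -
  have "vv (vv x) = V (a (vv x))" using assms by (intro vv_eq) (simp add: vv_A)
  also have "a (vv x) = V x" using vv_eq[OF assms] by (simp add: V_a)
  finally show ?thesis .
qed

lemma chart_A: "chart S A Red uu Blue rr (\<lambda>x. x) G"
  unfolding chart_def using glued AB(1,2) AB(3)[of Green]
  by (auto simp: inj_on_def glue_inj rr_def uu_def)

lemma origami_A: "origami A rr uu"
  unfolding origami_def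
proof (intro conjI allI impI)
  show "A \<noteq> {}"
  proof
    assume "A = {}"
    moreover from this have "B = {}" using AB(3)[of Green] by simp
    ultimately show False using AB(1) square_tiled by (simp add: square_tiled_def)
  qed
  fix Y assume Y: "Y \<subseteq> A" "Y \<noteq> {}" "rr ` Y \<subseteq> Y" "uu ` Y \<subseteq> Y"
  have fw: "rr z \<in> Y" "uu z \<in> Y" if "z \<in> Y" for z using Y that by auto
  have bw1: "z \<in> Y" if "rr z \<in> Y" for z
    using permutes_inv_closed[where A = Y, OF finite_A rr_permutes] fw(1) that by blast
  have bw2: "z \<in> Y" if "uu z \<in> Y" for z
    using permutes_inv_closed[where A = Y, OF finite_A uu_permutes] fw(2) that by blast
  have "glue S c y \<in> Y \<union> G ` Y" if y: "y \<in> Y \<union> G ` Y" for c y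
  proof -
    from y consider "y \<in> Y" | z where "z \<in> Y" "y = G z" by blast
    then show ?thesis
    proof cases
      case 1
      then have yA: "y \<in> A" using Y(1) by blast
      have R: "G (glue S Red y) \<in> A" "G (glue S Blue y) \<in> A" using gA gB yA by auto
      have "uu (G (glue S Red y)) = y" "rr (G (glue S Blue y)) = y" using R by (simp_all add: uu_def rr_def)
      then have "G (glue S Red y) \<in> Y" "G (glue S Blue y) \<in> Y"
        using bw1[of "G (glue S Blue y)"] bw2[of "G (glue S Red y)"] 1 by simp_all
      then have "G (G (glue S Red y)) \<in> G ` Y" "G (G (glue S Blue y)) \<in> G ` Y" by blast+
      then show ?thesis using 1 by (cases c) auto
    next
      case (2 z)
      then have "z \<in> A" using Y(1) by blast
      then have "glue S Red y = uu z" "glue S Blue y = rr z" "G y = z" using 2 by (simp_all add: uu_def rr_def)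
      then show ?thesis using 2 fw by (cases c) auto
    qed
  qed
  then have "\<forall>c. glue S c ` (Y \<union> G ` Y) \<subseteq> Y \<union> G ` Y" by blast
  moreover have GY: "G ` Y \<subseteq> B" using gA Y(1) by blast
  moreover have "Y \<union> G ` Y \<subseteq> triangles S" using GY Y(1) AB(1) by blast
  ultimately have "Y \<union> G ` Y = triangles S"
    using square_tiled Y(2) unfolding square_tiled_iff by (metis Un_empty)
  then show "Y = A" using GY Y(1) AB by blast
qed (use finite_A rr_permutes uu_permutes in auto)

lemma rep_A: "rep S A rr uu"
  unfolding rep_def using S origami_A chart_A by blast

lemma pt_inj: "inj_on pt A"
proof (rule inj_onI)
  fix x y assume *: "x \<in> A" "y \<in> A" "pt x = pt y"
  then have "x \<in> pt y" by (auto simp: pt_def)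
  moreover have "x \<noteq> a y" using * a_swap not_both by blast
  ultimately show "x = y" by (simp add: pt_def)
qed

lemma pt_A: "pt ` A = triangles Q"
proof -
  have "pt x \<in> pt ` A" if x: "x \<in> triangles S" for x
  proof (cases "x \<in> A")
    case False
    then have "a x \<in> A" using x tri_cases a_swap by blast
    then show ?thesis using pt_a[of x] by (metis image_eqI)
  qed auto
  then show ?thesis using A_tri by (auto simp: triangles_Q)
qed

lemma fixed_Q:
  assumes "\<And>x. x \<in> A \<Longrightarrow> f x \<in> A \<and> glue Q c (pt x) = pt (f x)"
  shows "card {y \<in> triangles Q. glue Q c y = y} = card {x \<in> A. f x = x}"
proof -
  have "{y \<in> triangles Q. glue Q c y = y} = pt ` {x \<in> A. f x = x}"
    unfolding pt_A[symmetric] using assms inj_on_eq_iff[OF pt_inj] by auto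
  then show ?thesis using card_image[OF inj_on_subset[OF pt_inj]] by simp
qed

lemma glue_Q_A:
  assumes "x \<in> A"
  shows "glue Q Green (pt x) = pt (bb x)" "glue Q Red (pt x) = pt (uu (bb x))" "glue Q Blue (pt x) = pt (rr (bb x))"
proof -
  have *: "glue Q c (pt x) = pt (glue S c (a x))" for c
    using glue_Q[OF A_tri[OF assms], of c] pt_a[of "glue S c x"] by (simp add: a_glue)
  have "G (a x) \<in> A" using assms gB a_swap by blast
  then show "glue Q Green (pt x) = pt (bb x)" "glue Q Red (pt x) = pt (uu (bb x))" "glue Q Blue (pt x) = pt (rr (bb x))"
    using * assms by (simp_all add: bb_def uu_def rr_def)
qed

lemma num_fixed_Q: "num_fixed Q = card {x \<in> A. uu (bb x) = x} + card {x \<in> A. bb x = x} + card {x \<in> A. rr (bb x) = x}"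
  using fixed_Q[of "\<lambda>x. uu (bb x)" Red] fixed_Q[of bb Green] fixed_Q[of "\<lambda>x. rr (bb x)" Blue]
  by (simp add: num_fixed_def in_A glue_Q_A)

lemma sum_cycles_Q:
  "(\<Sum>C \<in> vertex_cycles Q. int (card C) - 2) = (\<Sum>D \<in> rows A vv. int (card D) - 2)"
proof -
  have st: "vertex_perm Q (pt y) = pt (vv y) \<and> vv y \<in> A" if "y \<in> A" for y
  proof
    show "vertex_perm Q (pt y) = pt (vv y)"
      using vertex_perm_Q[OF A_tri[OF that]] pt_a[of "V y"] vv_eq[OF that] by (simp add: V_a)
    show "vv y \<in> A" using that by (simp add: vv_A)
  qed
  have o: "orbit (vertex_perm Q) (pt x) = pt ` orbit vv x" if "x \<in> A" for x
    by (rule orbit_semiconj[where A = A and h = pt and f = vv and g = "vertex_perm Q", OF st that])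
  have vc: "vertex_cycles Q = (`) pt ` rows A vv"
    unfolding vertex_cycles_def pt_A[symmetric] rows_def image_image by (rule image_cong[OF refl o])
  have sub: "D \<subseteq> A" if "D \<in> rows A vv" for D by (rule row_subset[OF vv_permutes that])
  have inj: "inj_on ((`) pt) (rows A vv)"
  proof (rule inj_onI)
    fix D D' assume D: "D \<in> rows A vv" "D' \<in> rows A vv" "pt ` D = pt ` D'"
    show "D = D'" by (rule iffD1[OF inj_on_image_eq_iff[OF pt_inj sub[OF D(1)] sub[OF D(2)]] D(3)])
  qed
  have "(\<Sum>C \<in> vertex_cycles Q. int (card C) - 2) = (\<Sum>D \<in> rows A vv. int (card (pt ` D)) - 2)"
    unfolding vc by (simp add: sum.reindex[OF inj])
  also have "\<dots> = (\<Sum>D \<in> rows A vv. int (card D) - 2)"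
    by (rule sum.cong[OF refl]) (simp add: card_image[OF inj_on_subset[OF pt_inj sub]])
  finally show ?thesis .
qed

text \<open>In the genus formula of the quotient the long cycle contributes \<open>d - 2\<close>,
  and every fixed point of \<open>vv\<close> or of a gluing contributes -1; the total -4 gives
  \<open>d + 2\<close> poles. As \<open>vv \<circ> vv\<close> takes \<open>rr (uu x)\<close> to
  \<open>uu (rr x)\<close>, the singular squares correspond to the points moved by
  \<open>vv \<circ> vv\<close>, which on \<open>A\<close> is \<open>V \<circ> V\<close>.\<close>

lemma hyp_A:
  assumes Z: "{x \<in> A. V (V x) \<noteq> x} \<in> rows A vv" "card {x \<in> A. V (V x) \<noteq> x} = d"
  shows "hyp A rr uu bb d"
proof -
  have Zv: "{x \<in> A. V (V x) \<noteq> x} = {x \<in> A. vv (vv x) \<noteq> x}" using vv_vv by auto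
  have "int (card {x \<in> A. vv x = x}) + int (num_fixed Q) = int d + 2"
    using genus sum_rows_minus_two[OF finite_A vv_permutes Zv Z(1)] Z(2)
    unfolding has_genus_def sum_cycle_type sum_cycles_Q by simp
  then have poles: "d + 2 = card {x \<in> A. bb x = x} + card {x \<in> A. uu (bb x) = x}
      + card {x \<in> A. rr (bb x) = x} + card {x \<in> A. uu (rr (bb x)) = x}"
    unfolding num_fixed_Q vv_def by linarith
  have i: "rr (bb (rr x)) = bb x" "uu (bb (uu x)) = bb x" "bb (bb x) = x" for x
    using inverts_bb by (simp_all add: inverts_def)
  have "vv (vv (rr (uu x))) = uu (rr x)" for x
    unfolding vv_def by (simp add: i)
  then have "card {x \<in> A. uu (rr x) \<noteq> rr (uu x)} = card {x \<in> A. vv (vv (rr (uu x))) \<noteq> rr (uu x)}" by simp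
  also have "\<dots> = card {x \<in> A. vv (vv (rr x)) \<noteq> rr x}" by (rule permutes_card_preimage[OF uu_permutes])
  also have "\<dots> = card {x \<in> A. vv (vv x) \<noteq> x}" by (rule permutes_card_preimage[OF rr_permutes])
  finally have sing: "card {x \<in> A. uu (rr x) \<noteq> rr (uu x)} = d" using Z(2) Zv by simp
  have "d > 0" using row_nonempty[OF Z(1)] finite_A Z(2) by (auto simp: card_gt_0_iff)
  then show ?thesis
    unfolding hyp_def using origami_A bb_permutes inverts_bb sing poles by simp
qed

section \<open>Long cycles of the vertex permutation and the value of \<open>d\<close>\<close>

lemma vertex_cycles_rows: "vertex_cycles S = rows (triangles S) V"
  by (simp add: vertex_cycles_def rows_def)

text \<open>\<open>V\<close> alternates between \<open>A\<close> and \<open>B\<close>.\<close>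

lemma half_cycle:
  assumes C: "C \<in> vertex_cycles S"
  shows "card C = 2 * card (C \<inter> A)"
proof -
  have Cr: "C \<in> rows (triangles S) V" using C vertex_cycles_rows by simp
  have sub: "C \<subseteq> triangles S" by (rule row_subset[OF V_permutes Cr])
  have fC: "finite C" using sub finite_tri finite_subset by blast
  have VC: "V x \<in> C \<longleftrightarrow> x \<in> C" for x by (rule row_step_iff[OF finite_tri V_permutes Cr])
  have inj: "inj_on V Y" for Y using permutes_inj[OF V_permutes] inj_on_subset by blast
  have "card (C \<inter> A) \<le> card (C \<inter> B)"
    by (rule card_inj_on_le[OF inj]) (use VC V_A fC in auto)
  moreover have "card (C \<inter> B) \<le> card (C \<inter> A)"
    by (rule card_inj_on_le[OF inj]) (use VC V_B fC in auto)
  moreover have "card C = card (C \<inter> A) + card (C \<inter> B)"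
  proof -
    have "C = (C \<inter> A) \<union> (C \<inter> B)" using sub AB(1) by blast
    moreover have "card ((C \<inter> A) \<union> (C \<inter> B)) = card (C \<inter> A) + card (C \<inter> B)"
      by (rule card_Un_disjoint) (use fC AB(2) in auto)
    ultimately show ?thesis by simp
  qed
  ultimately show ?thesis by simp
qed

text \<open>Two points of \<open>A\<close> are an even number of steps of \<open>V\<close> apart,
  and on \<open>A\<close> two steps of \<open>V\<close> are two steps of \<open>vv\<close>.\<close>

lemma same_cycle:
  assumes "x \<in> A" "y \<in> A" "y \<in> orbit V x"
  shows "y \<in> orbit vv x"
proof -
  have "y \<in> {(V ^^ n) x | n. True}" using assms(3) permutes_orbit_altdef[OF finite_tri V_permutes] by simp
  then obtain n where n: "y = (V ^^ n) x" by blast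
  have ev: "(V ^^ (2 * k)) x = (vv ^^ (2 * k)) x \<and> (V ^^ (2 * k)) x \<in> A" for k
  proof (induction k)
    case (Suc k)
    let ?z = "(V ^^ (2 * k)) x"
    have z: "(vv ^^ (2 * k)) x = ?z" "?z \<in> A"
      by (rule conjunct1[OF Suc, symmetric]) (rule conjunct2[OF Suc])
    have "(V ^^ (2 * Suc k)) x = V (V ?z)" "(vv ^^ (2 * Suc k)) x = vv (vv ((vv ^^ (2 * k)) x))" by simp_all
    moreover have "V (V ?z) \<in> A" using z(2) V_A V_B by blast
    ultimately show ?case using vv_vv[OF z(2)] unfolding z(1) by simp
  qed (use assms(1) in simp)
  have "even n"
  proof (rule ccontr)
    assume "odd n"
    then obtain k where "n = Suc (2 * k)" by (metis oddE Suc_eq_plus1)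
    then have "y = V ((V ^^ (2 * k)) x)" using n by simp
    then have "y \<in> B" using V_A[OF conjunct2[OF ev[of k]]] by (simp only:)
    then show False using assms(2) not_both by blast
  qed
  then obtain k where "n = 2 * k" by blast
  then have "y = (vv ^^ (2 * k)) x" using n ev by simp
  then show ?thesis using permutes_orbit_altdef[OF finite_A vv_permutes, of x] by blast
qed

lemma card_A: "2 * card A = sum_mset (cycle_type S)"
proof -
  have "card (triangles S) = card {x \<in> triangles S. True}" by simp
  also have "\<dots> = (\<Sum>C \<in> vertex_cycles S. card {x \<in> C. True})"
    unfolding vertex_cycles_rows by (rule card_split_rows[OF finite_tri V_permutes])
  also have "\<dots> = sum_mset (cycle_type S)" using sum_cycle_type[of "\<lambda>i. i" S] by simp
  finally have t: "card (triangles S) = sum_mset (cycle_type S)" .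
  have "card B = card A" using AB(3)[of Green] glue_inj card_image[of G A] by (auto simp: inj_on_def)
  moreover have "card (A \<union> B) = card A + card B"
    by (rule card_Un_disjoint) (use finite_A finite_tri AB in \<open>auto intro: finite_subset\<close>)
  ultimately show ?thesis using t AB(1) by simp
qed

lemma card_cycles: "card {C \<in> vertex_cycles S. card C = k} = count (cycle_type S) k"
proof -
  have fin: "finite (vertex_cycles S)" using finite_tri by (simp add: vertex_cycles_def)
  have "count (cycle_type S) k = (\<Sum>C \<in> card -` {k} \<inter> vertex_cycles S. 1)"
    unfolding cycle_type_def count_image_mset using fin by (intro sum.cong) auto
  also have "\<dots> = card {C \<in> vertex_cycles S. card C = k}"
    by (simp add: vimage_def Int_def conj_commute)
  finally show ?thesis by simp
qed

lemma cycle_length: "C \<in> vertex_cycles S \<Longrightarrow> card C \<in># cycle_type S"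
  using finite_tri by (simp add: cycle_type_def vertex_cycles_def)

lemma long_cycles:
  assumes ct: "set_mset (cycle_type S) \<subseteq> {2, k}" "k > 2" and x: "x \<in> triangles S"
  shows "V (V x) \<noteq> x \<longleftrightarrow> card (orbit V x) = k"
proof -
  have "orbit V x \<in> vertex_cycles S" using x by (simp add: vertex_cycles_def)
  then have "card (orbit V x) = 2 \<or> card (orbit V x) = k" using cycle_length ct(1) by blast
  then show ?thesis
    using orbit_two[OF finite_tri V_permutes, of x] orbit_le_two[of V x] ct(2) by auto
qed

lemma Z_row:
  assumes z: "z \<in> A" "V (V z) \<noteq> z" and tr: "\<And>y. y \<in> A \<Longrightarrow> V (V y) \<noteq> y \<Longrightarrow> y \<in> orbit vv z"
  shows "{x \<in> A. V (V x) \<noteq> x} \<in> rows A vv"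
proof -
  have "orbit vv z \<subseteq> {x \<in> A. V (V x) \<noteq> x}"
  proof (rule orbit_subset_closed)
    fix y assume y: "y \<in> {x \<in> A. V (V x) \<noteq> x}"
    then have yA: "y \<in> A" "vv y \<in> A" using permutes_in_image[OF vv_permutes] by auto
    have "vv (vv (vv y)) \<noteq> vv y"
    proof
      assume "vv (vv (vv y)) = vv y"
      then have "vv (vv y) = y" using permutes_inj[OF vv_permutes] by (simp add: inj_eq)
      then show False using y vv_vv[OF yA(1)] by simp
    qed
    then show "vv y \<in> {x \<in> A. V (V x) \<noteq> x}" using yA vv_vv[OF yA(2)] by simp
  qed (use z in simp)
  then have "{x \<in> A. V (V x) \<noteq> x} = orbit vv z" using tr by blast
  then show ?thesis using z(1) unfolding rows_def by blast
qed

text \<open>Half of the cycle of length \<open>4 * g - 2\<close> lies in \<open>A\<close>, and by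
  \<open>same_cycle\<close> it is a single cycle of \<open>vv\<close>.\<close>

lemma hyp_one:
  assumes ct: "cycle_type S = profile_one m g" and g: "g \<ge> 2"
  shows "hyp A rr uu bb (2 * g - 1)" "card A = m + (2 * g - 1)"
proof -
  let ?k = "4 * g - 2"
  have k: "?k > 2" using g by simp
  have set_ct: "set_mset (cycle_type S) \<subseteq> {2, ?k}" unfolding ct profile_one_def by auto
  have "card {C \<in> vertex_cycles S. card C = ?k} = 1"
    unfolding card_cycles ct profile_one_def using k by simp
  then obtain P where P: "{C \<in> vertex_cycles S. card C = ?k} = {P}" by (rule card_1_singletonE)
  then have PV: "P \<in> vertex_cycles S" "card P = ?k" by auto
  have Pr: "P \<in> rows (triangles S) V" using PV vertex_cycles_rows by simp
  have Zx: "V (V x) \<noteq> x \<longleftrightarrow> x \<in> P" if "x \<in> triangles S" for x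
  proof -
    have "orbit V x \<in> vertex_cycles S" using that by (simp add: vertex_cycles_def)
    then have "card (orbit V x) = ?k \<longleftrightarrow> orbit V x = P" using P by blast
    also have "\<dots> \<longleftrightarrow> x \<in> P"
      using row_eq_orbit[OF finite_tri V_permutes Pr, of x] permutes_self_in_orbit[OF finite_tri V_permutes, of x] by blast
    finally show ?thesis using long_cycles[OF set_ct k that] by simp
  qed
  have ZP: "{x \<in> A. V (V x) \<noteq> x} = P \<inter> A" using Zx A_tri by auto
  have cP: "card (P \<inter> A) = 2 * g - 1" using half_cycle[OF PV(1)] PV(2) g by simp
  then have "P \<inter> A \<noteq> {}" using g by auto
  then obtain z where z: "z \<in> P" "z \<in> A" by blast
  have "{x \<in> A. V (V x) \<noteq> x} \<in> rows A vv"
  proof (rule Z_row[OF z(2)])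
    show "V (V z) \<noteq> z" using Zx[OF A_tri[OF z(2)]] z(1) by blast
    fix y assume y: "y \<in> A" "V (V y) \<noteq> y"
    then have "y \<in> P" using Zx[OF A_tri[OF y(1)]] by blast
    then have "y \<in> orbit V z" using row_eq_orbit[OF finite_tri V_permutes Pr z(1)] by simp
    then show "y \<in> orbit vv z" by (rule same_cycle[OF z(2) y(1)])
  qed
  then show "hyp A rr uu bb (2 * g - 1)" by (rule hyp_A) (simp add: ZP cP)
  show "card A = m + (2 * g - 1)" using card_A g unfolding ct profile_one_def by simp
qed

text \<open>Each long cycle has \<open>g\<close> points in \<open>A\<close>. Since \<open>vv\<close>
  is \<open>V \<circ> a\<close> on \<open>A\<close> and \<open>a\<close> exchanges the long cycles,
  \<open>vv\<close> steps from one half to the other and joins them to one cycle of length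
  \<open>2 * g\<close>.\<close>

lemma hyp_two:
  assumes ct: "cycle_type S = profile_two m g" and g: "g \<ge> 2"
    and PQ: "P \<noteq> P'" "{C \<in> vertex_cycles S. card C = 2 * g} = {P, P'}" "a ` P = P'"
  shows "hyp A rr uu bb (2 * g)" "card A = m + 2 * g"
proof -
  let ?k = "2 * g"
  have k: "?k > 2" using g by simp
  have set_ct: "set_mset (cycle_type S) \<subseteq> {2, ?k}" unfolding ct profile_two_def by auto
  have PV: "P \<in> vertex_cycles S" "card P = ?k" "P' \<in> vertex_cycles S" "card P' = ?k" using PQ(2) by auto
  have Pr: "P \<in> rows (triangles S) V" "P' \<in> rows (triangles S) V" using PV vertex_cycles_rows by auto
  have Zx: "V (V x) \<noteq> x \<longleftrightarrow> x \<in> P \<or> x \<in> P'" if "x \<in> triangles S" for x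
  proof -
    have "orbit V x \<in> vertex_cycles S" using that by (simp add: vertex_cycles_def)
    then have "card (orbit V x) = ?k \<longleftrightarrow> orbit V x = P \<or> orbit V x = P'" using PQ(2) by blast
    also have "\<dots> \<longleftrightarrow> x \<in> P \<or> x \<in> P'"
      using row_eq_orbit[OF finite_tri V_permutes Pr(1), of x] row_eq_orbit[OF finite_tri V_permutes Pr(2), of x]
        permutes_self_in_orbit[OF finite_tri V_permutes, of x] by blast
    finally show ?thesis using long_cycles[OF set_ct k that] by simp
  qed
  have ZP: "{x \<in> A. V (V x) \<noteq> x} = (P \<inter> A) \<union> (P' \<inter> A)" using Zx A_tri by auto
  have cP: "card (P \<inter> A) = g" "card (P' \<inter> A) = g"
    using half_cycle[OF PV(1)] half_cycle[OF PV(3)] PV(2,4) by simp_all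
  have "P \<inter> P' = {}" using rows_disjoint[OF finite_tri V_permutes Pr] PQ(1) by blast
  then have "card ((P \<inter> A) \<union> (P' \<inter> A)) = card (P \<inter> A) + card (P' \<inter> A)"
    using finite_A by (intro card_Un_disjoint) auto
  then have cZ: "card {x \<in> A. V (V x) \<noteq> x} = 2 * g" using ZP cP by simp
  have "P \<inter> A \<noteq> {}" using cP g by auto
  then obtain z where z: "z \<in> P" "z \<in> A" by blast
  have vz: "vv z \<in> P'" "vv z \<in> A"
  proof -
    have "a z \<in> P'" using z PQ(3) by blast
    then show "vv z \<in> P'"
      using vv_eq[OF z(2)] row_step_iff[OF finite_tri V_permutes Pr(2), of "a z"] by simp
    show "vv z \<in> A" using z permutes_in_image[OF vv_permutes] by simp
  qed
  have "{x \<in> A. V (V x) \<noteq> x} \<in> rows A vv"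
  proof (rule Z_row[OF z(2)])
    show "V (V z) \<noteq> z" using Zx[OF A_tri[OF z(2)]] z(1) by blast
    fix y assume y: "y \<in> A" "V (V y) \<noteq> y"
    then have "y \<in> P \<or> y \<in> P'" using Zx[OF A_tri[OF y(1)]] by blast
    then show "y \<in> orbit vv z"
    proof
      assume "y \<in> P"
      then have "y \<in> orbit V z" using row_eq_orbit[OF finite_tri V_permutes Pr(1) z(1)] by simp
      then show ?thesis by (rule same_cycle[OF z(2) y(1)])
    next
      assume "y \<in> P'"
      then have "y \<in> orbit V (vv z)" using row_eq_orbit[OF finite_tri V_permutes Pr(2) vz(1)] by simp
      then have "y \<in> orbit vv (vv z)" by (rule same_cycle[OF vz(2) y(1)])
      then show ?thesis using permutes_orbit_eq[OF finite_A vv_permutes orbit.base, of z] by simp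
    qed
  qed
  then show "hyp A rr uu bb (2 * g)" by (rule hyp_A) (rule cZ)
  show "card A = m + 2 * g" using card_A g unfolding ct profile_two_def by simp
qed

end

section \<open>Transfer to isomorphism classes and the theorem\<close>

lemma iso_cycle_type:
  assumes "(S, T) \<in> iso_rel"
  shows "cycle_type T = cycle_type S"
proof -
  obtain \<sigma> where s: "\<sigma> permutes triangles S" "\<And>c. glue T c = \<sigma> \<circ> glue S c \<circ> pinv \<sigma>"
    and tri: "triangles S = triangles T"
    using assms unfolding iso_rel_def by blast
  have st: "vertex_perm T (\<sigma> y) = \<sigma> (vertex_perm S y)" for y
    using permutes_inverses[OF s(1)] by (simp add: vertex_perm_def s(2))
  have o: "orbit (vertex_perm T) (\<sigma> x) = \<sigma> ` orbit (vertex_perm S) x" for x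
    by (rule orbit_semiconj[where A = UNIV]) (use st in auto)
  have inj: "inj \<sigma>" by (rule permutes_inj[OF s(1)])
  have "vertex_cycles T = orbit (vertex_perm T) ` \<sigma> ` triangles S"
    using permutes_image[OF s(1)] tri by (simp add: vertex_cycles_def)
  also have "\<dots> = (`) \<sigma> ` vertex_cycles S" by (simp add: vertex_cycles_def image_image o)
  finally have vc: "vertex_cycles T = (`) \<sigma> ` vertex_cycles S" .
  have "inj_on ((`) \<sigma>) (vertex_cycles S)"
    by (rule inj_onI) (simp add: inj_image_eq_iff[OF inj])
  then have "mset_set (vertex_cycles T) = image_mset ((`) \<sigma>) (mset_set (vertex_cycles S))"
    unfolding vc by (simp add: image_mset_mset_set)
  then show ?thesis
    by (simp add: cycle_type_def image_mset.compositionality comp_def card_image inj_on_subset[OF inj])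
qed

lemma iso_Abelian:
  assumes "(S, T) \<in> iso_rel" "Abelian S"
  shows "Abelian T"
proof -
  obtain \<sigma> where s: "\<sigma> permutes triangles S" "\<And>c. glue T c = \<sigma> \<circ> glue S c \<circ> pinv \<sigma>"
    and tri: "triangles S = triangles T" using assms(1) unfolding iso_rel_def by blast
  obtain A B where AB: "A \<union> B = triangles S" "A \<inter> B = {}" "\<forall>c. glue S c ` A = B"
    using assms(2) by (auto simp: Abelian_def)
  have "\<sigma> ` A \<union> \<sigma> ` B = triangles T"
    using permutes_image[OF s(1)] AB(1) tri by (metis image_Un)
  moreover have "\<sigma> ` A \<inter> \<sigma> ` B = {}"
    using image_Int[OF permutes_inj[OF s(1)]] AB(2) by (metis image_empty)
  moreover have "glue T c ` \<sigma> ` A = \<sigma> ` B" for c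
  proof -
    have "glue T c ` \<sigma> ` A = \<sigma> ` glue S c ` A"
      unfolding s(2) using permutes_inverses[OF s(1)] by (simp add: image_image)
    then show ?thesis using AB(3) by simp
  qed
  ultimately show ?thesis unfolding Abelian_def by blast
qed

lemma ST_Ab_member:
  assumes "K \<in> ST_Ab \<mu>" "S \<in> K"
  shows "S \<in> square_tiled_surfaces" "cycle_type S = \<mu>" "Abelian S" "K = iso_rel `` {S}"
proof -
  obtain T where T: "T \<in> square_tiled_surfaces" "profile T = (\<mu>, 0)" "Abelian T" "K = iso_rel `` {T}"
    using assms(1) by (auto simp: ST_Ab_def quotient_def)
  have TS: "(T, S) \<in> iso_rel" using assms(2) T(4) by simp
  show "S \<in> square_tiled_surfaces" using TS by (auto simp: iso_rel_def)
  show "cycle_type S = \<mu>" using iso_cycle_type[OF TS] T(2) by (simp add: profile_def)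
  show "Abelian S" by (rule iso_Abelian[OF TS T(3)])
  show "K = iso_rel `` {S}" using equiv_class_eq[OF iso_equiv TS] T(4) by simp
qed

lemma ST_Ab_hyp_one_rep:
  assumes "K \<in> ST_Ab_hyp_one m g" "g \<ge> 2"
  shows "\<exists>S (X :: nat set) r u b. K = iso_rel `` {S} \<and> rep S X r u \<and> hyp X r u b (2 * g - 1) \<and> card X = m + (2 * g - 1)"
proof -
  obtain S where S: "K \<in> ST_Ab (profile_one m g)" "S \<in> K" "hyperelliptic S"
    using assms(1) by (auto simp: ST_Ab_hyp_one_def)
  note m = ST_Ab_member[OF S(1,2)]
  obtain A B where AB: "A \<union> B = triangles S" "A \<inter> B = {}" "\<And>c. glue S c ` A = B"
    using m(3) by (auto simp: Abelian_def)
  obtain a where a: "hyperelliptic_involution S a" using S(3) by (auto simp: hyperelliptic_def)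
  interpret hyp_surface S A B a by unfold_locales (use m(1) AB a in auto)
  show ?thesis using m(4) rep_A hyp_one[OF m(2) assms(2)] by blast
qed

lemma ST_Ab_hyp_two_rep:
  assumes "K \<in> ST_Ab_hyp_two m g" "g \<ge> 2"
  shows "\<exists>S (X :: nat set) r u b. K = iso_rel `` {S} \<and> rep S X r u \<and> hyp X r u b (2 * g) \<and> card X = m + 2 * g"
proof -
  have "\<exists>S \<in> K. hyperelliptic S \<and> (\<exists>\<alpha> P Q. hyperelliptic_involution S \<alpha> \<and>
      P \<noteq> Q \<and> {Z \<in> vertex_cycles S. card Z = 2 * g} = {P, Q} \<and> \<alpha> ` P = Q \<and> \<alpha> ` Q = P)"
    and K: "K \<in> ST_Ab (profile_two m g)"
    using assms(1) unfolding ST_Ab_hyp_two_def by simp_all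
  then obtain S where SK: "S \<in> K" and ex: "\<exists>a P P'. hyperelliptic_involution S a \<and>
      P \<noteq> P' \<and> {Z \<in> vertex_cycles S. card Z = 2 * g} = {P, P'} \<and> a ` P = P' \<and> a ` P' = P"
    by (elim bexE conjE) (rule that)
  obtain a P P' where ap: "hyperelliptic_involution S a \<and>
      P \<noteq> P' \<and> {Z \<in> vertex_cycles S. card Z = 2 * g} = {P, P'} \<and> a ` P = P' \<and> a ` P' = P"
    using ex by (elim exE) (rule that)
  then have a: "hyperelliptic_involution S a"
    and P: "P \<noteq> P'" "{Z \<in> vertex_cycles S. card Z = 2 * g} = {P, P'}" "a ` P = P'" by simp_all
  note m = ST_Ab_member[OF K SK]
  obtain A B where AB: "A \<union> B = triangles S" "A \<inter> B = {}" "\<And>c. glue S c ` A = B"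
    using m(3) by (auto simp: Abelian_def)
  interpret hyp_surface S A B a by unfold_locales (use m(1) AB a in auto)
  show ?thesis using m(4) rep_A hyp_two[OF m(2) assms(2) P] by blast
qed

theorem theorem1p6:
  shows "\<exists>C::real. C > 0 \<and>
    (\<forall>(g::nat) (m::nat) ST. g \<ge> 2 \<longrightarrow> ST = ST_Ab_hyp_one m g \<or> ST = ST_Ab_hyp_two m g \<longrightarrow>
       (\<forall>K \<in> ST. \<forall>L \<in> ST. \<exists>N::nat. real N \<le> C * real g \<and> (K, L) \<in> cylinder_move ^^ N))"
proof (intro exI[of _ "32::real"] conjI allI impI ballI)
  fix g m :: nat and ST K L
  assume g: "2 \<le> g" and ST: "ST = ST_Ab_hyp_one m g \<or> ST = ST_Ab_hyp_two m g" and KL: "K \<in> ST" "L \<in> ST"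
  \<comment> \<open>\<open>g \<ge> 2\<close> gives \<open>d \<ge> 3\<close>, hence the third block
    that \<open>star_normalise\<close> relies on.\<close>
  have "\<exists>d. 3 \<le> d \<and> d \<le> 2 * g \<and> (\<forall>K \<in> ST. \<exists>S (X :: nat set) r u b. K = iso_rel `` {S} \<and> rep S X r u \<and> hyp X r u b d \<and> card X = m + d)"
    using ST
  proof
    assume "ST = ST_Ab_hyp_one m g"
    then show ?thesis using ST_Ab_hyp_one_rep[OF _ g] g by (intro exI[of _ "2 * g - 1"]) auto
  next
    assume "ST = ST_Ab_hyp_two m g"
    then show ?thesis using ST_Ab_hyp_two_rep[OF _ g] g by (intro exI[of _ "2 * g"]) auto
  qed
  then obtain d where d: "3 \<le> d" "d \<le> 2 * g"
    and R: "\<forall>K \<in> ST. \<exists>S (X :: nat set) r u b. K = iso_rel `` {S} \<and> rep S X r u \<and> hyp X r u b d \<and> card X = m + d"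
    by (elim exE conjE)
  obtain S and X :: "nat set" and r u b
    where "K = iso_rel `` {S} \<and> rep S X r u \<and> hyp X r u b d \<and> card X = m + d"
    using bspec[OF R KL(1)] by (elim exE) (rule that)
  then have S: "K = iso_rel `` {S}" "rep S X r u" "hyp X r u b d" "card X = m + d" by simp_all
  obtain T and Y :: "nat set" and s v b'
    where "L = iso_rel `` {T} \<and> rep T Y s v \<and> hyp Y s v b' d \<and> card Y = m + d"
    using bspec[OF R KL(2)] by (elim exE) (rule that)
  then have T: "L = iso_rel `` {T}" "rep T Y s v" "hyp Y s v b' d" "card Y = m + d" by simp_all
  have cXY: "card X = card Y" using S(4) T(4) by simp
  obtain N where N: "N \<le> 16 * d" "(K, L) \<in> cylinder_move ^^ N"
    using rep_connected[OF S(2,3) T(2,3) cXY d(1)] unfolding S(1) T(1) by blast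
  \<comment> \<open>At most \<open>16 * d\<close> moves, with \<open>d \<le> 2 * g\<close>.\<close>
  have "real N \<le> real (32 * g)" using N(1) d(2) by (intro of_nat_mono) linarith
  then show "\<exists>N::nat. real N \<le> 32 * real g \<and> (K, L) \<in> cylinder_move ^^ N"
    using N(2) by auto
qed simp

end
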